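(* Let $\Gamma$ be an arbitrary Coxeter graph (with finite vertex set) and let $A(\Gamma)$ be the associated Artin group. Then $$H_2(A(\Gamma);\mathbb{Z}_2)\cong\mathbb{Z}_2^{\,p(\Gamma)+q(\Gamma)},$$ where $p(\Gamma)$ and $q(\Gamma)$ are the non-negative integers associated to $\Gamma$ defined in the context.
   Context: $\mathbb{Z}_2=\mathbb{Z}/2\mathbb{Z}$. A Coxeter graph $\Gamma$ with finite vertex set $S$ encodes a symmetric matrix $(m(s,t))_{s,t\in S}$ with $m(s,s)=1$ and $m(s,t)=m(t,s)\in\{2,3,\dots\}\cup\{\infty\}$ for $s\ne t$: the edges are the pairs $\{s,t\}$ with $m(s,t)\ge 3$, labeled by $m(s,t)$ when $m(s,t)\geq 4$. For letters $x,y$ and $m\ge 2$, $(xy)_m$ denotes the alternating word $xyx\cdots$ of length $m$. The Artin group is $A(\Gamma)=\langle a_s\ (s\in S)\mid (a_sa_t)_{m(s,t)}=(a_ta_s)_{m(s,t)}\text{ for distinct } s,t \text{ with } m(s,t)<\infty\rangle$. $\Gamma_{odd}$ is the subgraph of $\Gamma$ with vertex set $S$ and with edges the pairs $\{s,t\}$, $s\neq t$, with $m(s,t)$ odd (and finite), viewed as a 1-dimensional CW-complex. $P(\Gamma)=\{\{s,t\}\subset S\mid m(s,t)=2\}$. Write $\{s,t\}\equiv\{s',t'\}$ for two pairs in $P(\Gamma)$ if $s=s'$ and $m(t,t')$ is odd; let $\sim$ be the equivalence relation on $P(\Gamma)$ generated by $\equiv$. A class in $P(\Gamma)/\!\sim$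 is called a torsion class if it is represented by some $\{s,t\}\in P(\Gamma)$ for which there is $v\in S$ with $m(s,v)=m(t,v)=3$. Define: $p(\Gamma)$ = number of torsion classes in $P(\Gamma)/\!\sim$; $q_1(\Gamma)$ = number of non-torsion classes in $P(\Gamma)/\!\sim$; $q_2(\Gamma)=\#\{\{s,t\}\subset S\mid m(s,t)\ge 4 \text{ is (finite and) even}\}$; $q_3(\Gamma)=\operatorname{rank}H_1(\Gamma_{odd};\mathbb{Z})$; $q(\Gamma)=q_1(\Gamma)+q_2(\Gamma)+q_3(\Gamma)$. *)

theory Defs
  imports "HOL-Homology.Homology" "HOL-Library.Extended_Nat" "HOL-Library.Z2"
begin

section \<open>Groups given by generators and relations\<close>

text \<open>
  The letter \<open>(x, True)\<close> stands for the generator \<open>x\<close> and \<open>(x, False)\<close> for its inverse.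
\<close>

type_synonym 'a word = "('a \<times> bool) list"

abbreviation words_over :: "'a set \<Rightarrow> 'a word set"
  where "words_over X \<equiv> lists (X \<times> UNIV)"

inductive_set pres_rel :: "'a set \<Rightarrow> ('a word \<times> 'a word) set \<Rightarrow> ('a word \<times> 'a word) set"
  for X :: "'a set" and R :: "('a word \<times> 'a word) set"
  where
    refl: "u \<in> words_over X \<Longrightarrow> (u, u) \<in> pres_rel X R"
  | sym: "(u, v) \<in> pres_rel X R \<Longrightarrow> (v, u) \<in> pres_rel X R"
  | trans: "(u, v) \<in> pres_rel X R \<Longrightarrow> (v, w) \<in> pres_rel X R \<Longrightarrow> (u, w) \<in> pres_rel X R"
  | cancel: "\<lbrakk>x \<in> X; u \<in> words_over X; v \<in> words_over X\<rbrakk>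
      \<Longrightarrow> (u @ [(x, b), (x, \<not> b)] @ v, u @ v) \<in> pres_rel X R"
  | relator: "\<lbrakk>(l, r) \<in> R; l \<in> words_over X; r \<in> words_over X;
               u \<in> words_over X; v \<in> words_over X\<rbrakk>
      \<Longrightarrow> (u @ l @ v, u @ r @ v) \<in> pres_rel X R"

definition presented_group :: "'a set \<Rightarrow> ('a word \<times> 'a word) set \<Rightarrow> 'a word set monoid"
  where "presented_group X R =
    \<lparr>carrier = words_over X // pres_rel X R,
     monoid.mult = (\<lambda>A B. \<Union>u\<in>A. \<Union>v\<in>B. pres_rel X R `` {u @ v}),
     one = pres_rel X R `` {[]}\<rparr>"

lemma equiv_pres_rel: "equiv (words_over X) (pres_rel X R)"
proof (rule equivI)
  show "pres_rel X R \<subseteq> words_over X \<times> words_over X"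
  proof clarify
    fix a b assume "(a, b) \<in> pres_rel X R"
    then show "a \<in> words_over X \<and> b \<in> words_over X" by induction auto
  qed
  show "refl_on (words_over X) (pres_rel X R)"
    by (auto simp: refl_on_def intro: pres_rel.refl)
  show "sym (pres_rel X R)"
    by (auto simp: sym_def intro: pres_rel.sym)
  show "trans (pres_rel X R)"
    by (auto simp: trans_def intro: pres_rel.trans)
qed

lemma pres_rel_words: "(u, v) \<in> pres_rel X R \<Longrightarrow> u \<in> words_over X \<and> v \<in> words_over X"
  by (induction rule: pres_rel.induct) auto

lemma pres_rel_context:
  assumes "(u, v) \<in> pres_rel X R" "a \<in> words_over X" "b \<in> words_over X"
  shows "(a @ u @ b, a @ v @ b) \<in> pres_rel X R"
  using assms
proof (induction rule: pres_rel.induct)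
  case (refl u)
  then show ?case by (intro pres_rel.refl) auto
next
  case (sym u v)
  then show ?case by (blast intro: pres_rel.sym)
next
  case (trans u v w)
  then show ?case by (blast intro: pres_rel.trans)
next
  case (cancel x u v c)
  then show ?case using pres_rel.cancel[of x X "a @ u" "v @ b" c R] by simp
next
  case (relator l r u v)
  then show ?case using pres_rel.relator[of l r R X "a @ u" "v @ b"] by simp
qed

lemma pres_rel_append:
  assumes "(u, u') \<in> pres_rel X R" "(v, v') \<in> pres_rel X R"
  shows "(u @ v, u' @ v') \<in> pres_rel X R"
proof (rule pres_rel.trans)
  show "(u @ v, u' @ v) \<in> pres_rel X R"
    using pres_rel_context[OF assms(1), of "[]" v] pres_rel_words[OF assms(2)] by simp
  show "(u' @ v, u' @ v') \<in> pres_rel X R"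
    using pres_rel_context[OF assms(2), of u' "[]"] pres_rel_words[OF assms(1)] by simp
qed

lemma presented_group_mult:
  assumes "u \<in> words_over X" "v \<in> words_over X"
  shows "(pres_rel X R `` {u}) \<otimes>\<^bsub>presented_group X R\<^esub> (pres_rel X R `` {v}) =
         pres_rel X R `` {u @ v}"
proof -
  have "pres_rel X R `` {a @ b} = pres_rel X R `` {u @ v}"
    if "(u, a) \<in> pres_rel X R" "(v, b) \<in> pres_rel X R" for a b
    using equiv_class_eq[OF equiv_pres_rel pres_rel_append[OF that]] by simp
  moreover have "(u, u) \<in> pres_rel X R" "(v, v) \<in> pres_rel X R"
    using assms by (auto intro: pres_rel.refl)
  ultimately have "(\<Union>a\<in>pres_rel X R `` {u}. \<Union>b\<in>pres_rel X R `` {v}. pres_rel X R `` {a @ b})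
      = pres_rel X R `` {u @ v}" by blast
  then show ?thesis by (simp add: presented_group_def)
qed

lemma group_presented_group: "group (presented_group X R)"
proof (rule groupI)
  let ?G = "presented_group X R" and ?c = "\<lambda>u. pres_rel X R `` {u}"
  have carr: "carrier ?G = ?c ` words_over X"
    by (auto simp: presented_group_def quotient_def)
  have one: "\<one>\<^bsub>?G\<^esub> = ?c []"
    by (simp add: presented_group_def)
  note mult = presented_group_mult[of _ X _ R]
  show "\<one>\<^bsub>?G\<^esub> \<in> carrier ?G"
    by (auto simp: carr one)
  show "A \<otimes>\<^bsub>?G\<^esub> B \<in> carrier ?G" if AB: "A \<in> carrier ?G" "B \<in> carrier ?G" for A B
  proof -
    obtain u v where "u \<in> words_over X" "A = ?c u" "v \<in> words_over X" "B = ?c v"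
      using AB unfolding carr by blast
    then show ?thesis
      using mult[of u v] by (metis (no_types, lifting) append_in_lists_conv carr imageI)
  qed
  show "A \<otimes>\<^bsub>?G\<^esub> B \<otimes>\<^bsub>?G\<^esub> C = A \<otimes>\<^bsub>?G\<^esub> (B \<otimes>\<^bsub>?G\<^esub> C)"
    if ABC: "A \<in> carrier ?G" "B \<in> carrier ?G" "C \<in> carrier ?G" for A B C
  proof -
    obtain u v w where "u \<in> words_over X" "A = ?c u" "v \<in> words_over X" "B = ?c v"
      "w \<in> words_over X" "C = ?c w"
      using ABC unfolding carr by blast
    then show ?thesis
      using mult[of u v] mult[of "u @ v" w] mult[of v w] mult[of u "v @ w"] by simp
  qed
  show "\<one>\<^bsub>?G\<^esub> \<otimes>\<^bsub>?G\<^esub> A = A" if "A \<in> carrier ?G" for A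
    using that mult[of "[]"] by (auto simp: carr one)
  show "\<exists>B\<in>carrier ?G. B \<otimes>\<^bsub>?G\<^esub> A = \<one>\<^bsub>?G\<^esub>" if A: "A \<in> carrier ?G" for A
  proof -
    have "\<exists>v\<in>words_over X. (v @ u, []) \<in> pres_rel X R" if "u \<in> words_over X" for u
      using that
    proof (induction u)
      case Nil
      then show ?case by (auto intro!: bexI[of _ "[]"] pres_rel.refl)
    next
      case (Cons p u)
      obtain x c where p: "p = (x, c)" by (cases p)
      from Cons obtain v where v: "v \<in> words_over X" "(v @ u, []) \<in> pres_rel X R" by blast
      have "(v @ [(x, \<not> c), (x, \<not> \<not> c)] @ u, v @ u) \<in> pres_rel X R"
        by (rule pres_rel.cancel) (use Cons v p in auto)
      then have "((v @ [(x, \<not> c)]) @ p # u, []) \<in> pres_rel X R"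
        using v p by (auto intro: pres_rel.trans)
      moreover have "v @ [(x, \<not> c)] \<in> words_over X" using Cons v p by auto
      ultimately show ?case by blast
    qed
    then obtain u v where "u \<in> words_over X" "A = ?c u" "v \<in> words_over X"
      "(v @ u, []) \<in> pres_rel X R" using A unfolding carr by blast
    then have "?c v \<otimes>\<^bsub>?G\<^esub> A = \<one>\<^bsub>?G\<^esub>"
      using mult[of v u] equiv_class_eq[OF equiv_pres_rel] by (metis one)
    moreover have "?c v \<in> carrier ?G"
      using \<open>v \<in> words_over X\<close> unfolding carr by (rule imageI)
    ultimately show ?thesis by blast
  qed
qed


section \<open>Coxeter matrices and Artin groups\<close>

text \<open>
  A Coxeter graph with vertex set \<open>S\<close> is given by the matrix it encodes.  Only the
  values of \<open>m\<close> on \<open>S \<times> S\<close> are meaningful.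
\<close>

definition coxeter_matrix :: "'s set \<Rightarrow> ('s \<Rightarrow> 's \<Rightarrow> enat) \<Rightarrow> bool"
  where "coxeter_matrix S m \<longleftrightarrow>
    finite S \<and> (\<forall>s\<in>S. m s s = 1) \<and>
    (\<forall>s\<in>S. \<forall>t\<in>S. s \<noteq> t \<longrightarrow> m s t = m t s \<and> 2 \<le> m s t)"

fun alternating :: "'a \<Rightarrow> 'a \<Rightarrow> nat \<Rightarrow> 'a list"
  where
    "alternating x y 0 = []"
  | "alternating x y (Suc n) = x # alternating y x n"

definition artin_relations :: "'s set \<Rightarrow> ('s \<Rightarrow> 's \<Rightarrow> enat) \<Rightarrow> ('s word \<times> 's word) set"
  where "artin_relations S m =
    {(alternating (s, True) (t, True) k, alternating (t, True) (s, True) k) | s t k.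
       s \<in> S \<and> t \<in> S \<and> s \<noteq> t \<and> m s t = enat k}"

definition artin_group :: "'s set \<Rightarrow> ('s \<Rightarrow> 's \<Rightarrow> enat) \<Rightarrow> 's word set monoid"
  where "artin_group S m = presented_group S (artin_relations S m)"


section \<open>Group homology with trivial coefficients\<close>

text \<open>
  \<open>H\<^sub>n(G; M)\<close> for a trivial \<open>G\<close>-module \<open>M\<close>, computed from the (unnormalised,
  inhomogeneous) bar complex.  The module \<open>M\<close> is the additive group of a type \<open>'c\<close>, passed as \<open>TYPE('c)\<close>;
  an \<open>n\<close>-chain is a finite formal sum of tuples \<open>[g\<^sub>1|\<dots>|g\<^sub>n]\<close> with coefficients in \<open>'c\<close>,
  and the boundary is
  \<open>\<partial>[g\<^sub>1|\<dots>|g\<^sub>n] = [g\<^sub>2|\<dots>|g\<^sub>n] + (\<Sum>0<i<n. (-1)\<^sup>i [g\<^sub>1|\<dots>|g\<^sub>i g\<^sub>i\<^sub>+\<^sub>1|\<dots>|g\<^sub>n]) + (-1)\<^sup>n [g\<^sub>1|\<dots>|g\<^sub>n\<^sub>-\<^sub>1]\<close>.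
\<close>

definition bar_chains :: "('g, 'b) monoid_scheme \<Rightarrow> nat \<Rightarrow> ('g list \<Rightarrow>\<^sub>0 'c::ab_group_add) set"
  where "bar_chains G n =
    {c. Poly_Mapping.keys c \<subseteq> {gs. length gs = n \<and> set gs \<subseteq> carrier G}}"

definition bar_face :: "('g, 'b) monoid_scheme \<Rightarrow> nat \<Rightarrow> 'g list \<Rightarrow> 'g list"
  where "bar_face G i gs =
    (if i = 0 then tl gs
     else if i = length gs then butlast gs
     else take (i - 1) gs @ [gs ! (i - 1) \<otimes>\<^bsub>G\<^esub> gs ! i] @ drop (i + 1) gs)"

definition bar_boundary ::
    "('g, 'b) monoid_scheme \<Rightarrow> nat \<Rightarrow> ('g list \<Rightarrow>\<^sub>0 'c::ab_group_add) \<Rightarrow> ('g list \<Rightarrow>\<^sub>0 'c)"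
  where "bar_boundary G n c =
    (if n = 0 then 0
     else \<Sum>gs\<in>Poly_Mapping.keys c. \<Sum>i\<le>n.
       Poly_Mapping.single (bar_face G i gs)
         (if even i then Poly_Mapping.lookup c gs else - Poly_Mapping.lookup c gs))"

definition bar_cycle_group ::
    "('g, 'b) monoid_scheme \<Rightarrow> nat \<Rightarrow> ('g list \<Rightarrow>\<^sub>0 'c::ab_group_add) monoid"
  where "bar_cycle_group G n =
    \<lparr>carrier = {c \<in> bar_chains G n. bar_boundary G n c = 0}, monoid.mult = (+), one = 0\<rparr>"

definition group_homology ::
    "'c itself \<Rightarrow> nat \<Rightarrow> ('g, 'b) monoid_scheme \<Rightarrow> ('g list \<Rightarrow>\<^sub>0 'c::ab_group_add) set monoid"
  where "group_homology M n G =
    bar_cycle_group G n Mod (bar_boundary G (Suc n) ` bar_chains G (Suc n))"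


section \<open>Geometric realisation of a graph and rank of an abelian group\<close>

text \<open>
  Barycentric coordinates: a point is a convex combination of the vertices of a simplex of
  the graph, i.e. of a single vertex or of the two ends of an edge.  For finite \<open>V\<close> the
  product topology induces the CW topology.
\<close>

definition graph_realization :: "'v set \<Rightarrow> 'v set set \<Rightarrow> ('v \<Rightarrow> real) topology"
  where "graph_realization V E = subtopology (powertop_real UNIV)
    {x. (\<forall>v. 0 \<le> x v) \<and> {v. x v \<noteq> 0} \<in> (\<lambda>v. {v}) ` V \<union> E \<and> (\<Sum>v | x v \<noteq> 0. x v) = 1}"

definition int_independent :: "('a, 'b) monoid_scheme \<Rightarrow> 'a set \<Rightarrow> bool"
  where "int_independent G B \<longleftrightarrow>
    finite B \<and> B \<subseteq> carrier G \<and>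
    (\<forall>k :: 'a \<Rightarrow> int. finprod G (\<lambda>b. b [^]\<^bsub>G\<^esub> k b) B = \<one>\<^bsub>G\<^esub> \<longrightarrow> (\<forall>b\<in>B. k b = 0))"

text \<open>Only meaningful for commutative groups of finite rank.\<close>

definition abelian_rank :: "('a, 'b) monoid_scheme \<Rightarrow> nat"
  where "abelian_rank G = Sup {card B | B. int_independent G B}"


section \<open>The numbers \<open>p\<close> and \<open>q\<close>\<close>

text \<open>
  An unordered pair is a two-element set.  In the definitions below \<open>s \<noteq> t\<close> follows from
  the condition on \<open>m s t\<close>, as \<open>m s s = 1\<close>, except in \<open>odd_edges\<close>.
\<close>

definition odd_label :: "enat \<Rightarrow> bool"
  where "odd_label a \<longleftrightarrow> (\<exists>k. a = enat k \<and> odd k)"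

definition even_label :: "enat \<Rightarrow> bool"
  where "even_label a \<longleftrightarrow> (\<exists>k. a = enat k \<and> even k)"

definition commuting_pairs :: "'s set \<Rightarrow> ('s \<Rightarrow> 's \<Rightarrow> enat) \<Rightarrow> 's set set"
  where "commuting_pairs S m = {{s, t} | s t. s \<in> S \<and> t \<in> S \<and> m s t = 2}"

definition pair_step :: "'s set \<Rightarrow> ('s \<Rightarrow> 's \<Rightarrow> enat) \<Rightarrow> ('s set \<times> 's set) set"
  where "pair_step S m =
    {({s, t}, {s, t'}) | s t t'.
       {s, t} \<in> commuting_pairs S m \<and> {s, t'} \<in> commuting_pairs S m \<and> odd_label (m t t')}"

definition pair_equiv :: "'s set \<Rightarrow> ('s \<Rightarrow> 's \<Rightarrow> enat) \<Rightarrow> ('s set \<times> 's set) set"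
  where "pair_equiv S m =
    Restr ((pair_step S m \<union> (pair_step S m)\<inverse>)\<^sup>*) (commuting_pairs S m)"

definition torsion_class :: "'s set \<Rightarrow> ('s \<Rightarrow> 's \<Rightarrow> enat) \<Rightarrow> 's set set \<Rightarrow> bool"
  where "torsion_class S m C \<longleftrightarrow> (\<exists>s t v. {s, t} \<in> C \<and> v \<in> S \<and> m s v = 3 \<and> m t v = 3)"

definition p_num :: "'s set \<Rightarrow> ('s \<Rightarrow> 's \<Rightarrow> enat) \<Rightarrow> nat"
  where "p_num S m = card {C \<in> commuting_pairs S m // pair_equiv S m. torsion_class S m C}"

definition q1_num :: "'s set \<Rightarrow> ('s \<Rightarrow> 's \<Rightarrow> enat) \<Rightarrow> nat"
  where "q1_num S m = card {C \<in> commuting_pairs S m // pair_equiv S m. \<not> torsion_class S m C}"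

definition q2_num :: "'s set \<Rightarrow> ('s \<Rightarrow> 's \<Rightarrow> enat) \<Rightarrow> nat"
  where "q2_num S m = card {{s, t} | s t. s \<in> S \<and> t \<in> S \<and> 4 \<le> m s t \<and> even_label (m s t)}"

definition odd_edges :: "'s set \<Rightarrow> ('s \<Rightarrow> 's \<Rightarrow> enat) \<Rightarrow> 's set set"
  where "odd_edges S m = {{s, t} | s t. s \<in> S \<and> t \<in> S \<and> s \<noteq> t \<and> odd_label (m s t)}"

definition q3_num :: "'s set \<Rightarrow> ('s \<Rightarrow> 's \<Rightarrow> enat) \<Rightarrow> nat"
  where "q3_num S m = abelian_rank (homology_group 1 (graph_realization S (odd_edges S m)))"

definition q_num :: "'s set \<Rightarrow> ('s \<Rightarrow> 's \<Rightarrow> enat) \<Rightarrow> nat"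
  where "q_num S m = q1_num S m + q2_num S m + q3_num S m"

end

theory Submission
  imports Defs
begin

text \<open>
  A 2-cocycle \<open>f\<close> of the Artin group \<open>A\<close> with values in \<open>\<int>\<^sub>2\<close> gives a central extension.  Lifting
  the generators, the two sides of the braid relation of \<open>s\<close> and \<open>t\<close> differ by a sign
  \<open>disc f s t\<close>, and modulo the signs of coboundaries these numbers determine the class of \<open>f\<close>.
  On commuting pairs they are invariant under \<open>\<sim>\<close>, because the commutator of a lift of \<open>s\<close> with
  lifts of elements commuting with \<open>s\<close> is multiplicative.

  Conversely every such sign function \<open>\<phi>\<close> occurs, already for an extension of the
  Coxeter group \<open>W\<close>: one needs a \<open>\<int>\<^sub>2\<close>-valued function on the edges of the Cayley graph of \<open>W\<close>
  whose sum around every dihedral polygon of type \<open>{s, t}\<close> is \<open>\<phi> {s, t}\<close>.  It is built by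
  induction on the length of the highest vertex of an edge; the only obstruction comes from
  the finite parabolic subgroups of rank 3, where it vanishes because the polygons of each type are
  even in number, except in type \<open>A\<^sub>1 \<times> I\<^sub>2(k)\<close> with \<open>k\<close> odd, where two types of squares
  are related by \<open>\<sim>\<close>.

  So the dual of \<open>H\<^sub>2(A; \<int>\<^sub>2)\<close> is the space of \<open>\<sim>\<close>-invariant functions on the pairs with
  finite label, modulo the coboundaries of vertex functions on the odd graph.  The latter quotient
  has the edges outside a spanning forest as a basis, and their number is the rank of \<open>H\<^sub>1\<close>, as adding
  an edge raises this rank if and only if the edge joins two connected vertices.
\<close>

section \<open>Alternating words and Chebyshev coefficients\<close>

text \<open>Why rank 3 suffices: at a chamber \<open>w\<close> with a chosen descent
  \<open>p\<close> the value on the edge of \<open>p\<close> is normalised to \<open>0\<close>, and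
  the polygon of type \<open>{s, p}\<close> then determines the value on the edge of every other
  descent \<open>s\<close>. What remains at \<open>w\<close> is one equation for any two descents
  \<open>s\<close>, \<open>t\<close> different from \<open>p\<close>, and it involves only the coset
  of the parabolic subgroup of \<open>{s, t, p}\<close> with top \<open>w\<close>. A coset with a
  top is finite, so infinite labels and infinite parabolic subgroups impose nothing. The tops must
  be unique and dominate their cosets in length. Both facts are read off from the signs of the
  coordinates of roots (\<open>root_nonneg\<close>), which is why the Coxeter group enters through
  its geometric representation. The Euler relation then becomes a count of chambers by descents. The
  coefficients Z_2 matter twice: edges need no orientation, so the generators of the extension act
  as involutions along the Cayley graph; and chains form a vector space, so a basis of cocycle
  classes determines homology by duality.\<close>

lemma alternating_Suc_right:
  "alternating x y (Suc n) = alternating x y n @ [if even n then x else y]"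
  by (induction n arbitrary: x y) auto

lemma length_alternating [simp]: "length (alternating x y n) = n"
  by (induction n arbitrary: x y) auto

lemma set_alternating: "set (alternating x y n) \<subseteq> {x, y}"
  by (induction n arbitrary: x y) auto

lemma alternating_add:
  "alternating x y (j + k) = alternating x y j @ (if even j then alternating x y k else alternating y x k)"
  by (induction j arbitrary: x y) auto

lemma rev_alternating:
  "rev (alternating x y n) = (if even n then alternating y x n else alternating x y n)"
proof (induction n arbitrary: x y)
  case (Suc n)
  have "rev (alternating x y (Suc n)) = rev (alternating y x n) @ [x]" by simp
  also have "\<dots> = (if even n then alternating x y n else alternating y x n) @ [x]"
    by (simp add: Suc)
  also have "\<dots> = (if even (Suc n) then alternating y x (Suc n) else alternating x y (Suc n))"
    using alternating_Suc_right[of x y n] alternating_Suc_right[of y x n] by simp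
  finally show ?case .
qed simp

lemma alternating_double:
  "alternating x y (2 * n) = alternating x y n @ rev (alternating y x n)"
  using alternating_add[of x y n n] by (simp add: rev_alternating mult_2)

text \<open>\<open>cheb c n\<close> is U_(n-1)(c/2) for the Chebyshev polynomials U of the second
  kind: sin (n \<theta>) / sin \<theta> for c = 2 cos \<theta>, and \<open>n\<close> in the
  degenerate case c = 2, which serves the infinite labels.\<close>

fun cheb :: "real \<Rightarrow> nat \<Rightarrow> real" where
  "cheb c 0 = 0"
| "cheb c (Suc 0) = 1"
| "cheb c (Suc (Suc n)) = c * cheb c (Suc n) - cheb c n"

lemma cheb_cos: "cheb (2 * cos \<theta>) n * sin \<theta> = sin (n * \<theta>)"
proof (induction n rule: induct_nat_012)
  case (ge2 n)
  have "sin ((real n + 1) * \<theta> + \<theta>) + sin ((real n + 1) * \<theta> - \<theta>) = 2 * cos \<theta> * sin ((real n + 1) * \<theta>)"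
    by (simp only: sin_add sin_diff) simp
  then have "sin ((real n + 2) * \<theta>) = 2 * cos \<theta> * sin ((real n + 1) * \<theta>) - sin (real n * \<theta>)"
    by (simp add: algebra_simps)
  then show ?case using ge2 by (simp add: algebra_simps)
qed auto

lemma cheb_2: "cheb 2 n = n"
  by (induction n rule: induct_nat_012) auto

lemma sin_pi_div_pos: "k \<ge> 2 \<Longrightarrow> sin (pi / real k) > 0"
  by (intro sin_gt_zero) (auto simp: field_simps)

lemma cheb_nonneg:
  assumes "k \<ge> 2" "n \<le> k"
  shows "cheb (2 * cos (pi / real k)) n \<ge> 0"
proof -
  have "sin (n * (pi / real k)) \<ge> 0"
    using assms by (intro sin_ge_zero) (auto simp: field_simps)
  then show ?thesis
    using sin_pi_div_pos[OF assms(1)]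
    unfolding cheb_cos[of "pi / real k" n, symmetric] by (simp add: zero_le_mult_iff)
qed

text \<open>Multiplied by 2 sin \<theta> with \<theta> = \<pi>/k, the sum telescopes to a difference
  of cosines at two angles that differ by 2 \<pi>.\<close>

lemma sum_sin_period:
  assumes "k \<ge> 2"
  shows "(\<Sum>i<k. sin ((2 * real i) * (pi / real k) + a)) = 0"
proof -
  define \<theta> where "\<theta> = pi / real k"
  have "2 * sin \<theta> * sin ((2 * real i) * \<theta> + a)
      = cos ((2 * real i - 1) * \<theta> + a) - cos ((2 * real (Suc i) - 1) * \<theta> + a)" for i
  proof -
    define x where "x = (2 * real i) * \<theta> + a"
    have "(2 * real i - 1) * \<theta> + a = x - \<theta>" "(2 * real (Suc i) - 1) * \<theta> + a = x + \<theta>"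
      by (simp_all add: x_def algebra_simps)
    then show ?thesis unfolding x_def[symmetric] by (simp add: cos_add cos_diff)
  qed
  then have "2 * sin \<theta> * (\<Sum>i<k. sin ((2 * real i) * \<theta> + a))
     = (\<Sum>i<k. cos ((2 * real i - 1) * \<theta> + a) - cos ((2 * real (Suc i) - 1) * \<theta> + a))"
    by (simp add: sum_distrib_left)
  also have "\<dots> = cos ((2 * real 0 - 1) * \<theta> + a) - cos ((2 * real k - 1) * \<theta> + a)"
    by (rule sum_lessThan_telescope')
  also have "(2 * real k - 1) * \<theta> + a = ((2 * real 0 - 1) * \<theta> + a) + 2 * pi"
    using assms by (simp add: \<theta>_def field_simps)
  finally have "2 * sin \<theta> * (\<Sum>i<k. sin ((2 * real i) * \<theta> + a)) = 0"
    by (simp only: cos_periodic)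
  then show ?thesis using sin_pi_div_pos[OF assms] by (simp add: \<theta>_def)
qed

lemma sum_cheb_period:
  assumes "k \<ge> 2"
  shows "(\<Sum>i<k. cheb (2 * cos (pi / real k)) (2 * i + j)) = 0"
proof -
  define \<theta> where "\<theta> = pi / real k"
  have "(\<Sum>i<k. cheb (2 * cos \<theta>) (2 * i + j)) * sin \<theta> = (\<Sum>i<k. sin (real (2 * i + j) * \<theta>))"
    by (simp only: sum_distrib_right cheb_cos)
  also have "\<dots> = (\<Sum>i<k. sin (2 * real i * \<theta> + real j * \<theta>))"
    by (simp add: algebra_simps)
  also have "\<dots> = 0" unfolding \<theta>_def by (rule sum_sin_period[OF assms])
  finally show ?thesis using sin_pi_div_pos[OF assms] by (simp add: \<theta>_def)
qed

lemma sum_lessThan_double: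
  fixes f :: "nat \<Rightarrow> 'a::comm_monoid_add"
  shows "(\<Sum>j<2 * k. f j) = (\<Sum>i<k. f (2 * i)) + (\<Sum>i<k. f (Suc (2 * i)))"
  by (induction k) (auto simp: algebra_simps)

section \<open>The geometric representation of a Coxeter group\<close>

text \<open>
  An element \<open>w\<close> of the Coxeter group is represented by the images of the simple roots under \<open>w\<close>,
  together with the parity of its length; \<open>act s\<close> below is right multiplication by the reflection of \<open>s\<close>.
  Carrying the parity along avoids the determinant.
\<close>

type_synonym 's chamber = "('s \<Rightarrow> 's \<Rightarrow> real) \<times> bool"

locale coxeter =
  fixes S :: "'s set" and m :: "'s \<Rightarrow> 's \<Rightarrow> enat"
  assumes cox: "coxeter_matrix S m"
begin

lemma finite_S: "finite S"
  and m_self: "s \<in> S \<Longrightarrow> m s s = 1"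
  and m_ge2: "s \<in> S \<Longrightarrow> t \<in> S \<Longrightarrow> s \<noteq> t \<Longrightarrow> 2 \<le> m s t"
  using cox unfolding coxeter_matrix_def by blast+

lemma m_sym: "s \<in> S \<Longrightarrow> t \<in> S \<Longrightarrow> m s t = m t s"
  using cox unfolding coxeter_matrix_def by metis

lemma m_enat_ge2: "s \<in> S \<Longrightarrow> t \<in> S \<Longrightarrow> s \<noteq> t \<Longrightarrow> m s t = enat k \<Longrightarrow> 2 \<le> k"
  using m_ge2[of s t] by (simp add: numeral_eq_enat)

text \<open>The Tits form on simple roots. It is \<open>0\<close> as soon as one argument lies
  outside \<open>S\<close>, so that no reflection moves the rows of labels outside \<open>S\<close>
  (\<open>root_act_outside\<close>).\<close>

definition bil :: "'s \<Rightarrow> 's \<Rightarrow> real" where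
  "bil s t = (if s \<notin> S \<or> t \<notin> S then 0 else if s = t then 1 else
     (case m s t of enat k \<Rightarrow> - cos (pi / real k) | \<infinity> \<Rightarrow> - 1))"

lemma bil_sym: "bil s t = bil t s"
  using m_sym by (auto simp: bil_def)

lemma bil_self [simp]: "s \<in> S \<Longrightarrow> bil s s = 1"
  by (simp add: bil_def)

definition act :: "'s \<Rightarrow> 's chamber \<Rightarrow> 's chamber" where
  "act s w = ((\<lambda>t u. fst w t u - 2 * bil s t * fst w s u), \<not> snd w)"

abbreviation root :: "'s chamber \<Rightarrow> 's \<Rightarrow> 's \<Rightarrow> real" where "root w \<equiv> fst w"
abbreviation par :: "'s chamber \<Rightarrow> bool" where "par w \<equiv> snd w"

definition base :: "'s chamber" where
  "base = ((\<lambda>t u. if t = u then 1 else 0), False)"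

definition run :: "'s list \<Rightarrow> 's chamber \<Rightarrow> 's chamber" where
  "run u w = fold act u w"

lemma run_Nil [simp]: "run [] w = w"
  and run_Cons [simp]: "run (s # u) w = run u (act s w)"
  and run_append [simp]: "run (u @ v) w = run v (run u w)"
  by (auto simp: run_def)

text \<open>The Coxeter group is realised as the orbit of \<open>base\<close>, so equality of group
  elements is equality of chambers, and \<open>len\<close> is word length in this image of the
  geometric representation.\<close>

definition W :: "'s chamber set" where
  "W = (\<lambda>u. run u base) ` lists S"

lemma act_act [simp]: "s \<in> S \<Longrightarrow> act s (act s w) = w"
  by (cases w) (auto simp: act_def fun_eq_iff algebra_simps)

lemma par_act [simp]: "par (act s w) \<longleftrightarrow> \<not> par w"
  by (simp add: act_def)

lemma root_act: "root (act s w) t u = root w t u - 2 * bil s t * root w s u"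
  by (simp add: act_def)

lemma root_act_self: "s \<in> S \<Longrightarrow> root (act s w) s u = - root w s u"
  by (simp add: act_def)

lemma par_run: "par (run u w) \<longleftrightarrow> (par w \<noteq> odd (length u))"
  by (induction u arbitrary: w) auto

lemma base_in_W: "base \<in> W"
  unfolding W_def by (rule image_eqI[of _ _ "[]"]) auto

lemma run_in_W: "w \<in> W \<Longrightarrow> u \<in> lists S \<Longrightarrow> run u w \<in> W"
  unfolding W_def by (auto simp flip: run_append intro!: imageI)

lemma act_in_W: "w \<in> W \<Longrightarrow> s \<in> S \<Longrightarrow> act s w \<in> W"
  using run_in_W[of w "[s]"] by simp

lemma run_rev: "u \<in> lists S \<Longrightarrow> run (rev u) (run u w) = w"
  by (induction u arbitrary: w) auto

section \<open>Word length and descents\<close>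

definition len :: "'s chamber \<Rightarrow> nat" where
  "len w = (LEAST n. \<exists>u\<in>lists S. length u = n \<and> run u base = w)"

lemma len_word:
  assumes "w \<in> W" shows "\<exists>u\<in>lists S. length u = len w \<and> run u base = w"
  unfolding len_def
  by (rule LeastI_ex) (use assms in \<open>auto simp: W_def\<close>)

lemma len_le: "u \<in> lists S \<Longrightarrow> len (run u base) \<le> length u"
  unfolding len_def by (rule Least_le) auto

lemma len_run_le:
  assumes "w \<in> W" "u \<in> lists S" shows "len (run u w) \<le> len w + length u"
proof -
  obtain v where "v \<in> lists S" "length v = len w" "run v base = w"
    using len_word[OF assms(1)] by blast
  then show ?thesis using len_le[of "v @ u"] assms(2) by simp
qed

lemma len_base [simp]: "len base = 0"
  using len_le[of "[]"] by simp

lemma len_0: "w \<in> W \<Longrightarrow> len w = 0 \<Longrightarrow> w = base"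
  using len_word[of w] by auto

lemma even_len: "w \<in> W \<Longrightarrow> par w \<longleftrightarrow> odd (len w)"
  using len_word[of w] by (auto simp: par_run base_def)

lemma len_act_cases:
  assumes "w \<in> W" "s \<in> S"
  shows "len (act s w) = Suc (len w) \<or> len w = Suc (len (act s w))"
proof -
  have "len (act s w) \<le> len w + 1" using len_run_le[OF assms(1), of "[s]"] assms by simp
  moreover have "len w \<le> len (act s w) + 1"
    using len_run_le[OF act_in_W[OF assms], of "[s]"] assms by simp
  moreover have "len (act s w) \<noteq> len w"
    using even_len[OF assms(1)] even_len[OF act_in_W[OF assms]] by auto
  ultimately show ?thesis by linarith
qed

definition descents :: "'s chamber \<Rightarrow> 's set" where
  "descents w = {s \<in> S. len (act s w) < len w}"

lemma descents_iff: "w \<in> W \<Longrightarrow> s \<in> descents w \<longleftrightarrow> s \<in> S \<and> len w = Suc (len (act s w))"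
  using len_act_cases[of w s] by (auto simp: descents_def)

lemma not_descents_iff: "w \<in> W \<Longrightarrow> s \<in> S \<Longrightarrow> s \<notin> descents w \<longleftrightarrow> len (act s w) = Suc (len w)"
  using len_act_cases[of w s] by (auto simp: descents_def)

lemma descents_act: "w \<in> W \<Longrightarrow> s \<in> S \<Longrightarrow> s \<in> descents (act s w) \<longleftrightarrow> s \<notin> descents w"
  using len_act_cases[of w s] by (auto simp: descents_def)

text \<open>The coefficients \<open>cheb\<close> are those of the roots of a dihedral root system.\<close>

lemma root_run_alternating:
  fixes s t w
  defines "c \<equiv> - 2 * bil s t"
  assumes st: "s \<in> S" "t \<in> S"
  shows "root (run (alternating s t k) w) (if even k then s else t) u
           = cheb c (Suc k) * root w s u + cheb c k * root w t u"
    and "root (run (alternating s t k) w) (if even k then t else s) u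
           = (cheb c (Suc (Suc k)) - c * cheb c (Suc k)) * root w s u + (cheb c (Suc k) - c * cheb c k) * root w t u"
proof (induction k)
  case 0
  { case 1 then show ?case by simp next case 2 then show ?case by simp }
next
  case (Suc k)
  have run: "run (alternating s t (Suc k)) w = act (if even k then s else t) (run (alternating s t k) w)"
    by (simp only: alternating_Suc_right) simp
  have c: "bil t s = - c / 2" "bil s t = - c / 2" by (simp_all add: c_def bil_sym)
  { case 1 
    show ?case unfolding run
      using Suc st by (auto simp: root_act c algebra_simps) }
  \<comment> \<open>The second root belongs to the letter that has just acted, so it is the negative
    of the first root one step before. Its coefficients are \<open>- cheb c k\<close> and
    \<open>- cheb c (k - 1)\<close>; the statement writes them as differences because
    \<open>k - 1\<close> has no meaning at \<open>k = 0\<close>.\<close>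
  { case 2
    show ?case unfolding run using Suc(1) st 
      by (cases "even k") (auto simp: root_act_self algebra_simps) }
qed

text \<open>Step \<open>j\<close> subtracts \<open>2 * bil r v\<close> times the current root of its
  letter \<open>r\<close>, and \<open>root_run_alternating\<close> expresses that root by Chebyshev
  coefficients.\<close>

lemma root_run_alternating_sum:
  assumes st: "s \<in> S" "t \<in> S"
  shows "root (run (alternating s t n) w) v u = root w v u
    - (\<Sum>j<n. 2 * bil (if even j then s else t) v *
         (cheb (- 2 * bil s t) (Suc j) * root w s u + cheb (- 2 * bil s t) j * root w t u))"
proof (induction n)
  case (Suc n)
  have run: "run (alternating s t (Suc n)) w = act (if even n then s else t) (run (alternating s t n) w)"
    by (simp only: alternating_Suc_right) simp
  show ?case unfolding run root_act Suc root_run_alternating(1)[OF st] by simp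
qed simp

lemma bil_enat: "s \<in> S \<Longrightarrow> t \<in> S \<Longrightarrow> s \<noteq> t \<Longrightarrow> m s t = enat k \<Longrightarrow> - 2 * bil s t = 2 * cos (pi / real k)"
  by (simp add: bil_def)

lemma bil_infinity: "s \<in> S \<Longrightarrow> t \<in> S \<Longrightarrow> s \<noteq> t \<Longrightarrow> m s t = \<infinity> \<Longrightarrow> - 2 * bil s t = 2"
  by (simp add: bil_def)

lemma cheb_bil_nonneg:
  assumes "s \<in> S" "t \<in> S" "s \<noteq> t" "enat n \<le> m s t"
  shows "0 \<le> cheb (- 2 * bil s t) n"
proof (cases "m s t")
  case (enat k)
  then show ?thesis using assms m_enat_ge2[OF assms(1-3) enat]
    unfolding bil_enat[OF assms(1-3) enat] by (simp add: cheb_nonneg)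
next
  case infinity
  then show ?thesis using bil_infinity[OF assms(1-3)] by (simp add: cheb_2)
qed

text \<open>The displacement of a root over \<open>2 * k\<close> steps splits into the steps of
  \<open>s\<close> and those of \<open>t\<close>; each part is built from Chebyshev sums over a full
  period and vanishes.\<close>

lemma run_dihedral:
  assumes st: "s \<in> S" "t \<in> S" "s \<noteq> t" and k: "m s t = enat k"
  shows "run (alternating s t (2 * k)) w = w"
proof (rule prod_eqI)
  have k2: "k \<ge> 2" using m_enat_ge2[OF st k] .
  show "root (run (alternating s t (2 * k)) w) = root w"
  proof (intro ext)
    fix v u
    let ?c = "2 * cos (pi / real k)"
    let ?g = "\<lambda>j. cheb ?c (Suc j) * root w s u + cheb ?c j * root w t u"
    have "(\<Sum>i<k. ?g (2 * i + l)) = 0" for l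
    proof -
      have "(\<Sum>i<k. ?g (2 * i + l)) = (\<Sum>i<k. cheb ?c (2 * i + Suc l)) * root w s u
              + (\<Sum>i<k. cheb ?c (2 * i + l)) * root w t u"
        by (simp add: sum.distrib sum_distrib_right)
      then show ?thesis unfolding sum_cheb_period[OF k2] by simp
    qed
    from this[of 0] this[of 1]
    have g: "(\<Sum>i<k. ?g (2 * i)) = 0" "(\<Sum>i<k. ?g (Suc (2 * i))) = 0" by simp_all
    have "(\<Sum>j<2 * k. 2 * bil (if even j then s else t) v * ?g j)
        = 2 * bil s v * (\<Sum>i<k. ?g (2 * i)) + 2 * bil t v * (\<Sum>i<k. ?g (Suc (2 * i)))"
      by (simp add: sum_lessThan_double sum_distrib_left)
    then show "root (run (alternating s t (2 * k)) w) v u = root w v u"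
      unfolding root_run_alternating_sum[OF st(1,2)] bil_enat[OF st k] g by simp
  qed
qed (simp add: par_run)

lemma run_alternating_swap:
  assumes st: "s \<in> S" "t \<in> S" "s \<noteq> t" and k: "m s t = enat k"
  shows "run (alternating s t k) w = run (alternating t s k) w"
proof -
  have "run (rev (alternating t s k)) (run (alternating s t k) w) = w"
    using run_dihedral[OF assms, of w] by (simp add: alternating_double)
  moreover have "alternating t s k \<in> lists S"
    using set_alternating[of t s k] st by auto
  then have "rev (alternating t s k) \<in> lists S" by auto
  ultimately show ?thesis
    using run_rev[of "rev (alternating t s k)" "run (alternating s t k) w"] by simp
qed

end

section \<open>Descents and orbits of parabolic subgroups\<close>

lemma rev_in_lists [simp]: "rev u \<in> lists A \<longleftrightarrow> u \<in> lists A"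
  by (simp add: in_lists_conv_set)

context coxeter
begin

lemma alternating_in_lists: "s \<in> S \<Longrightarrow> t \<in> S \<Longrightarrow> alternating s t k \<in> lists S"
  using set_alternating[of s t k] by auto

text \<open>The braid relation swaps the first \<open>k\<close> letters; the swapped word ends in
  the letter that comes next, and the two cancel.\<close>

lemma len_run_long_alternating:
  assumes st: "s \<in> S" "t \<in> S" "s \<noteq> t" and k: "m s t = enat k" and w: "w \<in> W" and n: "k < n"
  shows "len (run (alternating s t n) w) + 2 \<le> len w + n"
proof -
  obtain j where j: "n = k + Suc j" using less_imp_Suc_add[OF n] by auto
  have k2: "k \<ge> 2" using m_enat_ge2[OF st k] .
  then obtain k' where k': "k = Suc k'" by (cases k) auto
  define z z' where "z = (if even k then s else t)" and "z' = (if even k then t else s)"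
  have z: "z \<in> S" "z' \<in> S" using st by (auto simp: z_def z'_def)
  have "run (alternating s t n) w = run (alternating z' z j) (act z (run (alternating s t k) w))"
    unfolding j alternating_add by (simp add: z_def z'_def)
  also have "run (alternating s t k) w = run (alternating t s k) w"
    by (rule run_alternating_swap[OF st k])
  also have "run (alternating t s k) w = act z (run (alternating t s k') w)"
    unfolding k' alternating_Suc_right by (simp add: z_def k')
  also have "act z \<dots> = run (alternating t s k') w" using z by simp
  also have "run (alternating z' z j) \<dots> = run (alternating t s k' @ alternating z' z j) w" by simp
  finally have "len (run (alternating s t n) w) \<le> len w + (k' + j)"
    using len_run_le[OF w, of "alternating t s k' @ alternating z' z j"] st z
    by (simp add: alternating_in_lists)
  then show ?thesis using j k' by simp
qed

text \<open>Take the longest alternating word that can be split off \<open>w\<close> with lengths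
  adding up. A descent of \<open>v\<close> in \<open>{s, t}\<close> would either prolong this word
  at its front or cancel its first letter, and a word longer than the label would not have additive
  length.\<close>

lemma dihedral_bottom:
  assumes st: "s \<in> S" "t \<in> S" "s \<noteq> t" and w: "w \<in> W"
  obtains v y y' k where "v \<in> W" "{y, y'} = {s, t}" "w = run (alternating y y' k) v"
    "len w = len v + k" "s \<notin> descents v" "t \<notin> descents v" "enat k \<le> m s t"
proof -
  define P where "P k \<longleftrightarrow> (\<exists>v\<in>W. \<exists>y y'. {y, y'} = {s, t} \<and> w = run (alternating y y' k) v \<and> len w = len v + k)" for k
  have "P 0" unfolding P_def using w by (auto intro!: bexI[of _ w])
  moreover have bound: "P k \<Longrightarrow> k \<le> len w" for k unfolding P_def by auto
  ultimately have P: "P (Greatest P)"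
    by (rule GreatestI_nat)
  have mx: "k \<le> Greatest P" if "P k" for k
    using that bound by (rule Greatest_le_nat)
  define k where "k = Greatest P"
  obtain v y y' where v: "v \<in> W" and yy: "{y, y'} = {s, t}" and wv: "w = run (alternating y y' k) v"
    and l: "len w = len v + k" using P unfolding k_def[symmetric] P_def by blast
  have yS: "y \<in> S" "y' \<in> S" "y \<noteq> y'" using yy st by (auto simp: doubleton_eq_iff)
  have not_descents: "z \<notin> descents v" if z: "z \<in> {s, t}" for z
  proof
    assume d: "z \<in> descents v"
    have zS: "z \<in> S" using z st by auto
    have lz: "len v = Suc (len (act z v))" using d descents_iff[OF v] by blast
    have vz: "act z v \<in> W" using act_in_W[OF v zS] .
    consider "z = y'" | "z = y" using z yy by auto
    then show False
    proof cases
      case 1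
      have "w = run (alternating y' y (Suc k)) (act z v)"
        using wv zS 1 by simp
      then have "P (Suc k)"
        unfolding P_def using vz yy lz l
        by (intro bexI[of _ "act z v"] exI[of _ y'] exI[of _ y] conjI) (simp_all only: insert_commute add_Suc add_Suc_right)
      then show False using mx[of "Suc k"] by (simp add: k_def)
    next
      case 2
      show False
      proof (cases k)
        case 0
        have "w = run (alternating y y' (Suc 0)) (act z v)"
          using wv zS 2 0 by simp
        then have "P (Suc 0)"
          unfolding P_def using vz yy lz l 0
          by (intro bexI[of _ "act z v"] exI[of _ y] exI[of _ y'] conjI) (simp_all only: add_Suc add_Suc_right)
        then show False using mx[of "Suc 0"] 0 by (simp add: k_def)
      next
        case (Suc k')
        have "w = run (alternating y' y k') (act z v)"
          using wv 2 Suc by simp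
        then have "len w \<le> len (act z v) + k'"
          using len_run_le[OF vz, of "alternating y' y k'"] yS by (simp add: alternating_in_lists)
        then show False using l lz Suc by simp
      qed
    qed
  qed
  have "enat k \<le> m s t"
  proof (cases "m s t")
    case (enat n)
    then have "m y y' = enat n" using yy m_sym st by (auto simp: doubleton_eq_iff)
    show ?thesis
    proof (rule ccontr)
      assume "\<not> ?thesis"
      then have "n < k" using enat by simp
      from len_run_long_alternating[OF yS \<open>m y y' = enat n\<close> v this] show False
        using wv l by simp
    qed
  qed simp
  then show thesis using that[OF v yy wv l] not_descents by auto
qed

text \<open>Tits's theorem on the signs of roots. For a descent \<open>t\<close> of
  \<open>w\<close>, pass to the bottom \<open>v\<close> of the dihedral coset of \<open>s\<close>
  and \<open>t\<close>. There both roots are nonnegative by induction, and the root of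
  \<open>s\<close> at \<open>w\<close> is their combination with Chebyshev coefficients, which are
  nonnegative up to the label.\<close>

theorem root_nonneg:
  assumes "w \<in> W" "s \<in> S" "s \<notin> descents w"
  shows "root w s u \<ge> 0"
  using assms
proof (induction "len w" arbitrary: w s rule: less_induct)
  case less
  show ?case
  proof (cases "len w = 0")
    case True
    then show ?thesis using len_0[OF less(2)] by (simp add: base_def)
  next
    case False
    obtain p where p: "p \<in> lists S" "length p = len w" "run p base = w"
      using len_word[OF less(2)] by blast
    then obtain p' t where pt: "p = p' @ [t]" using False by (cases p rule: rev_cases) auto
    have t: "t \<in> S" "p' \<in> lists S" using p pt by auto
    have "act t w = run p' base" using p pt t by auto
    then have "len (act t w) < len w" using len_le[OF t(2)] p pt by simp
    then have td: "t \<in> descents w" using t by (simp add: descents_def)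
    then have st: "s \<noteq> t" using less by auto
    obtain v y y' k where v: "v \<in> W" and yy: "{y, y'} = {s, t}" and wv: "w = run (alternating y y' k) v"
      and l: "len w = len v + k" and nd: "s \<notin> descents v" "t \<notin> descents v" and km: "enat k \<le> m s t"
      using dihedral_bottom[OF less(3) t(1) st less(2)] .
    have yS: "y \<in> S" "y' \<in> S" "y \<noteq> y'" using yy st t less by (auto simp: doubleton_eq_iff)
    have k0: "k \<noteq> 0"
    proof
      assume "k = 0"
      then have "w = v" using wv by simp
      then show False using td nd by simp
    qed
    then have lv: "len v < len w" using l by simp
    have pos: "root v y u \<ge> 0" "root v y' u \<ge> 0"
      using less(1)[OF lv v] nd yy t less(3) by (auto simp: doubleton_eq_iff)
    have lw: "len (act s w) = Suc (len w)" using less not_descents_iff by blast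
    \<comment> \<open>Otherwise the word from \<open>v\<close> to \<open>w\<close> would end in
      \<open>s\<close>, and \<open>s\<close> would be a descent of \<open>w\<close>.\<close>
    have last: "s = (if even k then y else y')"
    proof (rule ccontr)
      assume "\<not> ?thesis"
      then have s: "s = (if even k then y' else y)" using yy by (auto simp: doubleton_eq_iff split: if_splits)
      obtain k' where k': "k = Suc k'" using k0 by (cases k) auto
      have "w = act s (run (alternating y y' k') v)"
        unfolding wv k' alternating_Suc_right using s by (simp add: k')
      then have "act s w = run (alternating y y' k') v" using less(3) by simp
      then have "len (act s w) \<le> len v + k'"
        using len_run_le[OF v, of "alternating y y' k'"] yS by (simp add: alternating_in_lists)
      then show False using lw l k' by simp
    qed
    have m_yy: "m y y' = m s t" using yy m_sym t less(3) by (auto simp: doubleton_eq_iff)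
    have aw: "act s w = run (alternating y y' (Suc k)) v"
      unfolding wv alternating_Suc_right last by simp
    \<comment> \<open>\<open>act s w\<close> is longer than \<open>w\<close>, so even the word with
      \<open>s\<close> appended has at most \<open>m y y'\<close> letters; this makes the
      coefficient of index \<open>Suc k\<close> nonnegative.\<close>
    have "enat (Suc k) \<le> m y y'"
    proof (cases "m y y'")
      case (enat n)
      show ?thesis
      proof (rule ccontr)
        assume "\<not> ?thesis"
        then have "n < Suc k" using enat by simp
        from len_run_long_alternating[OF yS enat v this] show False
          using lw l aw by simp
      qed
    qed simp
    then have c: "0 \<le> cheb (- 2 * bil y y') (Suc k)" "0 \<le> cheb (- 2 * bil y y') k"
      using cheb_bil_nonneg[OF yS] km m_yy by auto
    have "root w s u = cheb (- 2 * bil y y') (Suc k) * root v y u + cheb (- 2 * bil y y') k * root v y' u"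
      unfolding wv last by (rule root_run_alternating(1)[OF yS(1,2)])
    then show ?thesis using c pos by simp
  qed
qed

lemma root_nonpos:
  assumes "w \<in> W" "s \<in> descents w"
  shows "root w s u \<le> 0"
proof -
  have s: "s \<in> S" using assms(2) by (simp add: descents_def)
  have "s \<notin> descents (act s w)" using descents_act[OF assms(1) s] assms(2) by blast
  from root_nonneg[OF act_in_W[OF assms(1) s] s this, of u] show ?thesis
    using root_act_self[OF s] by simp
qed

text \<open>With the images of the simple roots as the rows of a matrix, this is the product rule:
  the matrix of \<open>u\<close> times that of \<open>w\<close>.\<close>

lemma root_run:
  assumes "s \<in> S" "u \<in> lists S"
  shows "root (run u w) s x = (\<Sum>t\<in>S. root (run u base) s t * root w t x)"
  using assms
proof (induction u arbitrary: s rule: rev_induct)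
  case Nil
  have "(\<Sum>t\<in>S. root base s t * root w t x) = (\<Sum>t\<in>S. if t = s then root w t x else 0)"
    by (rule sum.cong) (auto simp: base_def)
  then show ?case using Nil finite_S by simp
next
  case (snoc r u)
  then have "root (run u w) v x = (\<Sum>t\<in>S. root (run u base) v t * root w t x)" if "v \<in> S" for v
    using that by simp
  then show ?case using snoc
    by (simp add: root_act algebra_simps sum_subtractf sum_distrib_left)
qed

lemma root_nonzero:
  assumes "w \<in> W" "s \<in> S"
  shows "\<exists>x. root w s x \<noteq> 0"
proof (rule ccontr)
  assume *: "\<not> ?thesis"
  obtain u where u: "u \<in> lists S" "w = run u base" using assms by (auto simp: W_def)
  have "run (rev (rev u)) (run (rev u) base) = base" using u by (intro run_rev) auto
  then have "root base s s = (\<Sum>t\<in>S. root (run u base) s t * root (run (rev u) base) t s)"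
    using root_run[OF assms(2) u(1), of "run (rev u) base" s] by simp
  then show False using * u by (simp add: base_def)
qed

lemma root_run_support:
  assumes "u \<in> lists J" "x \<notin> J"
  shows "root (run u base) s x = (if s = x then 1 else 0)"
  using assms
proof (induction u arbitrary: s rule: rev_induct)
  case (snoc r u)
  then show ?case by (auto simp: root_act)
qed (simp add: base_def)

lemma descents_nonempty:
  assumes "w \<in> W" "descents w = {}" shows "w = base"
proof (rule ccontr)
  assume "w \<noteq> base"
  obtain p where p: "p \<in> lists S" "length p = len w" "run p base = w"
    using len_word[OF assms(1)] by blast
  with \<open>w \<noteq> base\<close> obtain p' t where pt: "p = p' @ [t]" by (cases p rule: rev_cases) auto
  have t: "t \<in> S" "p' \<in> lists S" using p pt by auto
  have "act t w = run p' base" using p pt t by auto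
  then have "len (act t w) < len w" using len_le[OF t(2)] p pt by simp
  then show False using t assms by (auto simp: descents_def)
qed

text \<open>Descents outside \<open>J\<close> are impossible as well: the coordinate
  \<open>s\<close> of the root of such an \<open>s\<close> is still \<open>1\<close>, whereas roots
  of descents have no positive coordinate.\<close>

lemma run_base_no_descents:
  assumes J: "J \<subseteq> S" and u: "u \<in> lists J" and d: "J \<inter> descents (run u base) = {}"
  shows "run u base = base"
proof (rule descents_nonempty)
  have uS: "u \<in> lists S" using J u lists_mono by blast
  show W: "run u base \<in> W" by (rule run_in_W[OF base_in_W uS])
  show "descents (run u base) = {}"
  proof (rule ccontr)
    assume "descents (run u base) \<noteq> {}"
    then obtain s where s: "s \<in> descents (run u base)" by blast
    then have "s \<notin> J" using d by blast
    then have "root (run u base) s s = 1" using root_run_support[OF u, of s s] by simp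
    then show False using root_nonpos[OF W s, of s] by simp
  qed
qed

lemma root_act_outside: "s \<notin> S \<Longrightarrow> root (run u w) s = root w s"
  by (induction u arbitrary: w) (auto simp: act_def bil_def)

text \<open>With \<open>run_fix_imp_base\<close> this says that the Coxeter group acts freely on its
  chambers: a word that fixes one of them fixes all.\<close>

lemma run_eq_base_imp:
  assumes u: "u \<in> lists S" and e: "run u base = base"
  shows "run u w = w"
proof (rule prod_eqI)
  have "even (length u)" using e by (metis par_run)
  then show "par (run u w) = par w" by (simp add: par_run)
  show "root (run u w) = root w"
  proof (intro ext)
    fix s x
    show "root (run u w) s x = root w s x"
    proof (cases "s \<in> S")
      case True
      then show ?thesis
        using root_run[OF True u, of w x] root_run[OF True, of "[]" w x] e by simp
    next
      case False
      then show ?thesis by (simp add: root_act_outside)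
    qed
  qed
qed

lemma run_fix_imp_base:
  assumes u: "u \<in> lists S" and w: "w \<in> W" and e: "run u w = w"
  shows "run u base = base"
proof -
  obtain p where p: "p \<in> lists S" "w = run p base" using w by (auto simp: W_def)
  have "run (p @ u @ rev p) base = base"
    using e p by (simp add: run_rev)
  moreover have "p @ u @ rev p \<in> lists S" using p(1) u by simp
  ultimately have "run (p @ u @ rev p) (run (rev p) base) = run (rev p) base"
    using run_eq_base_imp by blast
  moreover have r: "run p (run (rev p) x) = x" for x using run_rev[of "rev p" x] p(1) by simp
  ultimately have "run (rev p) (run u base) = run (rev p) base" by simp
  then have "run p (run (rev p) (run u base)) = run p (run (rev p) base)" by simp
  then show ?thesis by (simp only: r)
qed

text \<open>The coset of \<open>w\<close> modulo the parabolic subgroup of \<open>J\<close>; for two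
  letters with a finite label, a polygon of the Cayley graph.\<close>

definition orb :: "'s set \<Rightarrow> 's chamber \<Rightarrow> 's chamber set" where
  "orb J w = (\<lambda>u. run u w) ` lists J"

lemma self_in_orb: "w \<in> orb J w"
  unfolding orb_def by (rule image_eqI[of _ _ "[]"]) auto

lemma act_in_orb: "x \<in> orb J w \<Longrightarrow> s \<in> J \<Longrightarrow> act s x \<in> orb J w"
  unfolding orb_def by (auto intro!: image_eqI[of _ _ "_ @ [s]"])

lemma orb_subset: "x \<in> orb J w \<Longrightarrow> I \<subseteq> J \<Longrightarrow> orb I x \<subseteq> orb J w"
proof
  fix y assume x: "x \<in> orb J w" and I: "I \<subseteq> J" and "y \<in> orb I x"
  then obtain u v where "u \<in> lists J" "x = run u w" "v \<in> lists I" "y = run v x" by (auto simp: orb_def)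
  then show "y \<in> orb J w"
    unfolding orb_def using lists_mono[OF I] by (intro image_eqI[of _ _ "u @ v"]) auto
qed

lemma orb_sym:
  assumes "x \<in> orb J w" "J \<subseteq> S" shows "w \<in> orb J x"
proof -
  obtain u where u: "u \<in> lists J" "x = run u w" using assms by (auto simp: orb_def)
  then have "w = run (rev u) x" using run_rev[of u w] assms(2) lists_mono by fastforce
  then show ?thesis unfolding orb_def using u by auto
qed

lemma orb_eq:
  assumes "x \<in> orb J w" "J \<subseteq> S" shows "orb J x = orb J w"
  using orb_subset[OF assms(1)] orb_subset[OF orb_sym[OF assms]] by auto

lemma orb_in_W: "w \<in> W \<Longrightarrow> J \<subseteq> S \<Longrightarrow> orb J w \<subseteq> W"
  unfolding orb_def using run_in_W lists_mono by blast

text \<open>If \<open>s\<close> is a descent of the quotient \<open>u\<close> of \<open>x\<close> by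
  \<open>w\<close>, the root of \<open>s\<close> at \<open>x\<close> is a combination of the roots
  of \<open>J\<close> at \<open>w\<close> with nonpositive coefficients, hence has the sign opposite
  to theirs. For two tops or two bottoms of one coset this is absurd, so they agree
  (\<open>orb_top_unique\<close>, \<open>orb_bottom_unique\<close>).\<close>

lemma orb_sum_sign:
  assumes J: "J \<subseteq> S" and w: "w \<in> W" and x: "x \<in> orb J w" and s: "s \<in> J"
    and u: "u \<in> lists J" "x = run u w" and d: "s \<in> descents (run u base)"
  shows "\<exists>y. root x s y \<noteq> 0 \<and> ((J \<subseteq> descents w \<longrightarrow> root x s y > 0) \<and> (J \<inter> descents w = {} \<longrightarrow> root x s y < 0))"
proof -
  have uS: "u \<in> lists S" using J u lists_mono by blast
  have W: "run u base \<in> W" by (rule run_in_W[OF base_in_W uS])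
  have xW: "x \<in> W" using orb_in_W[OF w J] x by blast
  obtain y where y: "root x s y \<noteq> 0" using root_nonzero[OF xW] s J by blast
  have eq: "root x s y = (\<Sum>t\<in>S. root (run u base) s t * root w t y)"
    unfolding u(2) by (rule root_run[OF _ uS]) (use s J in auto)
  have "0 \<le> root x s y" if "J \<subseteq> descents w"
    unfolding eq
  proof (rule sum_nonneg)
    fix t assume "t \<in> S"
    show "0 \<le> root (run u base) s t * root w t y"
    proof (cases "t \<in> J")
      case True
      then show ?thesis using root_nonpos[OF W d] root_nonpos[OF w] that by (meson mult_nonpos_nonpos subsetD)
    next
      case False
      then show ?thesis using root_run_support[OF u(1) False, of s] s by auto
    qed
  qed
  moreover have "root x s y \<le> 0" if "J \<inter> descents w = {}"
    unfolding eq
  proof (rule sum_nonpos)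
    fix t assume t: "t \<in> S"
    show "root (run u base) s t * root w t y \<le> 0"
    proof (cases "t \<in> J")
      case True
      then have "root w t y \<ge> 0" using root_nonneg[OF w t] that by blast
      then show ?thesis using root_nonpos[OF W d] by (simp add: mult_nonpos_nonneg)
    next
      case False
      then show ?thesis using root_run_support[OF u(1) False, of s] s by auto
    qed
  qed
  ultimately show ?thesis using y by (intro exI[of _ y]) auto
qed

lemma orb_top_unique:
  assumes J: "J \<subseteq> S" and w: "w \<in> W" and x: "x \<in> orb J w" and "J \<subseteq> descents w" "J \<subseteq> descents x"
  shows "x = w"
proof -
  obtain u where u: "u \<in> lists J" "x = run u w" using x by (auto simp: orb_def)
  have "s \<notin> descents (run u base)" if s: "s \<in> J" for s
  proof
    assume "s \<in> descents (run u base)"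
    from orb_sum_sign[OF J w x s u this] assms obtain y where "root x s y > 0" by blast
    moreover have "root x s y \<le> 0" using orb_in_W[OF w J] x assms s by (intro root_nonpos) auto
    ultimately show False by simp
  qed
  then have "run u base = base" using run_base_no_descents[OF J u(1)] by blast
  then show ?thesis using run_eq_base_imp[of u w] u J lists_mono by blast
qed

lemma orb_bottom_unique:
  assumes J: "J \<subseteq> S" and w: "w \<in> W" and x: "x \<in> orb J w" and "J \<inter> descents w = {}" "J \<inter> descents x = {}"
  shows "x = w"
proof -
  obtain u where u: "u \<in> lists J" "x = run u w" using x by (auto simp: orb_def)
  have "s \<notin> descents (run u base)" if s: "s \<in> J" for s
  proof
    assume "s \<in> descents (run u base)"
    from orb_sum_sign[OF J w x s u this] assms obtain y where "root x s y < 0" by blast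
    moreover have "root x s y \<ge> 0" using orb_in_W[OF w J] x assms s J by (intro root_nonneg) auto
    ultimately show False by simp
  qed
  then have "run u base = base" using run_base_no_descents[OF J u(1)] by blast
  then show ?thesis using run_eq_base_imp[of u w] u J lists_mono by blast
qed

text \<open>Lengths subtract below a top. Let \<open>s\<close> be a descent of \<open>u\<close> and
  \<open>u'\<close> the quotient after removing it: the root of \<open>s\<close> at
  \<open>run u' w\<close> is a combination of nonpositive roots at \<open>w\<close> with nonnegative
  coefficients, so \<open>s\<close> is a descent there too.\<close>

lemma len_orb_top:
  assumes J: "J \<subseteq> S" and w: "w \<in> W" and d: "J \<subseteq> descents w" and u: "u \<in> lists J"
  shows "len (run u w) + len (run u base) = len w"
  using u
proof (induction "len (run u base)" arbitrary: u rule: less_induct)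
  case less
  have uS: "u \<in> lists S" using J less(2) lists_mono by blast
  have aW: "run u base \<in> W" by (rule run_in_W[OF base_in_W uS])
  show ?case
  proof (cases "run u base = base")
    case True
    then show ?thesis using run_eq_base_imp[OF uS True, of w] by simp
  next
    case False
    then obtain s where s: "s \<in> J" "s \<in> descents (run u base)" using run_base_no_descents[OF J less(2)] by blast
    have sS: "s \<in> S" using s J by blast
    define u' where "u' = u @ [s]"
    have u': "u' \<in> lists J" using less(2) s by (simp add: u'_def)
    have u'S: "u' \<in> lists S" using J u' lists_mono by blast
    have l: "len (run u base) = Suc (len (run u' base))" using s descents_iff[OF aW] by (simp add: u'_def)
    have xW: "run u' w \<in> W" by (rule run_in_W[OF w u'S])
    have IH: "len (run u' w) + len (run u' base) = len w" using less(1)[OF _ u'] l by simp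
    have "s \<notin> descents (run u' base)" using descents_act[OF aW sS] s by (simp add: u'_def)
    then have nn: "root (run u' base) s t \<ge> 0" for t
      using root_nonneg run_in_W[OF base_in_W u'S] sS by blast
    have "s \<in> descents (run u' w)"
    proof (rule ccontr)
      assume "s \<notin> descents (run u' w)"
      then have pos: "root (run u' w) s y \<ge> 0" for y using root_nonneg[OF xW sS] by blast
      obtain y where y: "root (run u' w) s y \<noteq> 0" using root_nonzero[OF xW sS] by blast
      have "root (run u' w) s y = (\<Sum>t\<in>S. root (run u' base) s t * root w t y)"
        by (rule root_run[OF sS u'S])
      also have "\<dots> \<le> 0"
      proof (rule sum_nonpos)
        fix t assume t: "t \<in> S"
        show "root (run u' base) s t * root w t y \<le> 0"
        proof (cases "t \<in> J")
          case True
          then have "root w t y \<le> 0" using root_nonpos[OF w] d by blast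
          then show ?thesis using nn by (simp add: mult_nonneg_nonpos)
        next
          case False
          then show ?thesis using root_run_support[OF u' False, of s] s by auto
        qed
      qed
      finally show False using pos[of y] y by simp
    qed
    then have "len (run u' w) = Suc (len (act s (run u' w)))" using descents_iff[OF xW] by blast
    moreover have "act s (run u' w) = run u w" using sS by (simp add: u'_def)
    ultimately show ?thesis using IH l by simp
  qed
qed

lemma len_orb_top_less:
  assumes J: "J \<subseteq> S" and w: "w \<in> W" and d: "J \<subseteq> descents w" and x: "x \<in> orb J w" "x \<noteq> w"
  shows "len x < len w"
proof -
  obtain u where u: "u \<in> lists J" "x = run u w" using x by (auto simp: orb_def)
  have uS: "u \<in> lists S" using J u lists_mono by blast
  have "len (run u base) \<noteq> 0"
    using len_0[OF run_in_W[OF base_in_W uS]] run_eq_base_imp[OF uS, of w] u x by auto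
  then show ?thesis using len_orb_top[OF J w d u(1)] u by simp
qed

text \<open>By \<open>len_orb_top\<close> every element is reached from \<open>w\<close> by a word
  of length at most \<open>len w\<close>, and \<open>S\<close> is finite.\<close>

lemma finite_orb_top:
  assumes J: "J \<subseteq> S" and w: "w \<in> W" and d: "J \<subseteq> descents w"
  shows "finite (orb J w)"
proof (rule finite_subset)
  show "orb J w \<subseteq> (\<lambda>v. run v w) ` {v. set v \<subseteq> S \<and> length v \<le> len w}"
  proof
    fix x assume "x \<in> orb J w"
    then obtain u where u: "u \<in> lists J" "x = run u w" by (auto simp: orb_def)
    have uS: "u \<in> lists S" using J u lists_mono by blast
    obtain v where v: "v \<in> lists S" "length v = len (run u base)" "run v base = run u base"
      using len_word[OF run_in_W[OF base_in_W uS]] by blast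
    have "run (u @ rev v) base = base" using v run_rev[of v base] by simp
    then have "run (u @ rev v) w = w" using uS v(1) run_eq_base_imp[of "u @ rev v" w] by simp
    then have "run v (run (rev v) x) = run v w" using u by simp
    then have "x = run v w" using run_rev[of "rev v" x] v by simp
    moreover have "length v \<le> len w" using len_orb_top[OF J w d u(1)] v by simp
    ultimately show "x \<in> (\<lambda>v. run v w) ` {v. set v \<subseteq> S \<and> length v \<le> len w}" using v by auto
  qed
  show "finite ((\<lambda>v. run v w) ` {v. set v \<subseteq> S \<and> length v \<le> len w})"
    using finite_lists_length_le[OF finite_S] by blast
qed

text \<open>The order of the product of two reflections is exactly the label. With \<theta> =
  \<pi>/k, a return after fewer than \<open>2 * k\<close> steps forces sin (n \<theta>) = 0, so n
  \<theta> = \<pi>, where sin ((n + 1) \<theta>) has the wrong sign. For an infinite label the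
  coefficient that should vanish is \<open>n\<close> itself.\<close>

lemma alternating_fixes_base:
  assumes st: "s \<in> S" "t \<in> S" "s \<noteq> t" and n: "n \<noteq> 0" and e: "run (alternating s t n) base = base"
  obtains k where "m s t = enat k" "2 * k \<le> n"
proof -
  let ?c = "- 2 * bil s t"
  have ev: "even n" using e by (metis par_run length_alternating)
  have "root base s u = cheb ?c (Suc n) * root base s u + cheb ?c n * root base t u" for u
    using root_run_alternating(1)[OF st(1,2), of n base u] e ev by simp
  from this[of s] this[of t] have c: "cheb ?c (Suc n) = 1" "cheb ?c n = 0"
    using st by (auto simp: base_def)
  show thesis
  proof (cases "m s t")
    case infinity
    then show ?thesis using c n unfolding bil_infinity[OF st infinity] by (simp only: cheb_2)
  next
    case (enat k)
    have k2: "k \<ge> 2" using m_enat_ge2[OF st enat] .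
    define \<theta> where "\<theta> = pi / real k"
    have s0: "sin (n * \<theta>) = 0" "sin (real (Suc n) * \<theta>) = sin \<theta>" "sin \<theta> > 0"
      using cheb_cos[of \<theta> n] cheb_cos[of \<theta> "Suc n"] c sin_pi_div_pos[OF k2]
      unfolding bil_enat[OF st enat] \<theta>_def by (simp_all del: cheb.simps)
    have "2 * k \<le> n"
    proof (rule ccontr)
      assume "\<not> ?thesis"
      then have n2: "n * \<theta> < 2 * pi" using k2 by (simp add: \<theta>_def field_simps)
      have n0: "0 < n * \<theta>" using n k2 by (simp add: \<theta>_def)
      have "n * \<theta> = pi"
        using sin_gt_zero[of "n * \<theta>"] sin_lt_zero[of "n * \<theta>"] s0 n0 n2 by (cases "n * \<theta>" pi rule: linorder_cases) auto
      then have "real (Suc n) * \<theta> = \<theta> + pi" by (simp add: algebra_simps)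
      then show False using s0 by simp
    qed
    then show ?thesis using that enat by blast
  qed
qed

lemma alternating_orbit_inj:
  assumes st: "s \<in> S" "t \<in> S" "s \<noteq> t" and w: "w \<in> W" and i: "i < j"
    and eq: "run (alternating s t i) w = run (alternating s t j) w"
  obtains k where "m s t = enat k" "2 * k \<le> j - i"
proof -
  define y y' where "y = (if even i then s else t)" and "y' = (if even i then t else s)"
  have y: "y \<in> S" "y' \<in> S" "y \<noteq> y'" using st by (auto simp: y_def y'_def)
  have "run (alternating s t j) w = run (alternating y y' (j - i)) (run (alternating s t i) w)"
    using alternating_add[of s t i "j - i"] i by (simp add: y_def y'_def)
  then have f: "run (alternating y y' (j - i)) (run (alternating s t i) w) = run (alternating s t i) w"
    using eq by simp
  have W: "run (alternating s t i) w \<in> W" using w st by (simp add: run_in_W alternating_in_lists)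
  have "run (alternating y y' (j - i)) base = base"
    by (rule run_fix_imp_base[OF _ W f]) (use y in \<open>simp add: alternating_in_lists\<close>)
  then obtain k where "m y y' = enat k" "2 * k \<le> j - i"
    using alternating_fixes_base[OF y, of "j - i"] i by auto
  then show thesis using that m_sym st by (auto simp: y_def y'_def split: if_splits)
qed

text \<open>With an infinite label the alternating words from \<open>w\<close> would run through
  infinitely many chambers, but the coset below a top is finite.\<close>

lemma finite_label_top:
  assumes w: "w \<in> W" and d: "s \<in> descents w" "t \<in> descents w" "s \<noteq> t"
  obtains k where "m s t = enat k"
proof (rule ccontr)
  assume *: "\<not> thesis"
  have st: "s \<in> S" "t \<in> S" using d by (auto simp: descents_def)
  have "inj (\<lambda>j. run (alternating s t j) w)"
  proof (rule linorder_injI)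
    fix i j :: nat assume "i < j"
    then show "run (alternating s t i) w \<noteq> run (alternating s t j) w"
      using alternating_orbit_inj[OF st d(3) w] * that by blast
  qed
  moreover have "range (\<lambda>j. run (alternating s t j) w) \<subseteq> orb {s, t} w"
    unfolding orb_def using set_alternating[of s t] by auto
  moreover have "finite (orb {s, t} w)" using finite_orb_top[of "{s, t}" w] st w d by auto
  ultimately show False using finite_subset finite_imageD by blast
qed

lemma dihedral_orbit:
  assumes st: "s \<in> S" "t \<in> S" "s \<noteq> t" and k: "m s t = enat k" and w: "w \<in> W"
  shows "bij_betw (\<lambda>j. run (alternating s t j) w) {..<2 * k} (orb {s, t} w)"
proof (rule bij_betwI')
  have neq: "run (alternating s t i) w \<noteq> run (alternating s t j) w" if ij: "i < j" "j < 2 * k" for i j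
  proof
    assume "run (alternating s t i) w = run (alternating s t j) w"
    then obtain k' where "m s t = enat k'" "2 * k' \<le> j - i"
      using alternating_orbit_inj[OF st w ij(1)] by blast
    then show False using k ij by simp
  qed
  fix i j assume "i \<in> {..<2 * k}" "j \<in> {..<2 * k}"
  then show "(run (alternating s t i) w = run (alternating s t j) w) = (i = j)"
    using neq[of i j] neq[of j i] by (cases i j rule: linorder_cases) auto
next
  fix i show "run (alternating s t i) w \<in> orb {s, t} w"
    unfolding orb_def using set_alternating[of s t i] by auto
next
  have k2: "k \<ge> 2" using m_enat_ge2[OF st k] .
  let ?R = "(\<lambda>j. run (alternating s t j) w) ` {..<2 * k}"
  have step: "run (alternating s t j) w \<in> ?R" if "j \<le> 2 * k" for j
  proof (cases "j = 2 * k")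
    case True
    then show ?thesis using run_dihedral[OF st k, of w] k2 by (auto intro!: image_eqI[of _ _ 0])
  next
    case False
    then show ?thesis using that by auto
  qed
  \<comment> \<open>The enumerated chambers are closed under both letters, so they exhaust the
    coset.\<close>
  have edge_upto: "act r x \<in> ?R" if x: "x \<in> ?R" and r: "r \<in> {s, t}" for x r
  proof -
    obtain j where j: "j < 2 * k" "x = run (alternating s t j) w" using x by auto
    show ?thesis
    proof (cases "r = (if even j then s else t)")
      case True
      then have "act r x = run (alternating s t (Suc j)) w"
        unfolding j alternating_Suc_right by simp
      then show ?thesis using step[of "Suc j"] j by simp
    next
      case False
      then have r: "r = (if even j then t else s)" using r by auto
      have "act r x \<in> ?R" if j0: "j \<noteq> 0"
      proof -
        obtain i where i: "j = Suc i" using j0 by (cases j) auto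
        have "act r x = run (alternating s t i) w"
          unfolding j i alternating_Suc_right using r i st by simp
        then show ?thesis using step[of i] j i by simp
      qed
      moreover have "act r x \<in> ?R" if "j = 0"
      proof -
        \<comment> \<open>From the start, \<open>t\<close> leads backwards to position
          \<open>2 * k - 1\<close>, since the word of length \<open>2 * k\<close> closes up.\<close>
        have rt: "r = t" "x = w" using that r j by auto
        obtain i where i: "2 * k = Suc i" using k2 by (cases "2 * k") auto
        have "odd i" using i by presburger
        then have "w = act t (run (alternating s t i) w)"
          using run_dihedral[OF st k, of w] unfolding i alternating_Suc_right by simp
        then have "act r x = run (alternating s t i) w" using rt st by (metis act_act)
        then show ?thesis using step[of i] i by simp
      qed
      ultimately show ?thesis by blast
    qed
  qed
  have "run u w \<in> ?R" if "u \<in> lists {s, t}" for u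
    using that
  proof (induction u rule: rev_induct)
    case Nil
    then show ?case using step[of 0] by simp
  next
    case (snoc r u)
    then show ?case using edge_upto[of "run u w" r] by auto
  qed
  then show "\<exists>j\<in>{..<2 * k}. x = run (alternating s t j) w" if "x \<in> orb {s, t} w" for x
    using that by (auto simp: orb_def)
qed

end

section \<open>The Euler relation in rank 3\<close>

lemma bit_add_self [simp]: "(b::bit) + b = 0"
  by (cases b) auto

lemma bit_add_self_left [simp]: "(b::bit) + (b + c) = c"
  by (cases b; cases c) auto

lemma bit_of_nat: "(of_nat n :: bit) = of_bool (odd n)"
  by (induction n) auto

lemma bit_add_eq_0: "(a::bit) + b = 0 \<longleftrightarrow> a = b"
  by (cases a; cases b) auto

declare add_bit_eq_xor [simp del] mult_bit_eq_and [simp del]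

text \<open>These are the face counts of the finite Coxeter complexes of rank 3: the Euler relation
  \<open>x + y + z = n + 2\<close> leaves only the types \<open>(2,2,c)\<close>, \<open>(2,3,3)\<close>, \<open>(2,3,4)\<close> and \<open>(2,3,5)\<close>.\<close>

lemma parity_aux:
  fixes x y z c n :: nat and f g h :: bit
  assumes n: "n = 2 * x" "n = b * y" "n = c * z" and b: "b = 2 \<or> b = 3" and e: "x + y + z = n + 2" and c: "2 \<le> c"
    and fg: "b = 2 \<Longrightarrow> odd c \<Longrightarrow> f = g" and fh: "c = 2 \<Longrightarrow> odd b \<Longrightarrow> f = h"
  shows "of_nat x * f + of_nat y * g + of_nat z * h = 0"
  using b
proof
  assume "b = 2"
  then have "y = x" "z = 2" "x = c" using n e by auto
  then show ?thesis using fg[OF \<open>b = 2\<close>] by (auto simp: bit_of_nat)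
next
  assume b3: "b = 3"
  then have "2 * x = 3 * y" using n by simp
  then have "3 dvd x" by presburger
  then obtain i where i: "x = 3 * i" by blast
  then have yz: "y = 2 * i" "z = i + 2" using \<open>2 * x = 3 * y\<close> n e by auto
  then have ci: "6 * i = c * (i + 2)" using n i by simp
  have "c < 6"
  proof (rule ccontr)
    assume "\<not> c < 6"
    then have "6 * (i + 2) \<le> c * (i + 2)" by (intro mult_right_mono) auto
    then show False using ci by simp
  qed
  then have "c = 2 \<or> c = 3 \<or> c = 4 \<or> c = 5" using c by auto
  \<comment> \<open>The solutions for \<open>c\<close> = 2, 3, 4, 5 are \<open>i\<close> = 1, 2, 4,
    10, where the groups have \<open>2 * n = 12 * i\<close> elements: 12, 24, 48, 120. In all but
    the first the three counts are even.\<close>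
  then consider "c = 2" "i = 1" | "even i" using ci by auto
  then show ?thesis
  proof cases
    case 1
    then show ?thesis using fh b3 i yz by (simp add: bit_of_nat)
  next
    case 2
    then show ?thesis using i yz by (simp add: bit_of_nat)
  qed
qed

text \<open>If \<open>b\<close> and \<open>c\<close> were both at least 4, the counts would add up
  to at most n/2 + n/4 + n/4 = n, less than the Euler relation demands.\<close>

lemma parity_aux2:
  fixes x y z b c n :: nat and f g h :: bit
  assumes n: "n = 2 * x" "n = b * y" "n = c * z" and e: "x + y + z = n + 2" and b: "2 \<le> b" and c: "2 \<le> c"
    and fg: "b = 2 \<Longrightarrow> odd c \<Longrightarrow> f = g" and fh: "c = 2 \<Longrightarrow> odd b \<Longrightarrow> f = h"
  shows "of_nat x * f + of_nat y * g + of_nat z * h = 0"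
proof -
  have "b < 4 \<or> c < 4"
  proof (rule ccontr)
    assume "\<not> ?thesis"
    then have "4 * y \<le> b * y" "4 * z \<le> c * z" by (auto intro: mult_right_mono)
    then show False using n e by linarith
  qed
  then consider "b = 2 \<or> b = 3" | "c = 2 \<or> c = 3" using b c by linarith
  then show ?thesis
  proof cases
    case 1
    then show ?thesis using parity_aux[of n x b y c z f g h] assms by blast
  next
    case 2
    have "x + z + y = n + 2" using e by simp
    then have "of_nat x * f + of_nat z * h + of_nat y * g = 0"
      using parity_aux[of n x c z b y f h g] 2 assms by blast
    then show ?thesis by (simp only: ac_simps)
  qed
qed

text \<open>Some label is 2, since three labels of at least 3 would give at most n polygons. The
  conditions on \<open>f\<close>, \<open>g\<close>, \<open>h\<close> concern the products with an
  odd dihedral group, where the parities of the counts alone do not suffice.\<close>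

lemma parity_rank3:
  fixes x y z a b c n :: nat and f g h :: bit
  assumes n: "n = a * x" "n = b * y" "n = c * z" and e: "x + y + z = n + 2"
    and ge: "2 \<le> a" "2 \<le> b" "2 \<le> c"
    and fg: "a = 2 \<Longrightarrow> b = 2 \<Longrightarrow> odd c \<Longrightarrow> f = g"
    and fh: "a = 2 \<Longrightarrow> c = 2 \<Longrightarrow> odd b \<Longrightarrow> f = h"
    and gh: "b = 2 \<Longrightarrow> c = 2 \<Longrightarrow> odd a \<Longrightarrow> g = h"
  shows "of_nat x * f + of_nat y * g + of_nat z * h = 0"
proof -
  have "a < 3 \<or> b < 3 \<or> c < 3"
  proof (rule ccontr)
    assume "\<not> ?thesis"
    then have "3 * x \<le> a * x" "3 * y \<le> b * y" "3 * z \<le> c * z" by (auto intro: mult_right_mono)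
    then show False using n e by linarith
  qed
  then consider "a = 2" | "b = 2" | "c = 2" using ge by linarith
  then show ?thesis
  proof cases
    case 1
    then show ?thesis using parity_aux2[of n x b y c z f g h] assms by blast
  next
    case 2
    have "y + x + z = n + 2" using e by simp
    then have "of_nat y * g + of_nat x * f + of_nat z * h = 0"
      by (rule parity_aux2[of n y a x c z, rotated 3]) (use 2 assms in auto)
    then show ?thesis by (simp only: ac_simps)
  next
    case 3
    have "z + x + y = n + 2" using e by simp
    then have "of_nat z * h + of_nat x * f + of_nat y * g = 0"
      by (rule parity_aux2[of n z a x b y, rotated 3]) (use 3 assms in auto)
    then show ?thesis by (simp only: ac_simps)
  qed
qed

section \<open>Counting chambers, edges and polygons by their tops\<close>

context coxeter
begin

lemma exists_top:
  assumes "x \<in> W" "I \<subseteq> S" "finite (orb I x)"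
  shows "\<exists>y\<in>orb I x. I \<subseteq> descents y"
proof -
  have ne: "len ` orb I x \<noteq> {}" using self_in_orb by blast
  obtain y where y: "y \<in> orb I x" "len y = Max (len ` orb I x)"
    using Max_in[OF _ ne] assms(3) by fastforce
  have mx: "len z \<le> len y" if "z \<in> orb I x" for z using that assms(3) y(2) by simp
  have yW: "y \<in> W" using orb_in_W[OF assms(1,2)] y by blast
  have "s \<in> descents y" if s: "s \<in> I" for s
  proof (rule ccontr)
    assume "s \<notin> descents y"
    then have "len (act s y) = Suc (len y)" using not_descents_iff[OF yW] s assms(2) by blast
    then show False using mx[OF act_in_orb[OF y(1) s]] by simp
  qed
  then show ?thesis using y by blast
qed

lemma exists_bottom:
  assumes "x \<in> W" "I \<subseteq> S"
  shows "\<exists>y\<in>orb I x. I \<inter> descents y = {}"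
proof -
  obtain y where y: "y \<in> orb I x" "\<And>z. z \<in> orb I x \<Longrightarrow> len y \<le> len z"
    using ex_has_least_nat[of "\<lambda>z. z \<in> orb I x" x len] self_in_orb by blast
  have yW: "y \<in> W" using orb_in_W[OF assms(1,2)] y by blast
  have "s \<notin> descents y" if s: "s \<in> I" for s
    using y(2)[OF act_in_orb[OF y(1) s]] descents_iff[OF yW] by auto
  then show ?thesis using y by blast
qed

text \<open>The cosets of \<open>I\<close> partition the orbit and each has exactly one top, so the
  tops index the blocks. This serves for counts and for edge sums alike.\<close>

lemma sum_orb_tops:
  fixes f :: "'s chamber \<Rightarrow> 'c::comm_monoid_add"
  assumes J: "J \<subseteq> S" and w: "w \<in> W" and fin: "finite (orb J w)" and I: "I \<subseteq> J"
  shows "sum f (orb J w) = (\<Sum>y | y \<in> orb J w \<and> I \<subseteq> descents y. sum f (orb I y))"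
proof -
  let ?T = "{y. y \<in> orb J w \<and> I \<subseteq> descents y}"
  have IS: "I \<subseteq> S" using I J by blast
  have sub: "orb I y \<subseteq> orb J w" if "y \<in> orb J w" for y using orb_subset[OF that I] .
  have W: "orb J w \<subseteq> W" by (rule orb_in_W[OF w J])
  have "orb J w \<subseteq> (\<Union>y\<in>?T. orb I y)"
  proof
    fix x assume x: "x \<in> orb J w"
    have "finite (orb I x)" using sub[OF x] fin finite_subset by blast
    then obtain y where y: "y \<in> orb I x" "I \<subseteq> descents y" using exists_top[of x I] W x IS by blast
    then have "y \<in> ?T" "x \<in> orb I y" using sub[OF x] orb_sym[OF y(1) IS] by auto
    then show "x \<in> (\<Union>y\<in>?T. orb I y)" by blast
  qed
  then have eq: "orb J w = (\<Union>y\<in>?T. orb I y)" using sub by blast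
  have "orb I y \<inter> orb I z = {}" if "y \<in> ?T" "z \<in> ?T" "y \<noteq> z" for y z
  proof (rule ccontr)
    assume "orb I y \<inter> orb I z \<noteq> {}"
    then obtain x where "x \<in> orb I y" "x \<in> orb I z" by blast
    then have "z \<in> orb I y" using orb_eq[OF _ IS] orb_sym[OF _ IS] self_in_orb by metis
    then show False using orb_top_unique[OF IS, of y z] that W by blast
  qed
  moreover have "finite (orb I y)" if "y \<in> ?T" for y
    using sub[of y] that fin finite_subset by blast
  ultimately have "sum f (\<Union>y\<in>?T. orb I y) = (\<Sum>y\<in>?T. sum f (orb I y))"
    using fin by (intro sum.UNION_disjoint) auto
  then show ?thesis by (rule HOL.trans[OF arg_cong[OF eq]])
qed

lemma card_orb_dihedral:
  "s \<in> S \<Longrightarrow> t \<in> S \<Longrightarrow> s \<noteq> t \<Longrightarrow> m s t = enat k \<Longrightarrow> w \<in> W \<Longrightarrow> card (orb {s, t} w) = 2 * k"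
  using bij_betw_same_card[OF dihedral_orbit] by simp

text \<open>A polygon of type \<open>{s, t}\<close> has \<open>2 * k\<close> chambers and is counted
  by its top.\<close>

lemma card_orb_tops:
  assumes J: "J \<subseteq> S" and w: "w \<in> W" and fin: "finite (orb J w)" 
    and st: "s \<in> J" "t \<in> J" "s \<noteq> t" "m s t = enat k"
  shows "card (orb J w) = 2 * k * card {y \<in> orb J w. s \<in> descents y \<and> t \<in> descents y}"
proof -
  have "card (orb J w) = (\<Sum>y | y \<in> orb J w \<and> {s, t} \<subseteq> descents y. card (orb {s, t} y))"
    using sum_orb_tops[OF J w fin, of "{s, t}" "\<lambda>_. 1::nat"] st by simp
  also have "\<dots> = (\<Sum>y | y \<in> orb J w \<and> {s, t} \<subseteq> descents y. 2 * k)"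
    by (rule sum.cong) (use st J orb_in_W[OF w J] in \<open>auto intro!: card_orb_dihedral\<close>)
  finally show ?thesis by simp
qed

lemma card_orb_descents:
  assumes J: "J \<subseteq> S" and w: "w \<in> W" and fin: "finite (orb J w)" and s: "s \<in> J"
  shows "card (orb J w) = 2 * card {y \<in> orb J w. s \<in> descents y}"
proof -
  have W: "orb J w \<subseteq> W" by (rule orb_in_W[OF w J])
  have "bij_betw (act s) {y \<in> orb J w. s \<in> descents y} {y \<in> orb J w. s \<notin> descents y}"
    using s J W by (intro bij_betwI[where g = "act s"]) (auto simp: act_in_orb descents_act subset_iff)
  then have "card {y \<in> orb J w. s \<in> descents y} = card {y \<in> orb J w. s \<notin> descents y}"
    by (rule bij_betw_same_card)
  moreover have "card (orb J w) = card {y \<in> orb J w. s \<in> descents y} + card {y \<in> orb J w. s \<notin> descents y}"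
    by (subst card_Un_disjoint[symmetric]) (use fin in \<open>auto intro: arg_cong[where f = card]\<close>)
  ultimately show ?thesis by simp
qed

text \<open>The Euler characteristic 2 of a sphere with the chambers as vertices. It comes from a
  pointwise count: if the letters are distinct, a chamber with \<open>d\<close> descents among them
  contributes 1 - d + d (d - 1)/2, which is 1 for \<open>d\<close> = 0 and \<open>d\<close> = 3 and
  0 otherwise, and the coset has one bottom and one top.\<close>

lemma euler_rank3:
  assumes w: "w \<in> W" and d: "s \<in> descents w" "t \<in> descents w" "u \<in> descents w"
  defines "C \<equiv> orb {s, t, u} w"
  shows "card {y \<in> C. s \<in> descents y \<and> t \<in> descents y} + card {y \<in> C. s \<in> descents y \<and> u \<in> descents y}
      + card {y \<in> C. t \<in> descents y \<and> u \<in> descents y} = card {y \<in> C. s \<in> descents y} + 2"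
proof -
  let ?J = "{s, t, u}"
  have J: "?J \<subseteq> S" "?J \<subseteq> descents w" using d by (auto simp: descents_def)
  have fin: "finite C" unfolding C_def by (rule finite_orb_top[OF J(1) w J(2)])
  have CW: "C \<subseteq> W" unfolding C_def by (rule orb_in_W[OF w J(1)])
  have top: "{y \<in> C. ?J \<subseteq> descents y} = {w}"
    using orb_top_unique[OF J(1) w] J(2) self_in_orb unfolding C_def by blast
  obtain b where b: "b \<in> C" "?J \<inter> descents b = {}" using exists_bottom[OF w J(1)] unfolding C_def by blast
  have "x = b" if "x \<in> C" "?J \<inter> descents x = {}" for x
    using orb_bottom_unique[OF J(1), of b x] that b CW orb_eq[OF _ J(1), of b w] unfolding C_def by blast
  then have bot: "{y \<in> C. ?J \<inter> descents y = {}} = {b}" using b by blast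
  have half: "card C = 2 * card {y \<in> C. r \<in> descents y}" if "r \<in> ?J" for r
    unfolding C_def by (rule card_orb_descents[OF J(1) w _ that]) (use fin C_def in auto)
  let ?i = "\<lambda>P. of_bool P :: int"
  have ci: "(\<Sum>y\<in>C. ?i (P y)) = int (card {y \<in> C. P y})" for P
    using fin by (simp add: Int_def of_bool_def sum.If_cases)
  have "(\<Sum>y\<in>C. ?i True - ?i (s \<in> descents y) - ?i (t \<in> descents y) - ?i (u \<in> descents y)
      + ?i (s \<in> descents y \<and> t \<in> descents y) + ?i (s \<in> descents y \<and> u \<in> descents y) + ?i (t \<in> descents y \<and> u \<in> descents y))
    = (\<Sum>y\<in>C. ?i (?J \<subseteq> descents y) + ?i (?J \<inter> descents y = {}))"
    by (rule sum.cong) auto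
  then have "int (card {y \<in> C. True}) - int (card {y \<in> C. s \<in> descents y}) - int (card {y \<in> C. t \<in> descents y})
      - int (card {y \<in> C. u \<in> descents y}) + int (card {y \<in> C. s \<in> descents y \<and> t \<in> descents y})
      + int (card {y \<in> C. s \<in> descents y \<and> u \<in> descents y}) + int (card {y \<in> C. t \<in> descents y \<and> u \<in> descents y}) = 1 + 1"
    unfolding sum.distrib sum_subtractf ci top bot by simp
  then show ?thesis using half[of s] half[of t] half[of u] by simp
qed

text \<open>Constancy on the classes of \<open>pair_equiv\<close>, spelled out on labels; on pairs
  with a label other than 2 the function is arbitrary.\<close>

definition admissible :: "('s set \<Rightarrow> bit) \<Rightarrow> bool" where
  "admissible \<phi> \<longleftrightarrow> (\<forall>s\<in>S. \<forall>t\<in>S. \<forall>t'\<in>S.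
     m s t = 2 \<longrightarrow> m s t' = 2 \<longrightarrow> odd_label (m t t') \<longrightarrow> \<phi> {s, t} = \<phi> {s, t'})"

lemma admissibleD:
  "\<lbrakk>admissible \<phi>; s \<in> S; t \<in> S; t' \<in> S; m s t = 2; m s t' = 2; odd_label (m t t')\<rbrakk>
    \<Longrightarrow> \<phi> {s, t} = \<phi> {s, t'}"
  unfolding admissible_def by blast

text \<open>\<open>parity_rank3\<close> is applied with \<open>n\<close> the number of edges of one
  type; the equalities that it asks for are instances of admissibility.\<close>

lemma parity_orb:
  fixes \<phi> :: "'s set \<Rightarrow> bit"
  assumes w: "w \<in> W" and d: "s \<in> descents w" "t \<in> descents w" "u \<in> descents w" and ne: "s \<noteq> t" "s \<noteq> u" "t \<noteq> u"
    and adm: "admissible \<phi>"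
  defines "C \<equiv> orb {s, t, u} w"
  shows "of_nat (card {y \<in> C. s \<in> descents y \<and> t \<in> descents y}) * \<phi> {s, t}
      + of_nat (card {y \<in> C. s \<in> descents y \<and> u \<in> descents y}) * \<phi> {s, u}
      + of_nat (card {y \<in> C. t \<in> descents y \<and> u \<in> descents y}) * \<phi> {t, u} = 0"
proof -
  let ?J = "{s, t, u}"
  have J: "?J \<subseteq> S" "?J \<subseteq> descents w" using d by (auto simp: descents_def)
  have fin: "finite (orb ?J w)" by (rule finite_orb_top[OF J(1) w J(2)])
  obtain a b c where abc: "m s t = enat a" "m s u = enat b" "m t u = enat c"
    using finite_label_top[OF w d(1,2) ne(1)] finite_label_top[OF w d(1,3) ne(2)]
      finite_label_top[OF w d(2,3) ne(3)] by metis
  have ge: "2 \<le> a" "2 \<le> b" "2 \<le> c" using m_enat_ge2[OF _ _ ne(1)] m_enat_ge2[OF _ _ ne(2)] m_enat_ge2[OF _ _ ne(3)] abc J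
    by auto
  have sym: "m t s = m s t" "m u s = m s u" "m u t = m t u" using m_sym J by auto
  let ?n = "card {y \<in> C. s \<in> descents y}"
  have "card C = 2 * ?n" unfolding C_def by (rule card_orb_descents[OF J(1) w fin]) simp
  moreover have "card C = 2 * a * card {y \<in> C. s \<in> descents y \<and> t \<in> descents y}"
    "card C = 2 * b * card {y \<in> C. s \<in> descents y \<and> u \<in> descents y}"
    "card C = 2 * c * card {y \<in> C. t \<in> descents y \<and> u \<in> descents y}"
    unfolding C_def by (rule card_orb_tops[OF J(1) w fin]; use ne abc in simp)+
  ultimately have n: "?n = a * card {y \<in> C. s \<in> descents y \<and> t \<in> descents y}"
    "?n = b * card {y \<in> C. s \<in> descents y \<and> u \<in> descents y}" "?n = c * card {y \<in> C. t \<in> descents y \<and> u \<in> descents y}"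
    by auto
  have two: "(2::enat) = enat 2" by (simp add: numeral_eq_enat)
  show ?thesis
  proof (rule parity_rank3[OF n euler_rank3[OF w d, folded C_def] ge])
    show "\<phi> {s, t} = \<phi> {s, u}" if "a = 2" "b = 2" "odd c"
      using that abc J by (intro admissibleD[OF adm]) (auto simp: odd_label_def two)
    show "\<phi> {s, t} = \<phi> {t, u}" if "a = 2" "c = 2" "odd b"
      using that abc J sym admissibleD[OF adm, of t s u] by (auto simp: odd_label_def two insert_commute)
    show "\<phi> {s, u} = \<phi> {t, u}" if "b = 2" "c = 2" "odd a"
      using that abc J sym admissibleD[OF adm, of u s t] by (auto simp: odd_label_def two insert_commute)
  qed
qed

end

section \<open>Edge functions with prescribed sums around dihedral orbits\<close>

lemma map_fst_words_over: "u \<in> words_over X \<Longrightarrow> map fst u \<in> lists X"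
  by (induction u) auto

context coxeter
begin

text \<open>The descent whose edge is normalised to \<open>0\<close> at \<open>w\<close>; every
  other descent gets the value that its polygon with this one requires.\<close>

definition pick_descents :: "'s chamber \<Rightarrow> 's" where
  "pick_descents w = (SOME s. s \<in> descents w)"

text \<open>An edge carries its value at its longer end; this reads it from either end.\<close>

definition extend_edge :: "('s chamber \<Rightarrow> 's \<Rightarrow> bit) \<Rightarrow> 's chamber \<Rightarrow> 's \<Rightarrow> bit" where
  "extend_edge c y s = (if s \<in> descents y then c y s else c (act s y) s)"

text \<open>Edges join chambers of opposite parity, so visiting both edges of each even chamber
  meets every edge of the polygon once.\<close>

definition cell_sum :: "('s chamber \<Rightarrow> 's \<Rightarrow> bit) \<Rightarrow> 's \<Rightarrow> 's \<Rightarrow> 's chamber \<Rightarrow> bit" where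
  "cell_sum e s t w = (\<Sum>y\<in>orb {s, t} w. if par y then 0 else e y s + e y t)"

text \<open>\<open>edge_upto \<phi> n w s\<close> is the value on the edge from \<open>w\<close> down to \<open>act s w\<close>, provided that
  \<open>w\<close> has length at most \<open>n\<close>; on longer edges it is \<open>0\<close>.\<close>

primrec edge_upto :: "('s set \<Rightarrow> bit) \<Rightarrow> nat \<Rightarrow> 's chamber \<Rightarrow> 's \<Rightarrow> bit" where
  "edge_upto \<phi> 0 w s = 0"
| "edge_upto \<phi> (Suc n) w s =
    (if len w = Suc n then
       if s = pick_descents w then 0 else \<phi> {s, pick_descents w} + cell_sum (extend_edge (edge_upto \<phi> n)) s (pick_descents w) w
     else edge_upto \<phi> n w s)"

definition edge :: "('s set \<Rightarrow> bit) \<Rightarrow> 's chamber \<Rightarrow> 's \<Rightarrow> bit" where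
  "edge \<phi> = extend_edge (\<lambda>w. edge_upto \<phi> (len w) w)"

lemma cell_sum_swap: "cell_sum e s t w = cell_sum e t s w"
  by (auto simp: cell_sum_def insert_commute add.commute intro!: sum.cong)

lemma cell_sum_orb:
  assumes "y \<in> orb {s, t} w" "s \<in> S" "t \<in> S"
  shows "cell_sum e s t y = cell_sum e s t w"
  using orb_eq[OF assms(1)] assms(2,3) by (simp add: cell_sum_def)

lemma edge_upto_long: "n < len w \<Longrightarrow> edge_upto \<phi> n w s = 0"
  by (induction n) auto

lemma edge_upto_stable: "len w \<le> n \<Longrightarrow> edge_upto \<phi> n w s = edge_upto \<phi> (len w) w s"
proof (induction n)
  case (Suc n)
  then show ?case by (cases "len w = Suc n") auto
qed simp

lemma extend_edge_act: "w \<in> W \<Longrightarrow> s \<in> S \<Longrightarrow> extend_edge c (act s w) s = extend_edge c w s"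
  by (simp add: extend_edge_def descents_act)

lemma edge_act: "w \<in> W \<Longrightarrow> s \<in> S \<Longrightarrow> edge \<phi> (act s w) s = edge \<phi> w s"
  by (simp add: edge_def extend_edge_act)

text \<open>All chambers of the polygon other than its top \<open>w\<close> have length at most
  \<open>n\<close>. Hence stage \<open>n\<close> is final on all its edges but those at
  \<open>w\<close>, where it still is \<open>0\<close>.\<close>

lemma edge_split:
  assumes w: "w \<in> W" and d: "s \<in> descents w" "t \<in> descents w" and y: "y \<in> orb {s, t} w" and l: "len w = Suc n"
    and r: "r \<in> {s, t}"
  shows "edge \<phi> y r = extend_edge (edge_upto \<phi> n) y r + (if y = w \<or> act r y = w then edge_upto \<phi> (len w) w r else 0)"
proof -
  have J: "{s, t} \<subseteq> S" "{s, t} \<subseteq> descents w" using d by (auto simp: descents_def)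
  have yW: "y \<in> W" using orb_in_W[OF w J(1)] y by blast
  have less: "len z \<le> n" if "z \<in> orb {s, t} w" "z \<noteq> w" for z
    using len_orb_top_less[OF J(1) w J(2) that] l by simp
  define z where "z = (if r \<in> descents y then y else act r y)"
  have z: "z \<in> orb {s, t} w" using y act_in_orb[OF y r] by (simp add: z_def)
  have rS: "r \<in> S" using r J by blast
  have "z = w \<longleftrightarrow> y = w \<or> act r y = w"
    using r J(2) descents_act[OF yW rS] by (auto simp: z_def)
  moreover have "extend_edge c y r = c z r" for c by (simp add: extend_edge_def z_def)
  moreover have "edge_upto \<phi> n z r = edge_upto \<phi> (len z) z r" if "z \<noteq> w"
    using less[OF z that] edge_upto_stable by blast
  moreover have "edge_upto \<phi> n w r = 0" using l by (simp add: edge_upto_long)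
  ultimately show ?thesis by (auto simp: edge_def)
qed

lemma cell_sum_edge_top:
  assumes w: "w \<in> W" and d: "s \<in> descents w" "t \<in> descents w" and l: "len w = Suc n"
  shows "cell_sum (edge \<phi>) s t w = cell_sum (extend_edge (edge_upto \<phi> n)) s t w + (edge_upto \<phi> (len w) w s + edge_upto \<phi> (len w) w t)"
proof -
  let ?O = "orb {s, t} w"
  have J: "{s, t} \<subseteq> S" "{s, t} \<subseteq> descents w" using d by (auto simp: descents_def)
  have fin: "finite ?O" by (rule finite_orb_top[OF J(1) w J(2)])
  \<comment> \<open>An edge at \<open>w\<close> has exactly one even end, \<open>z\<close>, so its
    value enters the sum once.\<close>
  have one: "(\<Sum>y\<in>?O. if par y then 0 else if y = w \<or> act r y = w then c else 0) = c"
    if r: "r \<in> {s, t}" for r and c :: bit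
  proof -
    define z where "z = (if par w then act r w else w)"
    have z: "z \<in> ?O" using act_in_orb[OF self_in_orb r] self_in_orb by (simp add: z_def)
    have "r \<in> S" using r J by blast
    then have "(if par y then 0 else if y = w \<or> act r y = w then c else 0) = (if y = z then c else 0)" for y
      by (auto simp: z_def)
    then show ?thesis using fin z by simp
  qed
  have "cell_sum (edge \<phi>) s t w = (\<Sum>y\<in>?O. (if par y then 0 else extend_edge (edge_upto \<phi> n) y s + extend_edge (edge_upto \<phi> n) y t)
      + ((if par y then 0 else if y = w \<or> act s y = w then edge_upto \<phi> (len w) w s else 0)
      + (if par y then 0 else if y = w \<or> act t y = w then edge_upto \<phi> (len w) w t else 0)))"
    unfolding cell_sum_def
  proof (rule sum.cong[OF HOL.refl])
    fix y assume y: "y \<in> ?O"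
    have "edge \<phi> y r = extend_edge (edge_upto \<phi> n) y r + (if y = w \<or> act r y = w then edge_upto \<phi> (len w) w r else 0)" if "r \<in> {s, t}" for r
      using edge_split[OF w d y l that] .
    from this[of s] this[of t]
    show "(if par y then 0 else edge \<phi> y s + edge \<phi> y t) = (if par y then 0 else extend_edge (edge_upto \<phi> n) y s + extend_edge (edge_upto \<phi> n) y t)
      + ((if par y then 0 else if y = w \<or> act s y = w then edge_upto \<phi> (len w) w s else 0)
      + (if par y then 0 else if y = w \<or> act t y = w then edge_upto \<phi> (len w) w t else 0))"
      by (simp only: insertI1 insertI2 simp_thms if_True if_False ac_simps add_0_left add_0_right split: if_split) blast
  qed
  then show ?thesis
    unfolding sum.distrib one[of s, simplified] one[of t, simplified] by (simp add: cell_sum_def)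
qed

text \<open>Holds by construction: the recursion for \<open>edge_upto\<close> solves this very
  equation for the value at \<open>s\<close>.\<close>

lemma cell_sum_edge_pick:
  assumes w: "w \<in> W" and s: "s \<in> descents w" "s \<noteq> pick_descents w"
  shows "cell_sum (edge \<phi>) s (pick_descents w) w = \<phi> {s, pick_descents w}"
proof -
  obtain n where n: "len w = Suc n" using s(1) descents_iff[OF w] by auto
  have p: "pick_descents w \<in> descents w" unfolding pick_descents_def using s(1) by (rule someI)
  show ?thesis
    unfolding cell_sum_edge_top[OF w s(1) p n] using n s(2) by (simp add: add.commute)
qed

section \<open>Sums of edge values along words\<close>

primrec path_sum :: "('s set \<Rightarrow> bit) \<Rightarrow> 's list \<Rightarrow> 's chamber \<Rightarrow> bit" where
  "path_sum \<phi> [] w = 0"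
| "path_sum \<phi> (s # u) w = edge \<phi> w s + path_sum \<phi> u (act s w)"

lemma path_sum_append: "path_sum \<phi> (u @ v) w = path_sum \<phi> u w + path_sum \<phi> v (run u w)"
  by (induction u arbitrary: w) (auto simp: ac_simps)

lemma path_sum_rev: "u \<in> lists S \<Longrightarrow> w \<in> W \<Longrightarrow> path_sum \<phi> (rev u) (run u w) = path_sum \<phi> u w"
proof (induction u arbitrary: w)
  case (Cons s u)
  then have "path_sum \<phi> (rev u) (run u (act s w)) = path_sum \<phi> u (act s w)" by (auto simp: act_in_W)
  moreover have "run (rev u) (run u (act s w)) = act s w" using Cons by (intro run_rev) auto
  ultimately show ?case using Cons edge_act[of w s \<phi>] by (auto simp: path_sum_append ac_simps)
qed simp

lemma path_sum_alternating:
  "path_sum \<phi> (alternating s t n) w = (\<Sum>j<n. edge \<phi> (run (alternating s t j) w) (if even j then s else t))"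
proof (induction n)
  case (Suc n)
  show ?case unfolding alternating_Suc_right path_sum_append Suc by simp
qed simp

text \<open>Every edge of a rank 3 orbit lies in exactly two of its dihedral suborbits, so the values
  of \<open>cell_sum\<close> over these add up to \<open>0\<close>; by \<open>parity_orb\<close> so do the values of \<open>\<phi>\<close>.
  Hence the last of the equations \<open>cell_sum = \<phi>\<close> follows from the others.\<close>

lemma cell_sum_edge_descents:
  assumes adm: "admissible \<phi>" and "w \<in> W" "s \<in> descents w" "t \<in> descents w" "s \<noteq> t"
  shows "cell_sum (edge \<phi>) s t w = \<phi> {s, t}"
  using assms(2-)
proof (induction "len w" arbitrary: w s t rule: less_induct)
  case less
  note w = less(2)
  define u where "u = pick_descents w"
  have u: "u \<in> descents w" unfolding u_def pick_descents_def using less(3) by (rule someI)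
  show ?case
  proof (cases "s = u \<or> t = u")
    case True
    then show ?thesis
      using cell_sum_edge_pick[OF w less(3), of \<phi>] cell_sum_edge_pick[OF w less(4), of \<phi>] less(5)
        cell_sum_swap[of "edge \<phi>" s t w] by (auto simp: u_def insert_commute)
  next
    case False
    let ?J = "{s, t, u}"
    let ?C = "orb ?J w"
    let ?g = "\<lambda>a b y. if par y then 0 else edge \<phi> y a + edge \<phi> y b"
    let ?T = "\<lambda>a b. {y \<in> ?C. a \<in> descents y \<and> b \<in> descents y}"
    have J: "?J \<subseteq> S" "?J \<subseteq> descents w" using less u by (auto simp: descents_def)
    have fin: "finite ?C" by (rule finite_orb_top[OF J(1) w J(2)])
    have CW: "?C \<subseteq> W" by (rule orb_in_W[OF w J(1)])
    have lower: "cell_sum (edge \<phi>) a b y = \<phi> {a, b}" if "y \<in> ?T a b" "y \<noteq> w" "a \<noteq> b" for a b y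
      using less(1)[of y a b] len_orb_top_less[OF J(1) w J(2), of y] that CW by blast
    have tops: "sum (?g a b) ?C = (\<Sum>y\<in>?T a b. cell_sum (edge \<phi>) a b y)" if "a \<in> ?J" "b \<in> ?J" for a b
      unfolding cell_sum_def using sum_orb_tops[OF J(1) w fin, of "{a, b}" "?g a b"] that by simp
    \<comment> \<open>Only the polygon with top \<open>w\<close> escapes the induction hypothesis.
      Adding \<open>\<phi> {a, b}\<close> twice completes the terms of the others to the full count
      of polygons.\<close>
    have split: "sum (?g a b) ?C = of_nat (card (?T a b)) * \<phi> {a, b} + (cell_sum (edge \<phi>) a b w + \<phi> {a, b})"
      if ab: "a \<in> ?J" "b \<in> ?J" "a \<noteq> b" for a b
    proof -
      have wT: "w \<in> ?T a b" using self_in_orb ab J(2) by blast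
      have finT: "finite (?T a b)" using fin by simp
      have "sum (?g a b) ?C = cell_sum (edge \<phi>) a b w + (\<Sum>y\<in>?T a b - {w}. cell_sum (edge \<phi>) a b y)"
        unfolding tops[OF ab(1,2)] by (rule sum.remove[OF finT wT])
      also have "(\<Sum>y\<in>?T a b - {w}. cell_sum (edge \<phi>) a b y) = (\<Sum>y\<in>?T a b - {w}. \<phi> {a, b})"
        by (rule sum.cong[OF HOL.refl lower]) (use ab in auto)
      also have "cell_sum (edge \<phi>) a b w + \<dots> = (cell_sum (edge \<phi>) a b w + \<phi> {a, b}) + (\<phi> {a, b} + (\<Sum>y\<in>?T a b - {w}. \<phi> {a, b}))"
        by (simp only: add.assoc bit_add_self_left)
      also have "\<phi> {a, b} + (\<Sum>y\<in>?T a b - {w}. \<phi> {a, b}) = (\<Sum>y\<in>?T a b. \<phi> {a, b})"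
        by (rule sum.remove[OF finT wT, symmetric])
      finally show ?thesis by (simp only: sum_constant ac_simps)
    qed
    have e: "sum (?g s t) ?C = of_nat (card (?T s t)) * \<phi> {s, t} + (cell_sum (edge \<phi>) s t w + \<phi> {s, t})"
      "sum (?g s u) ?C = of_nat (card (?T s u)) * \<phi> {s, u} + (cell_sum (edge \<phi>) s u w + \<phi> {s, u})"
      "sum (?g t u) ?C = of_nat (card (?T t u)) * \<phi> {t, u} + (cell_sum (edge \<phi>) t u w + \<phi> {t, u})"
      by (rule split; use False less(5) in simp)+
    \<comment> \<open>Each of the three edge values at a chamber occurs in two of the three
      sums.\<close>
    have "sum (?g s t) ?C + sum (?g s u) ?C + sum (?g t u) ?C = 0"
      unfolding sum.distrib[symmetric] by (rule sum.neutral) (auto simp: ac_simps)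
    then have "(of_nat (card (?T s t)) * \<phi> {s, t} + of_nat (card (?T s u)) * \<phi> {s, u} + of_nat (card (?T t u)) * \<phi> {t, u})
      + ((cell_sum (edge \<phi>) s t w + \<phi> {s, t}) + (cell_sum (edge \<phi>) s u w + \<phi> {s, u}) + (cell_sum (edge \<phi>) t u w + \<phi> {t, u})) = 0"
      unfolding e by (simp only: ac_simps)
    moreover have "of_nat (card (?T s t)) * \<phi> {s, t} + of_nat (card (?T s u)) * \<phi> {s, u} + of_nat (card (?T t u)) * \<phi> {t, u} = 0"
      by (rule parity_orb[OF w less(3,4) u less(5) _ _ adm]) (use False in auto)
    moreover have "cell_sum (edge \<phi>) s u w = \<phi> {s, u}" "cell_sum (edge \<phi>) t u w = \<phi> {t, u}"
      using cell_sum_edge_pick[OF w, of s \<phi>] cell_sum_edge_pick[OF w, of t \<phi>] less(3,4) False by (auto simp: u_def)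
    ultimately show ?thesis by (simp only: bit_add_self add_0_left add_0_right bit_add_eq_0)
  qed
qed

lemma cell_sum_edge:
  assumes adm: "admissible \<phi>" and a: "w \<in> W" "s \<in> S" "t \<in> S" "s \<noteq> t" "m s t = enat k"
  shows "cell_sum (edge \<phi>) s t w = \<phi> {s, t}"
proof -
  have "2 \<le> k" using m_enat_ge2 a by blast
  then have "finite (orb {s, t} w)" using card_orb_dihedral[OF a(2-5,1)] card_ge_0_finite by force
  then obtain y where y: "y \<in> orb {s, t} w" "{s, t} \<subseteq> descents y" using exists_top[OF a(1), of "{s, t}"] a by auto
  then have "y \<in> W" using orb_in_W[OF a(1), of "{s, t}"] a by auto
  then have "cell_sum (edge \<phi>) s t y = \<phi> {s, t}" using cell_sum_edge_descents[OF adm] y a by blast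
  then show ?thesis using cell_sum_orb[OF y(1)] a by simp
qed

text \<open>The two alternating words run along the two halves of a polygon to the opposite chamber;
  reversing one of them closes the circuit, so their sums add up to \<open>cell_sum\<close>.\<close>

lemma path_sum_dihedral:
  assumes adm: "admissible \<phi>" and w: "w \<in> W" and st: "s \<in> S" "t \<in> S" "s \<noteq> t" and k: "m s t = enat k"
  shows "path_sum \<phi> (alternating s t k) w + path_sum \<phi> (alternating t s k) w = \<phi> {s, t}"
proof -
  let ?O = "orb {s, t} w"
  have J: "{s, t} \<subseteq> S" using st by simp
  have OW: "?O \<subseteq> W" by (rule orb_in_W[OF w J])
  \<comment> \<open>Edges of type \<open>r\<close> may be summed at their odd or at their even ends.
    The circuit leaves along \<open>s\<close> and along \<open>t\<close> at chambers of different
    parity, hence this exchange.\<close>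
  have flip: "(\<Sum>y\<in>?O. if par y then edge \<phi> y r else 0) = (\<Sum>y\<in>?O. if par y then 0 else edge \<phi> y r)"
    if r: "r \<in> {s, t}" for r
  proof -
    have "r \<in> S" using r J by blast
    then have b: "bij_betw (act r) ?O ?O"
      by (intro bij_betwI[where g = "act r"]) (auto simp: act_in_orb[OF _ r])
    have "(\<Sum>y\<in>?O. if par y then edge \<phi> y r else 0) = (\<Sum>y\<in>?O. if par (act r y) then edge \<phi> (act r y) r else 0)"
      by (rule sum.reindex_bij_betw[OF b, symmetric])
    also have "\<dots> = (\<Sum>y\<in>?O. if par y then 0 else edge \<phi> y r)"
      by (rule sum.cong) (use OW \<open>r \<in> S\<close> edge_act in auto)
    finally show ?thesis .
  qed
  have "path_sum \<phi> (alternating s t (2 * k)) w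
      = (\<Sum>j<2 * k. (\<lambda>y. if par y = par w then edge \<phi> y s else edge \<phi> y t) (run (alternating s t j) w))"
    unfolding path_sum_alternating by (rule sum.cong) (auto simp: par_run)
  also have "\<dots> = (\<Sum>y\<in>?O. if par y = par w then edge \<phi> y s else edge \<phi> y t)"
    by (rule sum.reindex_bij_betw[OF dihedral_orbit[OF st k w]])
  also have "\<dots> = (\<Sum>y\<in>?O. if par y then 0 else edge \<phi> y s) + (\<Sum>y\<in>?O. if par y then 0 else edge \<phi> y t)"
  proof (cases "par w")
    case True
    have "(\<Sum>y\<in>?O. if par y = par w then edge \<phi> y s else edge \<phi> y t)
      = (\<Sum>y\<in>?O. (if par y then edge \<phi> y s else 0) + (if par y then 0 else edge \<phi> y t))"
      by (rule sum.cong) (use True in auto)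
    then show ?thesis using flip[of s] by (simp add: sum.distrib)
  next
    case False
    have "(\<Sum>y\<in>?O. if par y = par w then edge \<phi> y s else edge \<phi> y t)
      = (\<Sum>y\<in>?O. (if par y then 0 else edge \<phi> y s) + (if par y then edge \<phi> y t else 0))"
      by (rule sum.cong) (use False in auto)
    then show ?thesis using flip[of t] by (simp add: sum.distrib)
  qed
  also have "\<dots> = cell_sum (edge \<phi>) s t w"
    unfolding cell_sum_def sum.distrib[symmetric] by (rule sum.cong) auto
  also have "\<dots> = \<phi> {s, t}" by (rule cell_sum_edge[OF adm w st k])
  finally have "path_sum \<phi> (alternating s t k) w + path_sum \<phi> (rev (alternating t s k)) (run (alternating s t k) w) = \<phi> {s, t}"
    by (simp add: alternating_double path_sum_append)
  moreover have "path_sum \<phi> (rev (alternating t s k)) (run (alternating t s k) w) = path_sum \<phi> (alternating t s k) w"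
    by (rule path_sum_rev) (use st w in \<open>auto simp: alternating_in_lists\<close>)
  ultimately show ?thesis using run_alternating_swap[OF st k, of w] by simp
qed

text \<open>A relator changes the sum by \<open>\<phi> {s, t}\<close> from whichever chamber the
  word starts, so the discrepancy \<open>e\<close> does not depend on \<open>w\<close>; this is the
  centrality of the extension. \<open>map fst\<close> may forget exponents because a letter acts as
  an involution and an edge has the same value in both directions.\<close>

lemma path_sum_pres_rel:
  assumes adm: "admissible \<phi>"
    and uv: "(u, v) \<in> pres_rel S (artin_relations S m)"
  shows "\<exists>e. \<forall>w\<in>W. run (map fst u) w = run (map fst v) w \<and> path_sum \<phi> (map fst u) w = path_sum \<phi> (map fst v) w + e"
  using uv
proof (induction rule: pres_rel.induct)
  case (refl u)
  then show ?case by (intro exI[of _ 0]) auto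
next
  case (sym u v)
  then obtain e where "\<forall>w\<in>W. run (map fst u) w = run (map fst v) w \<and> path_sum \<phi> (map fst u) w = path_sum \<phi> (map fst v) w + e"
    by blast
  then show ?case by (intro exI[of _ e]) (auto simp: add.assoc)
next
  case (trans u v x)
  then obtain e e' where "\<forall>w\<in>W. run (map fst u) w = run (map fst v) w \<and> path_sum \<phi> (map fst u) w = path_sum \<phi> (map fst v) w + e"
    "\<forall>w\<in>W. run (map fst v) w = run (map fst x) w \<and> path_sum \<phi> (map fst v) w = path_sum \<phi> (map fst x) w + e'"
    by blast
  then show ?case by (intro exI[of _ "e' + e"]) (auto simp: add.assoc)
next
  case (cancel x u v b)
  then have "map fst u \<in> lists S" using map_fst_words_over by blast
  then have "run (map fst u) w \<in> W" if "w \<in> W" for w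
    using that by (auto intro!: run_in_W)
  then show ?case using cancel(1) by (intro exI[of _ 0]) (auto simp: path_sum_append edge_act)
next
  case (relator l r u v)
  then obtain s t k where st: "s \<in> S" "t \<in> S" "s \<noteq> t" "m s t = enat k"
    and lr: "l = alternating (s, True) (t, True) k" "r = alternating (t, True) (s, True) k"
    by (auto simp: artin_relations_def)
  have fst: "map fst (alternating (a, c) (b, c) n) = alternating a b n" for a b :: 's and c :: bool and n
    by (induction n arbitrary: a b) auto
  have "map fst u \<in> lists S" using relator map_fst_words_over by blast
  then have W: "run (map fst u) w \<in> W" if "w \<in> W" for w
    using that by (auto intro!: run_in_W)
  have "path_sum \<phi> (alternating s t k) w = path_sum \<phi> (alternating t s k) w + \<phi> {s, t}" if "w \<in> W" for w
    unfolding path_sum_dihedral[OF adm that st, symmetric] by (simp add: add.left_commute)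
  then show ?case
    using W run_alternating_swap[OF st]
    by (intro exI[of _ "\<phi> {s, t}"] ballI) (simp add: lr fst path_sum_append ac_simps)
qed

end

section \<open>Two-cocycles of presented groups\<close>

text \<open>Cocycles are not normalised: the identity of the central extension has the bit
  \<open>f \<one> \<one>\<close>, which explains the values at \<open>[]\<close> below.\<close>

definition cocycle :: "('g, 'b) monoid_scheme \<Rightarrow> ('g \<Rightarrow> 'g \<Rightarrow> bit) \<Rightarrow> bool" where
  "cocycle G f \<longleftrightarrow> (\<forall>g\<in>carrier G. \<forall>h\<in>carrier G. \<forall>k\<in>carrier G.
     f g h + f (g \<otimes>\<^bsub>G\<^esub> h) k = f h k + f g (h \<otimes>\<^bsub>G\<^esub> k))"

definition coboundary :: "('g, 'b) monoid_scheme \<Rightarrow> ('g \<Rightarrow> 'g \<Rightarrow> bit) \<Rightarrow> bool" where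
  "coboundary G f \<longleftrightarrow> (\<exists>H. \<forall>g\<in>carrier G. \<forall>h\<in>carrier G. f g h = H g + H h + H (g \<otimes>\<^bsub>G\<^esub> h))"

lemma bit_swap_sides: "(a::bit) + b = c \<longleftrightarrow> a = b + c"
  by (cases a; cases b; cases c) auto

lemma cocycleD:
  "\<lbrakk>cocycle G f; g \<in> carrier G; h \<in> carrier G; k \<in> carrier G\<rbrakk>
    \<Longrightarrow> f g (h \<otimes>\<^bsub>G\<^esub> k) = f g h + f (g \<otimes>\<^bsub>G\<^esub> h) k + f h k"
  unfolding cocycle_def by (metis add.commute bit_swap_sides)

lemma cocycle_add: "cocycle G f \<Longrightarrow> cocycle G f' \<Longrightarrow> cocycle G (\<lambda>g h. f g h + f' g h)"
  unfolding cocycle_def by (simp add: ac_simps)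

lemma cocycle_sum:
  "(\<And>i. i \<in> I \<Longrightarrow> cocycle G (f i)) \<Longrightarrow> cocycle G (\<lambda>g h. \<Sum>i\<in>I. c i * f i g h)"
  unfolding cocycle_def by (simp add: sum.distrib[symmetric] distrib_left[symmetric] cong: sum.cong)

lemma (in group) cocycle_one:
  assumes "cocycle G f" "g \<in> carrier G"
  shows "f \<one> g = f \<one> \<one>" "f g \<one> = f \<one> \<one>"
  using cocycleD[OF assms(1), of \<one> \<one> g] cocycleD[OF assms(1), of g \<one> \<one>] assms(2)
  by (auto simp: bit_swap_sides)

lemma (in group) cocycle_inv:
  assumes "cocycle G f" "g \<in> carrier G"
  shows "f g (inv g) = f (inv g) g"
proof -
  have "f g \<one> = f g (inv g) + f \<one> g + f (inv g) g"
    using cocycleD[OF assms(1), of g "inv g" g] assms(2) by simp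
  then have "f \<one> \<one> = f g (inv g) + f \<one> \<one> + f (inv g) g"
    using cocycle_one[OF assms] by simp
  then show ?thesis
    by (cases "f \<one> \<one>"; cases "f g (inv g)"; cases "f (inv g) g") simp_all
qed

text \<open>In the central extension the commutator with a lift of \<open>a\<close> is
  multiplicative on the centraliser of \<open>a\<close>; \<open>f a g + f g a\<close> is its
  bit.\<close>

lemma (in group) cocycle_commutator:
  assumes f: "cocycle G f" and "a \<in> carrier G" "g \<in> carrier G" "h \<in> carrier G"
    and ag: "a \<otimes> g = g \<otimes> a" and ah: "a \<otimes> h = h \<otimes> a"
  shows "f a (g \<otimes> h) + f (g \<otimes> h) a = (f a g + f g a) + (f a h + f h a)"
proof -
  have e: "f a (g \<otimes> h) = f a g + f (a \<otimes> g) h + f g h"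
    "f g (h \<otimes> a) = f g h + f (g \<otimes> h) a + f h a"
    "f g (a \<otimes> h) = f g a + f (g \<otimes> a) h + f a h"
    using cocycleD[OF f, of a g h] cocycleD[OF f, of g h a] cocycleD[OF f, of g a h] assms by simp_all
  have "f (g \<otimes> h) a = f g (h \<otimes> a) + f g h + f h a"
    unfolding e(2) by (simp add: ac_simps)
  also have "f g (h \<otimes> a) = f g a + f (g \<otimes> a) h + f a h"
    unfolding ah[symmetric] by (rule e(3))
  finally show ?thesis unfolding e(1) ag by (simp add: ac_simps)
qed


section \<open>Evaluating words in a central extension\<close>

lemma carrier_presented_group:
  "carrier (presented_group X R) = (\<lambda>u. pres_rel X R `` {u}) ` words_over X"
  by (auto simp: presented_group_def quotient_def)

lemma one_presented_group: "\<one>\<^bsub>presented_group X R\<^esub> = pres_rel X R `` {[]}"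
  by (simp add: presented_group_def)

lemma class_in_carrier: "u \<in> words_over X \<Longrightarrow> pres_rel X R `` {u} \<in> carrier (presented_group X R)"
  unfolding carrier_presented_group by (rule imageI)

lemma class_eqI: "(u, v) \<in> pres_rel X R \<Longrightarrow> pres_rel X R `` {u} = pres_rel X R `` {v}"
  by (rule equiv_class_eq[OF equiv_pres_rel])

text \<open>\<open>lift_sum X R f h u\<close> is the \<open>bit\<close>-component of the word \<open>u\<close> evaluated in the central
  extension given by \<open>f\<close>, where the generator \<open>x\<close> is lifted to \<open>(x, h x)\<close>.\<close>

primrec lift_sum :: "'a set \<Rightarrow> ('a word \<times> 'a word) set \<Rightarrow> ('a word set \<Rightarrow> 'a word set \<Rightarrow> bit) \<Rightarrow> ('a \<Rightarrow> bit) \<Rightarrow> 'a word \<Rightarrow> bit" where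
  "lift_sum X R f h [] = f (pres_rel X R `` {[]}) (pres_rel X R `` {[]})"
| "lift_sum X R f h (y # u) =
    h (fst y) + (if snd y then 0 else
      f (pres_rel X R `` {[(fst y, False)]}) (pres_rel X R `` {[(fst y, True)]})
      + f (pres_rel X R `` {[]}) (pres_rel X R `` {[]}))
    + lift_sum X R f h u + f (pres_rel X R `` {[y]}) (pres_rel X R `` {u})"

context
  fixes X :: "'a set" and R :: "('a word \<times> 'a word) set" and f :: "'a word set \<Rightarrow> 'a word set \<Rightarrow> bit"
  assumes f: "cocycle (presented_group X R) f"
begin

interpretation group "presented_group X R" by (rule group_presented_group)

lemma cocycle_word:
  assumes "u \<in> words_over X" "v \<in> words_over X" "w \<in> words_over X"
  shows "f (pres_rel X R `` {u}) (pres_rel X R `` {v @ w})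
    = f (pres_rel X R `` {u}) (pres_rel X R `` {v}) + f (pres_rel X R `` {u @ v}) (pres_rel X R `` {w})
      + f (pres_rel X R `` {v}) (pres_rel X R `` {w})"
  using cocycleD[OF f class_in_carrier[OF assms(1)] class_in_carrier[OF assms(2)] class_in_carrier[OF assms(3)]]
    presented_group_mult[OF assms(1,2)] presented_group_mult[OF assms(2,3)] by simp

lemma cocycle_Nil:
  assumes "u \<in> words_over X"
  shows "f (pres_rel X R `` {[]}) (pres_rel X R `` {u}) = f (pres_rel X R `` {[]}) (pres_rel X R `` {[]})"
    "f (pres_rel X R `` {u}) (pres_rel X R `` {[]}) = f (pres_rel X R `` {[]}) (pres_rel X R `` {[]})"
  using cocycle_one[OF f class_in_carrier[OF assms]] by (simp_all add: one_presented_group)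

lemma lift_sum_append:
  assumes "u \<in> words_over X" "v \<in> words_over X"
  shows "lift_sum X R f h (u @ v)
    = lift_sum X R f h u + lift_sum X R f h v + f (pres_rel X R `` {u}) (pres_rel X R `` {v})"
  using assms
proof (induction u)
  case Nil
  then show ?case by (simp add: cocycle_Nil(1)[OF assms(2)] ac_simps)
next
  case (Cons y u)
  then show ?case using cocycle_word[of "[y]" u v] by (simp add: ac_simps)
qed

text \<open>The extra terms for an inverse letter in \<open>lift_sum\<close> give the bit of the
  inverse of a lift; by \<open>cocycle_inv\<close> it is inverse on both sides.\<close>

lemma lift_sum_cancel:
  assumes x: "x \<in> X"
  shows "lift_sum X R f h [(x, b), (x, \<not> b)] = lift_sum X R f h []"
proof -
  let ?c = "\<lambda>u. pres_rel X R `` {u}"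
  have w: "[(x, b)] \<in> words_over X" for b using x by auto
  have "?c [(x, b)] \<otimes>\<^bsub>presented_group X R\<^esub> ?c [(x, \<not> b)] = \<one>\<^bsub>presented_group X R\<^esub>" for b
    using presented_group_mult[OF w w, of R b "\<not> b"] class_eqI[OF pres_rel.cancel[OF x, of "[]" "[]" b]]
    by (simp add: one_presented_group)
  from this[of False] have "inv\<^bsub>presented_group X R\<^esub> (?c [(x, True)]) = ?c [(x, False)]"
    by (intro inv_equality class_in_carrier w) simp
  then have "f (?c [(x, True)]) (?c [(x, False)]) = f (?c [(x, False)]) (?c [(x, True)])"
    using cocycle_inv[OF f class_in_carrier[OF w[of True]]] by simp
  then show ?thesis
    using cocycle_Nil[OF w[of True]] cocycle_Nil[OF w[of False]] by (cases b) (simp_all add: ac_simps)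
qed

text \<open>Respecting the relators suffices: a context contributes only its own evaluation and
  values of \<open>f\<close> on classes, and these agree.\<close>

lemma lift_sum_pres_rel:
  assumes rel: "\<And>l r. (l, r) \<in> R \<Longrightarrow> l \<in> words_over X \<Longrightarrow> r \<in> words_over X \<Longrightarrow> lift_sum X R f h l = lift_sum X R f h r"
    and "(u, v) \<in> pres_rel X R"
  shows "lift_sum X R f h u = lift_sum X R f h v"
  using assms(2)
proof (induction rule: pres_rel.induct)
  case (cancel x u v b)
  have w: "[(x, b), (x, \<not> b)] \<in> words_over X" using cancel by auto
  have c: "pres_rel X R `` {[(x, b), (x, \<not> b)] @ v} = pres_rel X R `` {v}"
    "pres_rel X R `` {[(x, b), (x, \<not> b)]} = pres_rel X R `` {[]}"
    using class_eqI[OF pres_rel.cancel[OF cancel(1) _ cancel(3), of "[]" b R]]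
      class_eqI[OF pres_rel.cancel[OF cancel(1), of "[]" "[]" b R]] by auto
  have wv: "[(x, b), (x, \<not> b)] @ v \<in> words_over X" using w cancel by (simp only: append_in_lists_conv)
  have "lift_sum X R f h ([(x, b), (x, \<not> b)] @ v) = lift_sum X R f h v"
    unfolding lift_sum_append[OF w cancel(3)] lift_sum_cancel[OF cancel(1)] c
    using cocycle_Nil[OF cancel(3)] by (simp add: ac_simps)
  then show ?case unfolding lift_sum_append[OF cancel(2) wv] lift_sum_append[OF cancel(2,3)] c by simp
next
  case (relator l r u v)
  have c: "pres_rel X R `` {l @ v} = pres_rel X R `` {r @ v}" "pres_rel X R `` {l} = pres_rel X R `` {r}"
    using class_eqI[OF pres_rel.relator[OF relator(1-3) _ relator(5), of "[]"]]
      class_eqI[OF pres_rel.relator[OF relator(1-3), of "[]" "[]"]] by auto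
  have w: "l @ v \<in> words_over X" "r @ v \<in> words_over X" using relator by auto
  have "lift_sum X R f h (l @ v) = lift_sum X R f h (r @ v)"
    unfolding lift_sum_append[OF relator(2,5)] lift_sum_append[OF relator(3,5)] c
    using rel[OF relator(1-3)] by simp
  then show ?case unfolding lift_sum_append[OF relator(4) w(1)] lift_sum_append[OF relator(4) w(2)] c by simp
qed auto

text \<open>If the lifted generators satisfy the relations, they define a homomorphic section, and
  its bit \<open>H\<close> exhibits \<open>f\<close> as a coboundary.\<close>

lemma coboundary_if_lift:
  assumes rel: "\<And>l r. (l, r) \<in> R \<Longrightarrow> l \<in> words_over X \<Longrightarrow> r \<in> words_over X \<Longrightarrow> lift_sum X R f h l = lift_sum X R f h r"
  shows "coboundary (presented_group X R) f"
proof -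
  let ?c = "\<lambda>u. pres_rel X R `` {u}"
  define H where "H A = lift_sum X R f h (SOME u. u \<in> A)" for A
  have H: "H (?c u) = lift_sum X R f h u" if "u \<in> words_over X" for u
  proof -
    have "u \<in> ?c u" using pres_rel.refl[OF that] by blast
    then have "(SOME v. v \<in> ?c u) \<in> ?c u" by (rule someI)
    then show ?thesis unfolding H_def using lift_sum_pres_rel[OF rel] by fastforce
  qed
  have "f g k = H g + H k + H (g \<otimes>\<^bsub>presented_group X R\<^esub> k)"
    if gk: "g \<in> carrier (presented_group X R)" "k \<in> carrier (presented_group X R)" for g k
  proof -
    obtain u v where u: "u \<in> words_over X" "g = ?c u" and v: "v \<in> words_over X" "k = ?c v"
      using gk unfolding carrier_presented_group by blast
    have "H (g \<otimes>\<^bsub>presented_group X R\<^esub> k) = lift_sum X R f h (u @ v)"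
      using presented_group_mult[OF u(1) v(1), of R] H[of "u @ v"] u v by simp
    then show ?thesis
      using H[OF u(1)] H[OF v(1)] lift_sum_append[OF u(1) v(1), of h] u(2) v(2)
      by (simp add: ac_simps)
  qed
  then show ?thesis unfolding coboundary_def by blast
qed

end

section \<open>Two-cocycles of Artin groups\<close>

abbreviation pos :: "'a list \<Rightarrow> 'a word" where
  "pos u \<equiv> map (\<lambda>x. (x, True)) u"

lemma alternating_pos: "alternating (s, True) (t, True) k = pos (alternating s t k)"
  by (induction k arbitrary: s t) auto

lemma pos_words_over: "u \<in> lists X \<Longrightarrow> pos u \<in> words_over X"
  by (induction u) auto

lemma lift_sum_pos:
  "lift_sum X R f h (pos u) = lift_sum X R f (\<lambda>_. 0) (pos u) + sum_list (map h u)"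
  by (induction u) (auto simp: ac_simps)

text \<open>For even \<open>k\<close> both words contain each letter equally often; for odd
  \<open>k\<close> one has an additional \<open>s\<close>, the other an additional \<open>t\<close>.
  So the choice of lifts affects only odd labels, where it acts as the coboundary of a vertex
  function on the odd graph.\<close>

lemma sum_list_alternating:
  fixes h :: "'a \<Rightarrow> bit"
  shows "sum_list (map h (alternating s t k)) + sum_list (map h (alternating t s k)) = (if odd k then h s + h t else 0)"
proof (induction k)
  case (Suc k)
  have "sum_list (map h (alternating s t (Suc k))) + sum_list (map h (alternating t s (Suc k)))
     = h s + h t + (sum_list (map h (alternating s t k)) + sum_list (map h (alternating t s k)))"
    by (simp add: ac_simps)
  also have "sum_list (map h (alternating s t k)) + sum_list (map h (alternating t s k)) = (if odd k then h s + h t else 0)"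
    by (rule Suc)
  also have "h s + h t + (if odd k then h s + h t else 0) = (if odd (Suc k) then h s + h t else 0)"
    by simp
  finally show ?case .
qed simp

lemma lift_sum_linear:
  "lift_sum X R (\<lambda>g k. \<Sum>i\<in>I. c i * f i g k) (\<lambda>_. 0) (pos u)
    = (\<Sum>i\<in>I. c i * lift_sum X R (f i) (\<lambda>_. 0) (pos u))"
  by (induction u) (simp_all add: sum.distrib distrib_left)

lemma lift_sum_add:
  "lift_sum X R (\<lambda>g k. f g k + f' g k) (\<lambda>_. 0) (pos u)
    = lift_sum X R f (\<lambda>_. 0) (pos u) + lift_sum X R f' (\<lambda>_. 0) (pos u)"
  by (induction u) (simp_all add: ac_simps)

text \<open>\<open>H\<close> is the bit of a homomorphic section of the extension; a word lifted
  letter by letter differs from the section by the sum over its letters.\<close>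

lemma lift_sum_coboundary:
  assumes H: "\<And>g k. g \<in> carrier (presented_group X R) \<Longrightarrow> k \<in> carrier (presented_group X R) \<Longrightarrow>
      f g k = H g + H k + H (g \<otimes>\<^bsub>presented_group X R\<^esub> k)"
    and u: "u \<in> lists X"
  shows "lift_sum X R f (\<lambda>_. 0) (pos u)
    = sum_list (map (\<lambda>x. H (pres_rel X R `` {[(x, True)]})) u) + H (pres_rel X R `` {pos u})"
  using u
proof (induction u)
  case Nil
  have "pres_rel X R `` {[]} \<in> carrier (presented_group X R)"
    by (rule class_in_carrier) simp
  then show ?case using H presented_group_mult[of "[]" X "[]" R] by simp
next
  case (Cons x u)
  have w: "[(x, True)] \<in> words_over X" "pos u \<in> words_over X" using Cons by (auto simp: pos_words_over)
  show ?case
    using Cons H[OF class_in_carrier[OF w(1)] class_in_carrier[OF w(2)]] presented_group_mult[OF w, of R]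
    by (simp add: ac_simps)
qed

section \<open>Signs of the braid relations\<close>

context coxeter
begin

abbreviation cls :: "'s word \<Rightarrow> 's word set" where
  "cls u \<equiv> pres_rel S (artin_relations S m) `` {u}"

text \<open>All generators are lifted with bit \<open>0\<close>; an infinite label carries no
  relation and gets \<open>0\<close>.\<close>

definition disc :: "('s word set \<Rightarrow> 's word set \<Rightarrow> bit) \<Rightarrow> 's \<Rightarrow> 's \<Rightarrow> bit" where
  "disc f s t = (case m s t of
      enat k \<Rightarrow> lift_sum S (artin_relations S m) f (\<lambda>_. 0) (pos (alternating s t k))
        + lift_sum S (artin_relations S m) f (\<lambda>_. 0) (pos (alternating t s k))
    | \<infinity> \<Rightarrow> 0)"

lemma disc_sum: "disc (\<lambda>g k. \<Sum>i\<in>I. c i * f i g k) s t = (\<Sum>i\<in>I. c i * disc (f i) s t)"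
  unfolding disc_def by (cases "m s t") (simp_all add: lift_sum_linear sum.distrib distrib_left)

lemma disc_add: "disc (\<lambda>g k. f g k + f' g k) s t = disc f s t + disc f' s t"
  unfolding disc_def by (cases "m s t") (simp_all add: lift_sum_add ac_simps)

text \<open>Together with \<open>disc_coboundary\<close>: a cocycle is a coboundary exactly if its
  signs come from a vertex function \<open>h\<close>. Here \<open>h\<close> is the corrected choice
  of lifts, with which all braid relations hold in the extension.\<close>

lemma coboundary_if_disc:
  assumes f: "cocycle (artin_group S m) f"
    and h: "\<And>s t k. \<lbrakk>s \<in> S; t \<in> S; s \<noteq> t; m s t = enat k\<rbrakk> \<Longrightarrow> disc f s t = (if odd k then h s + h t else 0)"
  shows "coboundary (artin_group S m) f"
  unfolding artin_group_def
proof (rule coboundary_if_lift[OF f[unfolded artin_group_def], where h = h])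
  fix l r assume "(l, r) \<in> artin_relations S m"
  then obtain s t k where st: "s \<in> S" "t \<in> S" "s \<noteq> t" "m s t = enat k"
    and lr: "l = pos (alternating s t k)" "r = pos (alternating t s k)"
    by (auto simp: artin_relations_def alternating_pos)
  have "disc f s t = sum_list (map h (alternating s t k)) + sum_list (map h (alternating t s k))"
    using h[OF st] by (simp add: sum_list_alternating)
  then have "lift_sum S (artin_relations S m) f (\<lambda>_. 0) l + lift_sum S (artin_relations S m) f (\<lambda>_. 0) r
      = sum_list (map h (alternating s t k)) + sum_list (map h (alternating t s k))"
    using st by (simp add: disc_def lr)
  then show "lift_sum S (artin_relations S m) f h l = lift_sum S (artin_relations S m) f h r"
    unfolding lr by (subst (1 2) lift_sum_pos) (simp add: bit_swap_sides ac_simps)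
qed

lemma cls_alternating_swap:
  assumes st: "s \<in> S" "t \<in> S" "s \<noteq> t" "m s t = enat k"
  shows "cls (pos (alternating s t k)) = cls (pos (alternating t s k))"
proof (rule class_eqI)
  have "(pos (alternating s t k), pos (alternating t s k)) \<in> artin_relations S m"
    using st by (auto simp: artin_relations_def alternating_pos)
  from pres_rel.relator[OF this, of S "[]" "[]"]
  show "(pos (alternating s t k), pos (alternating t s k)) \<in> pres_rel S (artin_relations S m)"
    using st by (simp add: pos_words_over alternating_in_lists)
qed

lemma disc_coboundary:
  assumes "coboundary (artin_group S m) f"
  obtains h where "\<And>s t k. \<lbrakk>s \<in> S; t \<in> S; s \<noteq> t; m s t = enat k\<rbrakk> \<Longrightarrow> disc f s t = (if odd k then h s + h t else 0)"
proof -
  obtain H where H: "\<And>g k. g \<in> carrier (artin_group S m) \<Longrightarrow> k \<in> carrier (artin_group S m) \<Longrightarrow>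
      f g k = H g + H k + H (g \<otimes>\<^bsub>artin_group S m\<^esub> k)"
    using assms unfolding coboundary_def by blast
  define h where "h = (\<lambda>x. H (cls [(x, True)]))"
  show thesis
  proof (rule that[of h])
    fix s t k assume st: "s \<in> S" "t \<in> S" "s \<noteq> t" "m s t = enat k"
    have ls: "lift_sum S (artin_relations S m) f (\<lambda>_. 0) (pos u) = sum_list (map h u) + H (cls (pos u))" if "u \<in> lists S" for u
      unfolding h_def by (rule lift_sum_coboundary[OF H[unfolded artin_group_def] that])
    have "disc f s t = sum_list (map h (alternating s t k)) + sum_list (map h (alternating t s k))"
      using st cls_alternating_swap[OF st]
      by (simp add: disc_def ls alternating_in_lists ac_simps)
    then show "disc f s t = (if odd k then h s + h t else 0)" by (simp add: sum_list_alternating)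
  qed
qed

text \<open>Both sides of the odd braid relation of \<open>t\<close> and \<open>t'\<close> are the
  same element, which commutes with \<open>s\<close>. Its commutator bit is additive over letters
  and can be computed from either side; the sides differ by one \<open>t\<close> against one
  \<open>t'\<close>.\<close>

lemma disc_admissible:
  assumes f: "cocycle (artin_group S m) f"
    and st: "s \<in> S" "t \<in> S" "t' \<in> S" "m s t = 2" "m s t' = 2" "odd_label (m t t')"
  shows "disc f s t = disc f s t'"
\<comment> \<open>The hypotheses admit \<open>t = t'\<close>, since the label
  \<open>m t t = 1\<close> is odd.\<close>
proof (cases "t = t'")
  case False
  interpret A: group "artin_group S m" unfolding artin_group_def by (rule group_presented_group)
  have f': "cocycle (presented_group S (artin_relations S m)) f" using f by (simp add: artin_group_def)
  have mult: "cls u \<otimes>\<^bsub>artin_group S m\<^esub> cls v = cls (u @ v)" if "u \<in> words_over S" "v \<in> words_over S" for u v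
    unfolding artin_group_def by (rule presented_group_mult[OF that])
  have carr: "cls u \<in> carrier (artin_group S m)" if "u \<in> words_over S" for u
    unfolding artin_group_def by (rule class_in_carrier[OF that])
  have one: "\<one>\<^bsub>artin_group S m\<^esub> = cls []" by (simp add: artin_group_def one_presented_group)
  obtain k where k: "m t t' = enat k" "odd k" using st by (auto simp: odd_label_def)
  define a where "a = cls [(s, True)]"
  define b where "b g = f a g + f g a" for g
  have sw: "[(s, True)] \<in> words_over S" using st by auto
  have com: "a \<otimes>\<^bsub>artin_group S m\<^esub> cls [(r, True)] = cls [(r, True)] \<otimes>\<^bsub>artin_group S m\<^esub> a
      \<and> disc f s r = b (cls [(r, True)])"
    if r: "r \<in> {t, t'}" for r
  proof -
    have rS: "r \<in> S" "m s r = enat 2" "s \<noteq> r" using r st m_self by (auto simp: numeral_eq_enat one_enat_def)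
    then have rw: "[(r, True)] \<in> words_over S" by auto
    have alt: "alternating x y 2 = [x, y]" for x y :: 's by (simp add: numeral_2_eq_2)
    have d: "disc f s r = lift_sum S (artin_relations S m) f (\<lambda>_. 0) ([(s, True)] @ [(r, True)])
        + lift_sum S (artin_relations S m) f (\<lambda>_. 0) ([(r, True)] @ [(s, True)])"
      using rS(2) by (simp add: disc_def alt)
    show ?thesis
      using cls_alternating_swap[OF st(1) rS(1,3,2)] mult[OF sw rw] mult[OF rw sw]
      unfolding d lift_sum_append[OF f' sw rw] lift_sum_append[OF f' rw sw]
      by (simp add: a_def b_def alt ac_simps)
  qed
  have word: "a \<otimes>\<^bsub>artin_group S m\<^esub> cls (pos u) = cls (pos u) \<otimes>\<^bsub>artin_group S m\<^esub> a
      \<and> b (cls (pos u)) = sum_list (map (disc f s) u)" if "u \<in> lists {t, t'}" for u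
    using that
  proof (induction u)
    case Nil
    have "a \<in> carrier (artin_group S m)" unfolding a_def by (rule carr[OF sw])
    then show ?case using A.cocycle_one[OF f, of a] by (simp add: b_def one[symmetric])
  next
    case (Cons r u)
    have uS: "u \<in> lists S" "r \<in> S" using Cons st by (auto intro: lists_mono[THEN subsetD, of "{t, t'}"])
    have w: "[(r, True)] \<in> words_over S" "pos u \<in> words_over S" using uS pos_words_over by auto
    have c: "a \<in> carrier (artin_group S m)" unfolding a_def by (rule carr[OF sw])
    have IH: "a \<otimes>\<^bsub>artin_group S m\<^esub> cls (pos u) = cls (pos u) \<otimes>\<^bsub>artin_group S m\<^esub> a"
      "b (cls (pos u)) = sum_list (map (disc f s) u)" using Cons by auto
    have r: "a \<otimes>\<^bsub>artin_group S m\<^esub> cls [(r, True)] = cls [(r, True)] \<otimes>\<^bsub>artin_group S m\<^esub> a"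
      "disc f s r = b (cls [(r, True)])" using com[of r] Cons by auto
    have eq: "cls (pos (r # u)) = cls [(r, True)] \<otimes>\<^bsub>artin_group S m\<^esub> cls (pos u)"
      using mult[OF w] by simp
    have "b (cls (pos (r # u))) = b (cls [(r, True)]) + b (cls (pos u))"
      unfolding eq b_def by (rule A.cocycle_commutator[OF f c carr[OF w(1)] carr[OF w(2)] r(1) IH(1)])
    moreover have "a \<otimes>\<^bsub>artin_group S m\<^esub> cls (pos (r # u)) = cls (pos (r # u)) \<otimes>\<^bsub>artin_group S m\<^esub> a"
      unfolding eq using c carr[OF w(1)] carr[OF w(2)] r(1) IH(1) by (metis A.m_assoc)
    ultimately show ?case using r(2) IH(2) by simp
  qed
  have "alternating t t' k \<in> lists {t, t'}" "alternating t' t k \<in> lists {t, t'}"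
    using set_alternating[of t t' k] set_alternating[of t' t k] by auto
  then have "sum_list (map (disc f s) (alternating t t' k)) = sum_list (map (disc f s) (alternating t' t k))"
    using word cls_alternating_swap[OF st(2,3) False k(1)] by metis
  then show ?thesis
    using sum_list_alternating[of "disc f s" t t' k] k(2) by (simp add: bit_add_eq_0)
qed simp

text \<open>Choose a word \<open>rep A\<close> in every class. \<open>e u\<close> is the discrepancy
  between \<open>u\<close> and the word chosen for its class, and \<open>f\<close> is formally the
  coboundary of \<open>e\<close>, which makes it a cocycle; it need not be a coboundary because
  \<open>e\<close> depends on words, not on classes.\<close>

lemma exists_cocycle:
  assumes adm: "admissible \<phi>"
  obtains f e where "cocycle (artin_group S m) f"
    "\<And>s t k. \<lbrakk>s \<in> S; t \<in> S; s \<noteq> t; m s t = enat k\<rbrakk> \<Longrightarrow> disc f s t = \<phi> {s, t} + (if odd k then e s + e t else 0)"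
proof -
  define rep where "rep A = (SOME u. u \<in> A)" for A :: "'s word set"
  define g where "g u w = path_sum \<phi> (map fst u) w" for u :: "'s word" and w
  define r where "r u w = run (map fst u) w" for u :: "'s word" and w
  have rW: "r u w \<in> W" if "u \<in> words_over S" "w \<in> W" for u w
    unfolding r_def by (rule run_in_W[OF that(2) map_fst_words_over[OF that(1)]])
  have g_append: "g (u @ v) w = g u w + g v (r u w)" for u v w
    by (simp add: g_def r_def path_sum_append)
  have rep: "(u, rep (cls u)) \<in> pres_rel S (artin_relations S m)" if "u \<in> words_over S" for u
  proof -
    have "u \<in> cls u" using pres_rel.refl[OF that] by blast
    then have "rep (cls u) \<in> cls u" unfolding rep_def by (rule someI)
    then show ?thesis by blast
  qed
  have rep_words: "rep (cls u) \<in> words_over S" if "u \<in> words_over S" for u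
    using rep[OF that] pres_rel_words by blast
  define e where "e u = g u base + g (rep (cls u)) base" for u
  \<comment> \<open>The discrepancy is the same from every chamber, so it may be measured at
    \<open>base\<close>.\<close>
  have key: "r (rep (cls u)) w = r u w \<and> g (rep (cls u)) w = g u w + e u" if u: "u \<in> words_over S" and w: "w \<in> W" for u w
  proof -
    obtain c where c: "\<forall>w\<in>W. run (map fst u) w = run (map fst (rep (cls u))) w
        \<and> path_sum \<phi> (map fst u) w = path_sum \<phi> (map fst (rep (cls u))) w + c"
      using path_sum_pres_rel[OF adm rep[OF u]] by blast
    have "e u = c" using c base_in_W by (simp add: e_def g_def ac_simps)
    then show ?thesis using c w by (simp add: g_def r_def add.assoc)
  qed
  define f where "f A B = g (rep A @ rep B) base + g (rep (A \<otimes>\<^bsub>artin_group S m\<^esub> B)) base" for A B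
  have mult: "cls u \<otimes>\<^bsub>artin_group S m\<^esub> cls v = cls (u @ v)" if "u \<in> words_over S" "v \<in> words_over S" for u v
    unfolding artin_group_def by (rule presented_group_mult[OF that])
  have f: "f (cls u) (cls v) = e u + e v + e (u @ v)" if uv: "u \<in> words_over S" "v \<in> words_over S" for u v
  proof -
    have uvw: "u @ v \<in> words_over S" using uv by (simp only: append_in_lists_conv)
    show ?thesis
      unfolding f_def mult[OF uv] g_append
      using key[OF uv(1) base_in_W] key[OF uv(2) rW[OF uv(1) base_in_W]] key[OF uvw base_in_W]
      by (simp add: g_append ac_simps)
  qed
  have coc: "cocycle (artin_group S m) f"
    unfolding cocycle_def
  proof (intro ballI)
    fix A B C assume ABC: "A \<in> carrier (artin_group S m)" "B \<in> carrier (artin_group S m)" "C \<in> carrier (artin_group S m)"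
    obtain u v w where u: "u \<in> words_over S" "A = cls u" and v: "v \<in> words_over S" "B = cls v"
      and w: "w \<in> words_over S" "C = cls w"
      using ABC unfolding artin_group_def carrier_presented_group by blast
    have "u @ v \<in> words_over S" "v @ w \<in> words_over S" using u(1) v(1) w(1) by (simp_all only: append_in_lists_conv)
    then show "f A B + f (A \<otimes>\<^bsub>artin_group S m\<^esub> B) C = f B C + f A (B \<otimes>\<^bsub>artin_group S m\<^esub> C)"
      using u v w by (simp add: mult f ac_simps)
  qed
  have ls: "lift_sum S (artin_relations S m) f (\<lambda>_. 0) (pos u) = sum_list (map (\<lambda>x. e [(x, True)]) u) + e (pos u)"
    if "u \<in> lists S" for u
    using that
  proof (induction u)
    case Nil
    then show ?case using f[of "[]" "[]"] by simp
  next
    case (Cons x u)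
    have "[(x, True)] \<in> words_over S" "pos u \<in> words_over S" using Cons by (auto simp: pos_words_over)
    then show ?case using Cons f[of "[(x, True)]" "pos u"] by (simp add: ac_simps)
  qed
  have "disc f s t = \<phi> {s, t} + (if odd k then e [(s, True)] + e [(t, True)] else 0)"
    if st: "s \<in> S" "t \<in> S" "s \<noteq> t" "m s t = enat k" for s t k
  proof -
    have "g (pos (alternating s t k)) base + g (pos (alternating t s k)) base = \<phi> {s, t}"
      using path_sum_dihedral[OF adm base_in_W st] by (simp add: g_def comp_def)
    then have "e (pos (alternating s t k)) + e (pos (alternating t s k)) = \<phi> {s, t}"
      unfolding e_def cls_alternating_swap[OF st] by (simp add: ac_simps)
    then have "disc f s t = \<phi> {s, t} + (sum_list (map (\<lambda>x. e [(x, True)]) (alternating s t k))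
        + sum_list (map (\<lambda>x. e [(x, True)]) (alternating t s k)))"
      using st by (simp add: disc_def ls alternating_in_lists ac_simps)
    then show ?thesis unfolding sum_list_alternating .
  qed
  then show thesis using that[OF coc, of "\<lambda>x. e [(x, True)]"] by blast
qed

end

section \<open>Duality between second homology and two-cocycles\<close>

text \<open>A group of exponent 2 is a vector space over \<open>bit\<close>, and a subset containing
  0 and closed under addition is a subspace; this is the extension of linear functionals.\<close>

lemma extend_additive_bit:
  fixes U :: "'v::ab_group_add set" and g :: "'v \<Rightarrow> bit"
  assumes two: "\<And>v::'v. v + v = 0" and U: "0 \<in> U" "\<And>x y. x \<in> U \<Longrightarrow> y \<in> U \<Longrightarrow> x + y \<in> U"
    and g: "\<And>x y. x \<in> U \<Longrightarrow> y \<in> U \<Longrightarrow> g (x + y) = g x + g y"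
  obtains \<psi> :: "'v \<Rightarrow> bit" where "\<And>x y. \<psi> (x + y) = \<psi> x + \<psi> y" "\<And>x. x \<in> U \<Longrightarrow> \<psi> x = g x"
proof -
  let ?s = "\<lambda>(a::bit) (x::'v). if a = 0 then 0 else x"
  interpret v: vector_space ?s
    by standard (use two in \<open>auto simp: add_bit_eq_xor mult_bit_eq_and split: if_splits\<close>)
  interpret b: vector_space "(*) :: bit \<Rightarrow> bit \<Rightarrow> bit"
    by standard (auto simp: algebra_simps)
  interpret p: vector_space_pair ?s "(*) :: bit \<Rightarrow> bit \<Rightarrow> bit" ..
  obtain B where B: "B \<subseteq> U" "v.independent B" "U \<subseteq> v.span B"
    using v.maximal_independent_subset by blast
  obtain \<psi> where \<psi>: "Vector_Spaces.linear ?s (*) \<psi>" "\<forall>x\<in>B. \<psi> x = g x"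
    using p.linear_independent_extend[OF B(2)] by blast
  interpret l: Vector_Spaces.linear ?s "(*)" \<psi> by (rule \<psi>(1))
  have g0: "g 0 = 0" using g[OF U(1) U(1)] by simp
  have "v.subspace {x \<in> U. \<psi> x = g x}"
    unfolding v.subspace_def using U g g0 l.add l.zero by auto
  then have "v.span B \<subseteq> {x \<in> U. \<psi> x = g x}"
    using B(1) \<psi>(2) by (intro v.span_minimal) auto
  then show thesis using that[of \<psi>] B(3) l.add by blast
qed

lemma additive_bit_sum:
  fixes \<psi> :: "'v::ab_group_add \<Rightarrow> bit"
  assumes "\<And>x y. \<psi> (x + y) = \<psi> x + \<psi> y"
  shows "\<psi> (sum F A) = (\<Sum>a\<in>A. \<psi> (F a))"
proof -
  have "\<psi> 0 = 0" using assms[of 0 0] by simp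
  then show ?thesis by (induction A rule: infinite_finite_induct) (auto simp: assms)
qed

text \<open>If \<open>\<psi> j\<close> vanished on the common kernel of the others in
  \<open>Z\<close>, it would be a combination of them there, with its values at dual vectors
  \<open>d i\<close> as coefficients. So some \<open>k\<close> in this kernel has
  \<open>\<psi> j k = 1\<close>, and adding \<open>k\<close> adjusts the last value alone.\<close>

lemma independent_functionals_surj:
  fixes \<psi> :: "'i \<Rightarrow> 'v::ab_group_add \<Rightarrow> bit"
  assumes two: "\<And>v::'v. v + v = 0" and Z: "0 \<in> Z" "\<And>x y. x \<in> Z \<Longrightarrow> y \<in> Z \<Longrightarrow> x + y \<in> Z"
    and add: "\<And>i x y. \<psi> i (x + y) = \<psi> i x + \<psi> i y"
    and "finite I"
    and "\<And>c. (\<forall>z\<in>Z. (\<Sum>i\<in>I. c i * \<psi> i z) = 0) \<Longrightarrow> \<forall>i\<in>I. c i = 0"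
  shows "\<exists>z\<in>Z. \<forall>i\<in>I. \<psi> i z = t i"
  using assms(5,6)
proof (induction I arbitrary: t rule: finite_induct)
  case empty
  then show ?case using Z by blast
next
  case (insert j I)
  have Zsum: "sum F A \<in> Z" if "\<And>a. a \<in> A \<Longrightarrow> F a \<in> Z" for F :: "'i \<Rightarrow> 'v" and A
    using that by (induction A rule: infinite_finite_induct) (auto simp: Z)
  have z0: "\<psi> i 0 = 0" for i using add[of i 0 0] by simp
  have ind: "\<forall>i\<in>I. c i = 0" if "\<forall>z\<in>Z. (\<Sum>i\<in>I. c i * \<psi> i z) = 0" for c
  proof -
    have eq: "(\<Sum>i\<in>I. (c(j := 0)) i * \<psi> i z) = (\<Sum>i\<in>I. c i * \<psi> i z)" for z
      by (rule sum.cong) (use insert(2) in auto)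
    have "\<forall>z\<in>Z. (\<Sum>i\<in>insert j I. (c(j := 0)) i * \<psi> i z) = 0"
      using that insert(1,2) eq by simp
    then have "\<forall>i\<in>insert j I. (c(j := 0)) i = 0" by (rule insert(4))
    moreover have "i \<noteq> j" if "i \<in> I" for i using insert(2) that by blast
    ultimately show ?thesis by (simp add: fun_upd_def)
  qed
  note IH = insert(3)[OF ind]
  have "\<exists>k\<in>Z. (\<forall>i\<in>I. \<psi> i k = 0) \<and> \<psi> j k = 1"
  proof (rule ccontr)
    assume *: "\<not> ?thesis"
    have "\<forall>i. \<exists>z. z \<in> Z \<and> (\<forall>l\<in>I. \<psi> l z = of_bool (l = i))"
      using IH[of "\<lambda>l. of_bool (l = i)" for i] by blast
    then obtain d where d: "\<And>i. d i \<in> Z" "\<And>i l. l \<in> I \<Longrightarrow> \<psi> l (d i) = of_bool (l = i)" by metis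
    define c where "c i = (if i = j then 1 else \<psi> j (d i))" for i
    have "(\<Sum>i\<in>insert j I. c i * \<psi> i z) = 0" if z: "z \<in> Z" for z
    proof -
      \<comment> \<open>The projection of \<open>z\<close> to the common kernel of the
        \<open>\<psi> i\<close> with \<open>i\<close> in \<open>I\<close>.\<close>
      define k where "k = z + (\<Sum>i\<in>I. if \<psi> i z = 0 then 0 else d i)"
      have k: "k \<in> Z" unfolding k_def using z Z d(1) Zsum by auto
      have \<psi>k: "\<psi> l k = \<psi> l z + (\<Sum>i\<in>I. \<psi> i z * \<psi> l (d i))" for l
        unfolding k_def add additive_bit_sum[of "\<psi> l", OF add]
        by (intro arg_cong2[where f = "(+)"] sum.cong) (auto simp: z0)
      have "\<psi> l k = 0" if l: "l \<in> I" for l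
      proof -
        have "(\<Sum>i\<in>I. \<psi> i z * \<psi> l (d i)) = (\<Sum>i\<in>I. if i = l then \<psi> l z else 0)"
          by (rule sum.cong) (use d(2)[OF l] in auto)
        then show ?thesis using \<psi>k[of l] l insert(1) by simp
      qed
      then have "\<psi> j k = 0" using * k by (metis bit_not_zero_iff)
      then have "\<psi> j z = (\<Sum>i\<in>I. \<psi> i z * \<psi> j (d i))" using \<psi>k[of j] by (simp add: bit_add_eq_0)
      also have "\<dots> = (\<Sum>i\<in>I. c i * \<psi> i z)"
        by (rule sum.cong) (use insert(2) in \<open>auto simp: c_def mult.commute\<close>)
      finally show ?thesis using insert(1,2) by (simp add: c_def)
    qed
    then have "c j = 0" using insert(4) by blast
    then show False by (simp add: c_def)
  qed
  then obtain k where k: "k \<in> Z" "\<forall>i\<in>I. \<psi> i k = 0" "\<psi> j k = 1" by blast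
  obtain z where z: "z \<in> Z" "\<forall>i\<in>I. \<psi> i z = t i" using IH by blast
  show ?case
  proof (cases "\<psi> j z = t j")
    case True
    then show ?thesis using z by blast
  next
    case False
    then have "\<psi> j (z + k) = t j" using k(3) by (cases "t j"; cases "\<psi> j z") (auto simp: add)
    moreover have "\<forall>i\<in>I. \<psi> i (z + k) = t i" using z k by (simp add: add)
    ultimately show ?thesis using Z(2)[OF z(1) k(1)] by blast
  qed
qed

section \<open>Linear maps on chains over Z_2\<close>

lemma poly_mapping_bit_add_self [simp]: "(c :: 'k \<Rightarrow>\<^sub>0 bit) + c = 0"
  by (rule poly_mapping_eqI) (simp add: lookup_add)

text \<open>Over \<open>bit\<close> a chain is determined by its support, so the linear extension of
  \<open>F\<close> is a sum over the keys.\<close>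

definition lin :: "('k \<Rightarrow> 'v::ab_group_add) \<Rightarrow> ('k \<Rightarrow>\<^sub>0 bit) \<Rightarrow> 'v" where
  "lin F c = (\<Sum>k\<in>Poly_Mapping.keys c. F k)"

lemma lin_zero [simp]: "lin F 0 = 0"
  by (simp add: lin_def)

lemma lin_single [simp]: "lin F (Poly_Mapping.single k 1) = F k"
  by (simp add: lin_def)

lemma lin_add:
  fixes F :: "'k \<Rightarrow> 'v::ab_group_add"
  assumes two: "\<And>v::'v. v + v = 0"
  shows "lin F (c + d) = lin F c + lin F d"
proof -
  let ?K = "Poly_Mapping.keys c \<union> Poly_Mapping.keys d"
  have ext: "lin F e = (\<Sum>k\<in>?K. if Poly_Mapping.lookup e k = 0 then 0 else F k)" if "Poly_Mapping.keys e \<subseteq> ?K" for e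
    unfolding lin_def using that
    by (intro sum.mono_neutral_cong_left) (auto simp: in_keys_iff)
  have "lin F (c + d) = (\<Sum>k\<in>?K. if Poly_Mapping.lookup (c + d) k = 0 then 0 else F k)"
    by (rule ext[OF keys_add])
  also have "\<dots> = (\<Sum>k\<in>?K. (if Poly_Mapping.lookup c k = 0 then 0 else F k) + (if Poly_Mapping.lookup d k = 0 then 0 else F k))"
    by (rule sum.cong) (use two in \<open>auto simp: lookup_add\<close>)
  also have "\<dots> = lin F c + lin F d" using ext[of c] ext[of d] by (simp add: sum.distrib)
  finally show ?thesis .
qed

lemma lin_sum:
  fixes F :: "'k \<Rightarrow> 'v::ab_group_add"
  assumes two: "\<And>v::'v. v + v = 0"
  shows "lin F (\<Sum>a\<in>A. c a) = (\<Sum>a\<in>A. lin F (c a))"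
  by (induction A rule: infinite_finite_induct) (auto simp: lin_add[OF two])

lemma lin_lin:
  fixes F :: "'k \<Rightarrow> 'v::ab_group_add"
  assumes two: "\<And>v::'v. v + v = 0"
  shows "lin F (lin E c) = lin (\<lambda>k. lin F (E k)) c"
  unfolding lin_def[of E] lin_sum[OF two] by (simp add: lin_def)

lemma lin_single_id: "lin (\<lambda>k. Poly_Mapping.single k 1) c = (c :: 'k \<Rightarrow>\<^sub>0 bit)"
proof (rule poly_mapping_eqI)
  fix l
  have "Poly_Mapping.lookup (lin (\<lambda>k. Poly_Mapping.single k 1) c) l
      = (\<Sum>k\<in>Poly_Mapping.keys c. if k = l then 1 else (0::bit))"
    unfolding lin_def lookup_sum by (rule sum.cong) (auto simp: lookup_single)
  also have "\<dots> = Poly_Mapping.lookup c l"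
    by (auto simp: in_keys_iff)
  finally show "Poly_Mapping.lookup (lin (\<lambda>k. Poly_Mapping.single k 1) c) l = Poly_Mapping.lookup c l" .
qed

lemma additive_eq_lin:
  fixes \<psi> :: "('k \<Rightarrow>\<^sub>0 bit) \<Rightarrow> bit"
  assumes "\<And>x y. \<psi> (x + y) = \<psi> x + \<psi> y"
  shows "\<psi> c = lin (\<lambda>k. \<psi> (Poly_Mapping.single k 1)) c"
proof -
  have "\<psi> c = \<psi> (lin (\<lambda>k. Poly_Mapping.single k 1) c)" by (simp add: lin_single_id)
  then show ?thesis unfolding lin_def additive_bit_sum[OF assms] .
qed

section \<open>The bar complex over Z_2 in low degrees\<close>

lemma bar_boundary_eq_lin:
  assumes "n \<noteq> 0"
  shows "bar_boundary G n c = lin (\<lambda>gs. \<Sum>i\<le>n. Poly_Mapping.single (bar_face G i gs) (1::bit)) c"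
  unfolding bar_boundary_def lin_def
  using assms by (auto simp: in_keys_iff intro!: sum.cong)

lemma bar_boundary_add:
  "bar_boundary G n (c + d) = bar_boundary G n c + bar_boundary G n (d :: 'g list \<Rightarrow>\<^sub>0 bit)"
  by (cases "n = 0") (simp_all add: bar_boundary_eq_lin lin_add bar_boundary_def[of G 0])

lemma bar_boundary_zero [simp]: "bar_boundary G n 0 = 0"
  by (simp add: bar_boundary_def)

lemma bar_boundary_2:
  "bar_boundary G 2 (Poly_Mapping.single [g, h] (1::bit))
    = Poly_Mapping.single [h] 1 + Poly_Mapping.single [g \<otimes>\<^bsub>G\<^esub> h] 1 + Poly_Mapping.single [g] 1"
  by (simp add: bar_boundary_eq_lin bar_face_def numeral_2_eq_2)

lemma bar_boundary_3:
  "bar_boundary G 3 (Poly_Mapping.single [g, h, k] (1::bit))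
    = Poly_Mapping.single [h, k] 1 + Poly_Mapping.single [g \<otimes>\<^bsub>G\<^esub> h, k] 1
      + Poly_Mapping.single [g, h \<otimes>\<^bsub>G\<^esub> k] 1 + Poly_Mapping.single [g, h] 1"
  by (simp add: bar_boundary_eq_lin bar_face_def numeral_3_eq_3)

lemma zero_in_bar_chains [simp]: "0 \<in> bar_chains G n"
  by (simp add: bar_chains_def)

lemma bar_chains_add: "c \<in> bar_chains G n \<Longrightarrow> d \<in> bar_chains G n \<Longrightarrow> c + d \<in> bar_chains G n"
  unfolding bar_chains_def using keys_add[of c d] by blast

lemma length_2E:
  assumes "length xs = 2" obtains a b where "xs = [a, b]"
  using assms by (metis (no_types, opaque_lifting) One_nat_def Suc_1 length_0_conv length_Suc_conv)

lemma length_3E: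
  assumes "length xs = 3" obtains a b c where "xs = [a, b, c]"
  using assms by (auto simp: numeral_3_eq_3 length_Suc_conv)

definition pairing :: "('g \<Rightarrow> 'g \<Rightarrow> bit) \<Rightarrow> ('g list \<Rightarrow>\<^sub>0 bit) \<Rightarrow> bit" where
  "pairing f = lin (\<lambda>gs. f (gs ! 0) (gs ! 1))"

lemma pairing_add: "pairing f (x + y) = pairing f x + pairing f y"
  unfolding pairing_def by (rule lin_add) simp

lemma pairing_linear: "pairing (\<lambda>g h. \<Sum>i\<in>I. c i * f i g h) z = (\<Sum>i\<in>I. c i * pairing (f i) z)"
  unfolding pairing_def lin_def sum_distrib_left by (rule sum.swap)

lemma pairing_add_left: "pairing (\<lambda>g h. f g h + f' g h) z = pairing f z + pairing f' z"
  unfolding pairing_def lin_def by (rule sum.distrib)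

lemma pairing_boundary:
  assumes f: "cocycle G f" and c: "c \<in> bar_chains G 3"
  shows "pairing f (bar_boundary G 3 c) = 0"
proof -
  have *: "(\<Sum>i\<le>3. Poly_Mapping.single (bar_face G i gs) (1::bit)) = bar_boundary G 3 (Poly_Mapping.single gs 1)" for gs
    by (simp add: bar_boundary_eq_lin)
  have "pairing f (bar_boundary G 3 c) = (\<Sum>gs\<in>Poly_Mapping.keys c. pairing f (bar_boundary G 3 (Poly_Mapping.single gs 1)))"
    unfolding bar_boundary_eq_lin[of 3 G c, simplified] pairing_def * by (subst lin_lin) (simp_all add: lin_def)
  also have "\<dots> = 0"
  proof (rule sum.neutral, rule ballI)
    fix gs assume "gs \<in> Poly_Mapping.keys c"
    then have gs: "length gs = 3" "set gs \<subseteq> carrier G" using c by (auto simp: bar_chains_def)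
    obtain g h k where "gs = [g, h, k]" using length_3E[OF gs(1)] .
    moreover have "f g (h \<otimes>\<^bsub>G\<^esub> k) = f g h + f (g \<otimes>\<^bsub>G\<^esub> h) k + f h k" 
      using cocycleD[OF f] gs calculation by simp
    ultimately show "pairing f (bar_boundary G 3 (Poly_Mapping.single gs 1)) = 0"
      by (simp add: bar_boundary_3 pairing_add) (simp add: pairing_def ac_simps)
  qed
  finally show ?thesis .
qed

lemma pairing_coboundary:
  assumes f: "coboundary G f" and z: "z \<in> bar_chains G 2" "bar_boundary G 2 z = 0"
  shows "pairing f z = 0"
proof -
  obtain H where H: "\<And>g h. g \<in> carrier G \<Longrightarrow> h \<in> carrier G \<Longrightarrow> f g h = H g + H h + H (g \<otimes>\<^bsub>G\<^esub> h)"
    using f unfolding coboundary_def by blast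
  let ?H = "lin (\<lambda>gs. H (gs ! 0)) :: _ \<Rightarrow> bit"
  have *: "(\<Sum>i\<le>2. Poly_Mapping.single (bar_face G i gs) (1::bit)) = bar_boundary G 2 (Poly_Mapping.single gs 1)" for gs
    by (simp add: bar_boundary_eq_lin)
  have "?H (bar_boundary G 2 z) = (\<Sum>gs\<in>Poly_Mapping.keys z. ?H (bar_boundary G 2 (Poly_Mapping.single gs 1)))"
    unfolding bar_boundary_eq_lin[of 2 G z, simplified] * by (subst lin_lin) (simp_all add: lin_def)
  also have "\<dots> = pairing f z"
    unfolding pairing_def lin_def[of _ z]
  proof (rule sum.cong[OF HOL.refl])
    fix gs assume "gs \<in> Poly_Mapping.keys z"
    then have gs: "length gs = 2" "set gs \<subseteq> carrier G" using z by (auto simp: bar_chains_def)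
    obtain g h where "gs = [g, h]" using length_2E[OF gs(1)] .
    then show "?H (bar_boundary G 2 (Poly_Mapping.single gs 1)) = f (gs ! 0) (gs ! 1)"
      using gs by (simp add: bar_boundary_2 lin_add H ac_simps)
  qed
  finally show ?thesis using z(2) by simp
qed

lemma bar_boundary_boundary:
  fixes c :: "'g list \<Rightarrow>\<^sub>0 bit"
  assumes G: "group G" and c: "c \<in> bar_chains G 3"
  shows "bar_boundary G 3 c \<in> bar_chains G 2 \<and> bar_boundary G 2 (bar_boundary G 3 c) = 0"
proof -
  interpret group G by (rule G)
  have two: "v + v = 0" "v + (v + w) = w" for v w :: "'g list \<Rightarrow>\<^sub>0 bit" by (simp_all add: add.assoc[symmetric])
  have one: "bar_boundary G 3 (Poly_Mapping.single gs (1::bit)) \<in> bar_chains G 2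
      \<and> bar_boundary G 2 (bar_boundary G 3 (Poly_Mapping.single gs (1::bit))) = 0" if gs: "gs \<in> Poly_Mapping.keys c" for gs
  proof -
    have gs: "length gs = 3" "set gs \<subseteq> carrier G" using c gs by (auto simp: bar_chains_def)
    obtain g h k where ghk: "gs = [g, h, k]" using length_3E[OF gs(1)] .
    have s: "Poly_Mapping.single [x, y] (1::bit) \<in> bar_chains G 2" if "x \<in> carrier G" "y \<in> carrier G" for x y
      using that by (simp add: bar_chains_def)
    show ?thesis
      using gs(2) unfolding ghk bar_boundary_3
      by (simp add: s bar_chains_add bar_boundary_add bar_boundary_2 m_assoc) (simp add: ac_simps two)
  qed
  have "bar_boundary G 3 c = (\<Sum>gs\<in>Poly_Mapping.keys c. bar_boundary G 3 (Poly_Mapping.single gs 1))"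
    by (simp add: bar_boundary_eq_lin) (simp add: lin_def)
  moreover have "(\<Sum>gs\<in>A. bar_boundary G 3 (Poly_Mapping.single gs (1::bit))) \<in> bar_chains G 2
      \<and> bar_boundary G 2 (\<Sum>gs\<in>A. bar_boundary G 3 (Poly_Mapping.single gs (1::bit))) = 0"
    if "A \<subseteq> Poly_Mapping.keys c" for A
    using that by (induction A rule: infinite_finite_induct) (auto simp: one bar_boundary_add intro!: bar_chains_add one[THEN conjunct1])
  ultimately show ?thesis by auto
qed

lemma group_bar_cycle_group: "group (bar_cycle_group G n :: ('g list \<Rightarrow>\<^sub>0 bit) monoid)"
proof (rule groupI)
  fix x assume "x \<in> carrier (bar_cycle_group G n :: ('g list \<Rightarrow>\<^sub>0 bit) monoid)"
  then show "\<exists>y\<in>carrier (bar_cycle_group G n). y \<otimes>\<^bsub>bar_cycle_group G n\<^esub> x = \<one>\<^bsub>bar_cycle_group G n\<^esub>"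
    by (intro bexI[of _ x]) (auto simp: bar_cycle_group_def)
qed (auto simp: bar_cycle_group_def bar_boundary_add bar_chains_add add.assoc)

text \<open>A chain \<open>z\<close> that is no boundary is separated from the boundaries by a
  functional on all chains. Its values on single tuples form a cocycle, up to a coboundary a
  combination of the \<open>f i\<close>, so its value at the cycle \<open>z\<close> would be
  \<open>0\<close>.\<close>

lemma boundary_if_pairings_vanish:
  fixes G :: "('g, 'b) monoid_scheme"
  assumes f: "\<And>i. i \<in> I \<Longrightarrow> cocycle G (f i)"
    and span: "\<And>f'. cocycle G f' \<Longrightarrow> \<exists>c. coboundary G (\<lambda>g h. f' g h + (\<Sum>i\<in>I. c i * f i g h))"
    and z: "z \<in> bar_chains G 2" "bar_boundary G 2 z = 0" "\<And>i. i \<in> I \<Longrightarrow> pairing (f i) z = 0"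
  shows "z \<in> bar_boundary G 3 ` bar_chains G 3"
proof (rule ccontr)
  let ?B = "bar_boundary G 3 ` bar_chains G 3 :: ('g list \<Rightarrow>\<^sub>0 bit) set"
  assume zB: "z \<notin> ?B"
  have B: "0 \<in> ?B" "\<And>x y. x \<in> ?B \<Longrightarrow> y \<in> ?B \<Longrightarrow> x + y \<in> ?B"
    by (auto simp: bar_boundary_add[symmetric] bar_chains_add intro!: image_eqI[of 0 _ 0])
  have Biff: "x + y \<in> ?B \<longleftrightarrow> y \<in> ?B" if "x \<in> ?B" for x y
    using B(2)[OF that, of y] B(2)[OF that, of "x + y"] by (auto simp: add.assoc[symmetric])
  \<comment> \<open>\<open>?B\<close> and its translate by \<open>z\<close> form the subgroup
    generated by both; on it, \<open>g\<close> is the functional with kernel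
    \<open>?B\<close>.\<close>
  define U where "U = {x. x \<in> ?B \<or> z + x \<in> ?B}"
  define g :: "('g list \<Rightarrow>\<^sub>0 bit) \<Rightarrow> bit" where "g x = of_bool (x \<notin> ?B)" for x
  have two: "v + v = 0" for v :: "'g list \<Rightarrow>\<^sub>0 bit" by simp
  have zz: "z + (z + x) = x" for x by (simp add: add.assoc[symmetric])
  have Uadd: "x + y \<in> U \<and> g (x + y) = g x + g y" if xy: "x \<in> U" "y \<in> U" for x y
  proof -
    consider "x \<in> ?B" | "y \<in> ?B" | "x \<notin> ?B" "y \<notin> ?B" "z + x \<in> ?B" "z + y \<in> ?B"
      using xy by (auto simp: U_def)
    then show ?thesis
    proof cases
      case 1
      then have "z + (x + y) \<in> ?B \<longleftrightarrow> z + y \<in> ?B" using Biff[OF 1, of "z + y"] by (simp add: ac_simps)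
      then show ?thesis using Biff[OF 1, of y] 1 xy by (auto simp: U_def g_def)
    next
      case 2
      then have "z + (x + y) \<in> ?B \<longleftrightarrow> z + x \<in> ?B" using Biff[OF 2, of "z + x"] by (simp add: ac_simps)
      then show ?thesis using Biff[OF 2, of x] 2 xy by (auto simp: U_def g_def add.commute)
    next
      case 3
      have "(z + x) + (z + y) = (z + z) + (x + y)" by (simp only: ac_simps)
      then have "(z + x) + (z + y) = x + y" by simp
      with B(2)[OF 3(3,4)] have "x + y \<in> ?B" by (simp only:)
      then show ?thesis using 3 by (auto simp: U_def g_def)
    qed
  qed
  obtain \<psi> :: "('g list \<Rightarrow>\<^sub>0 bit) \<Rightarrow> bit" where \<psi>: "\<And>x y. \<psi> (x + y) = \<psi> x + \<psi> y" "\<And>x. x \<in> U \<Longrightarrow> \<psi> x = g x"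
    using extend_additive_bit[of U g, OF two] Uadd B(1) unfolding U_def by blast
  have \<psi>B: "\<psi> x = 0" if "x \<in> ?B" for x using \<psi>(2)[of x] that by (simp add: U_def g_def)
  have \<psi>z: "\<psi> z = 1" using \<psi>(2)[of z] zB B(1) by (simp add: U_def g_def)
  define f' where "f' g h = \<psi> (Poly_Mapping.single [g, h] 1)" for g h
  have "cocycle G f'"
    unfolding cocycle_def
  proof (intro ballI)
    fix g h k assume ghk: "g \<in> carrier G" "h \<in> carrier G" "k \<in> carrier G"
    then have "Poly_Mapping.single [g, h, k] (1::bit) \<in> bar_chains G 3" by (simp add: bar_chains_def)
    then have "\<psi> (bar_boundary G 3 (Poly_Mapping.single [g, h, k] 1)) = 0" using \<psi>B by blast
    then have "(f' g h + f' (g \<otimes>\<^bsub>G\<^esub> h) k) + (f' h k + f' g (h \<otimes>\<^bsub>G\<^esub> k)) = 0"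
      unfolding bar_boundary_3 \<psi>(1) f'_def by (simp add: ac_simps)
    then show "f' g h + f' (g \<otimes>\<^bsub>G\<^esub> h) k = f' h k + f' g (h \<otimes>\<^bsub>G\<^esub> k)" by (simp only: bit_add_eq_0)
  qed
  then obtain c where "coboundary G (\<lambda>g h. f' g h + (\<Sum>i\<in>I. c i * f i g h))" using span by blast
  from pairing_coboundary[OF this z(1,2)] have "pairing f' z = 0"
    using z(3) unfolding pairing_add_left pairing_linear by simp
  moreover have "pairing f' z = \<psi> z"
    unfolding additive_eq_lin[OF \<psi>(1), of z] pairing_def lin_def
  proof (rule sum.cong[OF HOL.refl])
    fix gs assume "gs \<in> Poly_Mapping.keys z"
    then have "length gs = 2" using z by (auto simp: bar_chains_def)
    then obtain g h where "gs = [g, h]" by (rule length_2E)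
    then show "f' (gs ! 0) (gs ! 1) = \<psi> (Poly_Mapping.single gs 1)" by (simp add: f'_def)
  qed
  ultimately show False using \<psi>z by simp
qed

text \<open>As \<open>F\<close> vanishes on cycles, its pairing factors through the boundary map.
  The induced functional on boundaries extends to all chains, and its values on the tuples
  \<open>[g]\<close> form a cochain with coboundary \<open>F\<close>.\<close>

lemma pairing_nondegenerate:
  fixes G :: "('g, 'b) monoid_scheme"
  assumes F: "\<And>z. z \<in> bar_chains G 2 \<Longrightarrow> bar_boundary G 2 z = 0 \<Longrightarrow> pairing F z = 0"
  shows "coboundary G F"
proof -
  let ?U = "bar_boundary G 2 ` bar_chains G 2 :: ('g list \<Rightarrow>\<^sub>0 bit) set"
  define p where "p x = (SOME c. c \<in> bar_chains G 2 \<and> bar_boundary G 2 c = x)" for x :: "'g list \<Rightarrow>\<^sub>0 bit"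
  have p: "p x \<in> bar_chains G 2 \<and> bar_boundary G 2 (p x) = x" if "x \<in> ?U" for x
    unfolding p_def by (rule someI_ex) (use that in auto)
  have wd: "pairing F (p (bar_boundary G 2 c)) = pairing F c" if c: "c \<in> bar_chains G 2" for c
  proof -
    have pc: "p (bar_boundary G 2 c) \<in> bar_chains G 2" "bar_boundary G 2 (p (bar_boundary G 2 c)) = bar_boundary G 2 c"
      using p[of "bar_boundary G 2 c"] c by auto
    have "pairing F (p (bar_boundary G 2 c) + c) = 0"
      by (rule F) (use pc c in \<open>auto simp: bar_chains_add bar_boundary_add\<close>)
    then show ?thesis by (simp add: pairing_add bit_add_eq_0)
  qed
  have two: "v + v = 0" for v :: "'g list \<Rightarrow>\<^sub>0 bit" by simp
  have U: "0 \<in> ?U" "\<And>x y. x \<in> ?U \<Longrightarrow> y \<in> ?U \<Longrightarrow> x + y \<in> ?U"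
    by (auto simp: bar_boundary_add[symmetric] bar_chains_add intro!: image_eqI[of 0 _ 0])
  have add: "pairing F (p (x + y)) = pairing F (p x) + pairing F (p y)" if xy: "x \<in> ?U" "y \<in> ?U" for x y
  proof -
    obtain c d where cd: "c \<in> bar_chains G 2" "x = bar_boundary G 2 c" "d \<in> bar_chains G 2" "y = bar_boundary G 2 d"
      using xy by blast
    show ?thesis
      using wd[OF cd(1)] wd[OF cd(3)] wd[OF bar_chains_add[OF cd(1,3)]] cd(2,4)
      by (simp add: bar_boundary_add pairing_add)
  qed
  obtain \<eta> where \<eta>: "\<And>x y. \<eta> (x + y) = \<eta> x + \<eta> y" "\<And>x. x \<in> ?U \<Longrightarrow> \<eta> x = pairing F (p x)"
    using extend_additive_bit[of ?U "\<lambda>x. pairing F (p x)", OF two U add] by blast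
  have "F g h = \<eta> (Poly_Mapping.single [g] 1) + \<eta> (Poly_Mapping.single [h] 1) + \<eta> (Poly_Mapping.single [g \<otimes>\<^bsub>G\<^esub> h] 1)"
    if "g \<in> carrier G" "h \<in> carrier G" for g h
  proof -
    have c: "Poly_Mapping.single [g, h] (1::bit) \<in> bar_chains G 2" using that by (simp add: bar_chains_def)
    have "F g h = pairing F (Poly_Mapping.single [g, h] 1)" by (simp add: pairing_def)
    also have "\<dots> = \<eta> (bar_boundary G 2 (Poly_Mapping.single [g, h] 1))"
      using \<eta>(2) wd[OF c] c by simp
    finally show ?thesis unfolding bar_boundary_2 \<eta>(1) by (simp add: ac_simps)
  qed
  then show ?thesis unfolding coboundary_def by (intro exI[of _ "\<lambda>g. \<eta> (Poly_Mapping.single [g] 1)"]) auto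
qed

text \<open>The \<open>f i\<close> represent a basis of second cohomology, and cycles are evaluated
  on it: \<open>span\<close> yields injectivity modulo boundaries, \<open>ind\<close>
  surjectivity.\<close>

theorem second_homology_iso:
  fixes G :: "('g, 'b) monoid_scheme"
  assumes G: "group G" and I: "finite I" and f: "\<And>i. i \<in> I \<Longrightarrow> cocycle G (f i)"
    and span: "\<And>f'. cocycle G f' \<Longrightarrow> \<exists>c. coboundary G (\<lambda>g h. f' g h + (\<Sum>i\<in>I. c i * f i g h))"
    and ind: "\<And>c. coboundary G (\<lambda>g h. \<Sum>i\<in>I. c i * f i g h) \<Longrightarrow> \<forall>i\<in>I. c i = 0"
  shows "group_homology TYPE(bit) 2 G \<cong> product_group {..<card I} (\<lambda>_. integer_mod_group 2)"
proof -
  let ?Z = "bar_cycle_group G 2 :: ('g list \<Rightarrow>\<^sub>0 bit) monoid"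
  let ?P = "product_group {..<card I} (\<lambda>_. integer_mod_group 2)"
  obtain b where b: "bij_betw b {..<card I} I"
    using ex_bij_betw_nat_finite[OF I] by (auto simp: atLeast0LessThan)
  define \<Theta> where "\<Theta> z = (\<lambda>j\<in>{..<card I}. if pairing (f (b j)) z = 0 then 0 else (1::int))" for z
  have Z: "carrier ?Z = {c \<in> bar_chains G 2. bar_boundary G 2 c = 0}" "\<one>\<^bsub>?Z\<^esub> = 0" "\<And>x y. x \<otimes>\<^bsub>?Z\<^esub> y = x + y"
    by (simp_all add: bar_cycle_group_def)
  have hom: "\<Theta> \<in> hom ?Z ?P"
    by (rule homI) (auto simp: \<Theta>_def Z pairing_add carrier_integer_mod_group fun_eq_iff restrict_def
        PiE_iff extensional_def split: if_splits)
  interpret group_hom ?Z ?P \<Theta>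
    by (simp add: group_hom_def group_hom_axioms_def group_bar_cycle_group hom)
  have surj: "\<Theta> ` carrier ?Z = carrier ?P"
  proof
    show "\<Theta> ` carrier ?Z \<subseteq> carrier ?P" using hom by (auto simp: hom_def)
    show "carrier ?P \<subseteq> \<Theta> ` carrier ?Z"
    proof
      fix y assume y: "y \<in> carrier ?P"
      define t where "t i = (if y (inv_into {..<card I} b i) = 0 then 0 else (1::bit))" for i
      have "\<exists>z\<in>carrier ?Z. \<forall>i\<in>I. pairing (f i) z = t i"
      proof (rule independent_functionals_surj[OF _ _ _ _ I])
        fix c assume "\<forall>z\<in>carrier ?Z. (\<Sum>i\<in>I. c i * pairing (f i) z) = 0"
        then have "coboundary G (\<lambda>g h. \<Sum>i\<in>I. c i * f i g h)"
          by (intro pairing_nondegenerate) (simp add: pairing_linear Z)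
        then show "\<forall>i\<in>I. c i = 0" by (rule ind)
      qed (auto simp: Z bar_chains_add bar_boundary_add pairing_add)
      then obtain z where z: "z \<in> carrier ?Z" "\<And>i. i \<in> I \<Longrightarrow> pairing (f i) z = t i" by blast
      have "y = \<Theta> z"
      proof
        fix j
        show "y j = \<Theta> z j"
        proof (cases "j < card I")
          case True
          then have "b j \<in> I" using b bij_betwE by blast
          moreover have "inv_into {..<card I} b (b j) = j" using b True by (simp add: bij_betw_def)
          moreover have "y j \<in> {0..<2}" using y True by (auto simp: carrier_integer_mod_group PiE_iff)
          ultimately show ?thesis using z(2)[of "b j"] True by (auto simp: \<Theta>_def t_def)
        next
          case False
          then show ?thesis using y by (auto simp: \<Theta>_def PiE_iff extensional_def)
        qed
      qed
      then show "y \<in> \<Theta> ` carrier ?Z" using z(1) by blast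
    qed
  qed
  have three: "Suc 2 = 3" by simp
  have ker: "kernel ?Z ?P \<Theta> = bar_boundary G 3 ` bar_chains G 3"
  proof
    show "kernel ?Z ?P \<Theta> \<subseteq> bar_boundary G 3 ` bar_chains G 3"
    proof
      fix z assume z: "z \<in> kernel ?Z ?P \<Theta>"
      have "pairing (f i) z = 0" if i: "i \<in> I" for i
      proof -
        have "i \<in> b ` {..<card I}" using b i by (simp add: bij_betw_def)
        then obtain j where j: "j < card I" "b j = i" by blast
        have "\<Theta> z j = 0" using z j by (simp add: kernel_def)
        then show ?thesis by (simp add: \<Theta>_def j split: if_splits)
      qed
      then show "z \<in> bar_boundary G 3 ` bar_chains G 3"
        using z by (intro boundary_if_pairings_vanish[of I G f, OF f span]) (simp_all add: kernel_def Z)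
    qed
    show "bar_boundary G 3 ` bar_chains G 3 \<subseteq> kernel ?Z ?P \<Theta>"
    proof
      fix z :: "'g list \<Rightarrow>\<^sub>0 bit" assume "z \<in> bar_boundary G 3 ` bar_chains G 3"
      then obtain c where c: "c \<in> bar_chains G 3" "z = bar_boundary G 3 c" by blast
      have "z \<in> carrier ?Z" unfolding c(2) Z using bar_boundary_boundary[OF G c(1)] by blast
      moreover have "\<Theta> z = \<one>\<^bsub>?P\<^esub>"
        using pairing_boundary[OF f c(1)] b bij_betwE[OF b] by (auto simp: \<Theta>_def c(2) restrict_def fun_eq_iff)
      ultimately show "z \<in> kernel ?Z ?P \<Theta>" by (simp add: kernel_def)
    qed
  qed
  show ?thesis
    unfolding group_homology_def three ker[symmetric] by (rule FactGroup_iso[OF surj])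
qed

section \<open>Free abelian groups of finite rank\<close>

text \<open>An isomorphism with Z^n, realised as the integer sequences that vanish from index
  \<open>n\<close> on; a further factor Z then just fills the next coordinate.\<close>

definition free_rank :: "('a, 'b) monoid_scheme \<Rightarrow> nat \<Rightarrow> bool" where
  "free_rank G n \<longleftrightarrow> group G \<and> (\<exists>\<theta> :: 'a \<Rightarrow> nat \<Rightarrow> int.
     bij_betw \<theta> (carrier G) {x. \<forall>i\<ge>n. x i = 0} \<and>
     (\<forall>g\<in>carrier G. \<forall>h\<in>carrier G. \<forall>i. \<theta> (g \<otimes>\<^bsub>G\<^esub> h) i = \<theta> g i + \<theta> h i))"

lemma free_rank_trivial:
  assumes "group G" "trivial_group G" shows "free_rank G 0"
proof -
  interpret group G by fact
  have c: "carrier G = {\<one>\<^bsub>G\<^esub>}" using assms(2) by (simp add: trivial_group_def)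
  have "{x :: nat \<Rightarrow> int. \<forall>i\<ge>0. x i = 0} = {\<lambda>_. 0}" by auto
  then show ?thesis
    unfolding free_rank_def using assms(1)
    by (intro conjI exI[of _ "\<lambda>_ _. 0"]) (auto simp: c bij_betw_def)
qed

lemma free_rank_iso:
  assumes G: "free_rank G n" and H: "group H" and iso: "G \<cong> H"
  shows "free_rank H n"
proof -
  have "H \<cong> G" using G iso group.iso_sym unfolding free_rank_def by blast
  then obtain f where f: "f \<in> iso H G" by (auto simp: is_iso_def)
  obtain \<theta> :: "_ \<Rightarrow> nat \<Rightarrow> int" where \<theta>: "bij_betw \<theta> (carrier G) {x. \<forall>i\<ge>n. x i = 0}"
    "\<And>g h i. g \<in> carrier G \<Longrightarrow> h \<in> carrier G \<Longrightarrow> \<theta> (g \<otimes>\<^bsub>G\<^esub> h) i = \<theta> g i + \<theta> h i"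
    using G unfolding free_rank_def by blast
  have "bij_betw (\<theta> \<circ> f) (carrier H) {x. \<forall>i\<ge>n. x i = 0}"
    using f \<theta>(1) by (auto simp: iso_def intro: bij_betw_trans)
  moreover have "f (g \<otimes>\<^bsub>H\<^esub> h) = f g \<otimes>\<^bsub>G\<^esub> f h" "f g \<in> carrier G" if "g \<in> carrier H" "h \<in> carrier H" for g h
    using f that by (auto simp: iso_def hom_def)
  ultimately show ?thesis
    unfolding free_rank_def using H \<theta>(2) by (intro conjI exI[of _ "\<theta> \<circ> f"]) auto
qed

lemma free_rank_DirProd_int:
  assumes G: "free_rank G n" and K: "group K" "K \<cong> integer_group"
  shows "free_rank (G \<times>\<times> K) (Suc n)"
proof -
  obtain f where f: "f \<in> iso K integer_group" using K by (auto simp: is_iso_def)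
  obtain \<theta> :: "_ \<Rightarrow> nat \<Rightarrow> int" where \<theta>: "bij_betw \<theta> (carrier G) {x. \<forall>i\<ge>n. x i = 0}"
    "\<And>g h i. g \<in> carrier G \<Longrightarrow> h \<in> carrier G \<Longrightarrow> \<theta> (g \<otimes>\<^bsub>G\<^esub> h) i = \<theta> g i + \<theta> h i"
    and grp: "group G"
    using G unfolding free_rank_def by blast
  have fb: "bij_betw f (carrier K) UNIV" using f by (simp add: iso_def)
  have \<theta>n: "\<theta> g i = 0" if "g \<in> carrier G" "n \<le> i" for g i
    using bij_betwE[OF \<theta>(1)] that by blast
  define \<eta> where "\<eta> p = (\<theta> (fst p))(n := f (snd p))" for p
  have "bij_betw \<eta> (carrier (G \<times>\<times> K)) {x. \<forall>i\<ge>Suc n. x i = 0}"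
  proof (rule bij_betwI')
    fix p q assume p: "p \<in> carrier (G \<times>\<times> K)" and q: "q \<in> carrier (G \<times>\<times> K)"
    have pc: "fst p \<in> carrier G" "snd p \<in> carrier K" and qc: "fst q \<in> carrier G" "snd q \<in> carrier K"
      using p q by (auto simp: DirProd_def)
    show "(\<eta> p = \<eta> q) = (p = q)"
    proof
      assume e: "\<eta> p = \<eta> q"
      have "f (snd p) = f (snd q)" using fun_cong[OF e, of n] by (simp add: \<eta>_def)
      then have s: "snd p = snd q" by (rule inj_onD[OF bij_betw_imp_inj_on[OF fb] _ pc(2) qc(2)])
      have "\<theta> (fst p) i = \<theta> (fst q) i" for i
        using fun_cong[OF e, of i] \<theta>n[of "fst p" i] \<theta>n[of "fst q" i] pc qc
        by (cases "i = n") (auto simp: \<eta>_def)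
      then have "\<theta> (fst p) = \<theta> (fst q)" by blast
      then have "fst p = fst q" by (rule inj_onD[OF bij_betw_imp_inj_on[OF \<theta>(1)] _ pc(1) qc(1)])
      with s show "p = q" by (rule prod_eqI[rotated])
    qed simp
  next
    fix p assume "p \<in> carrier (G \<times>\<times> K)"
    then show "\<eta> p \<in> {x. \<forall>i\<ge>Suc n. x i = 0}" using \<theta>n[of "fst p"] by (auto simp: \<eta>_def DirProd_def)
  next
    fix x :: "nat \<Rightarrow> int" assume x: "x \<in> {x. \<forall>i\<ge>Suc n. x i = 0}"
    have "x(n := 0) \<in> {x. \<forall>i\<ge>n. x i = 0}" using x by auto
    then have "x(n := 0) \<in> \<theta> ` carrier G" using \<theta>(1) by (simp add: bij_betw_def)
    then obtain g where g: "g \<in> carrier G" "\<theta> g = x(n := 0)" by force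
    have "x n \<in> f ` carrier K" using fb by (simp add: bij_betw_def)
    then obtain k where k: "k \<in> carrier K" "f k = x n" by force
    show "\<exists>p\<in>carrier (G \<times>\<times> K). x = \<eta> p"
      by (rule bexI[of _ "(g, k)"]) (use g k in \<open>auto simp: \<eta>_def DirProd_def fun_eq_iff\<close>)
  qed
  moreover have "\<eta> (p \<otimes>\<^bsub>G \<times>\<times> K\<^esub> q) i = \<eta> p i + \<eta> q i"
    if "p \<in> carrier (G \<times>\<times> K)" "q \<in> carrier (G \<times>\<times> K)" for p q i
    using that f \<theta>(2) by (auto simp: \<eta>_def DirProd_def iso_def hom_def)
  ultimately show ?thesis
    unfolding free_rank_def using DirProd_group[OF grp K(1)] by blast
qed

text \<open>Elimination without fractions: a vector \<open>v p\<close> with nonzero coordinate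
  \<open>n\<close> is the pivot, and \<open>u\<close> combines it with the others so that this
  coordinate disappears.\<close>

lemma int_vectors_dependent:
  fixes v :: "'i \<Rightarrow> nat \<Rightarrow> int"
  assumes "finite I" "n < card I" "\<And>i j. i \<in> I \<Longrightarrow> n \<le> j \<Longrightarrow> v i j = 0"
  shows "\<exists>k. (\<exists>i\<in>I. k i \<noteq> 0) \<and> (\<forall>j. (\<Sum>i\<in>I. k i * v i j) = (0::int))"
  using assms
proof (induction n arbitrary: I v)
  case 0
  then obtain i where "i \<in> I" by (metis card.empty equals0I less_nat_zero_code)
  then show ?case using 0 by (intro exI[of _ "\<lambda>_. 1"]) auto
next
  case (Suc n)
  show ?case
  proof (cases "\<forall>i\<in>I. v i n = 0")
    case True
    then have "v i j = 0" if "i \<in> I" "n \<le> j" for i j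
      using Suc(4)[of i j] that by (cases "j = n") auto
    then show ?thesis using Suc(1)[of I v] Suc(2,3) by auto
  next
    case False
    then obtain p where p: "p \<in> I" "v p n \<noteq> 0" by blast
    define u where "u i j = v p n * v i j - v i n * v p j" for i j
    have "\<exists>k. (\<exists>i\<in>I - {p}. k i \<noteq> 0) \<and> (\<forall>j. (\<Sum>i\<in>I - {p}. k i * u i j) = 0)"
    proof (rule Suc(1))
      show "finite (I - {p})" "n < card (I - {p})" using Suc(2,3) p by auto
      fix i j assume "i \<in> I - {p}" "n \<le> j"
      then show "u i j = 0" using Suc(4)[of i j] Suc(4)[of p j] p
        by (cases "j = n") (auto simp: u_def)
    qed
    then obtain k where k: "\<exists>i\<in>I - {p}. k i \<noteq> 0" "\<And>j. (\<Sum>i\<in>I - {p}. k i * u i j) = 0" by blast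
    define l where "l i = (if i = p then - (\<Sum>i\<in>I - {p}. k i * v i n) else v p n * k i)" for i
    have "(\<Sum>i\<in>I. l i * v i j) = 0" for j
    proof -
      have "(\<Sum>i\<in>I. l i * v i j) = l p * v p j + (\<Sum>i\<in>I - {p}. l i * v i j)"
        using Suc(2) p by (simp add: sum.remove)
      also have "(\<Sum>i\<in>I - {p}. l i * v i j) = (\<Sum>i\<in>I - {p}. v p n * (k i * v i j))"
        by (rule sum.cong) (auto simp: l_def)
      also have "l p * v p j = - (\<Sum>i\<in>I - {p}. k i * v i n * v p j)"
        by (simp add: l_def sum_distrib_right)
      also have "- (\<Sum>i\<in>I - {p}. k i * v i n * v p j) + (\<Sum>i\<in>I - {p}. v p n * (k i * v i j))
          = (\<Sum>i\<in>I - {p}. k i * u i j)"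
        by (simp add: u_def sum_subtractf algebra_simps)
      finally show ?thesis using k(2) by simp
    qed
    moreover have "\<exists>i\<in>I. l i \<noteq> 0" using k(1) p by (auto simp: l_def)
    ultimately show ?thesis by blast
  qed
qed

lemma abelian_rank_free_rank:
  assumes "free_rank G n"
  shows "abelian_rank G = n"
proof -
  obtain \<theta> :: "_ \<Rightarrow> nat \<Rightarrow> int" where bij: "bij_betw \<theta> (carrier G) {x. \<forall>i\<ge>n. x i = 0}"
    and add: "\<And>g h i. g \<in> carrier G \<Longrightarrow> h \<in> carrier G \<Longrightarrow> \<theta> (g \<otimes>\<^bsub>G\<^esub> h) i = \<theta> g i + \<theta> h i"
    and grp: "group G"
    using assms unfolding free_rank_def by blast
  have inj: "g = h" if "g \<in> carrier G" "h \<in> carrier G" "\<And>i. \<theta> g i = \<theta> h i" for g h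
  proof -
    have "\<theta> g = \<theta> h" using that(3) by blast
    then show ?thesis by (rule inj_onD[OF bij_betw_imp_inj_on[OF bij] _ that(1,2)])
  qed
  interpret group G by (rule grp)
  interpret comm_group G
    by (rule group_comm_groupI) (auto intro!: inj simp: add)
  have hom: "group_hom G integer_group (\<lambda>g. \<theta> g i)" for i
    by (auto simp: group_hom_def group_hom_axioms_def hom_def grp add)
  have \<theta>_pow: "\<theta> (g [^]\<^bsub>G\<^esub> (k::int)) i = k * \<theta> g i" if "g \<in> carrier G" for g k i
    using group_hom.hom_int_pow[OF hom[of i] that, of k] by (simp add: mult.commute)
  have \<theta>_one: "\<theta> \<one>\<^bsub>G\<^esub> i = 0" for i using group_hom.hom_one[OF hom, of i] by simp
  have \<theta>_prod: "\<theta> (finprod G (\<lambda>b. b [^]\<^bsub>G\<^esub> (k b)) B) i = (\<Sum>b\<in>B. k b * \<theta> b i)"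
    if "finite B" "B \<subseteq> carrier G" for B and k :: "_ \<Rightarrow> int" and i
    using that
  proof (induction B rule: finite_induct)
    case (insert b B)
    then have "finprod G (\<lambda>b. b [^]\<^bsub>G\<^esub> (k b)) (insert b B) = b [^]\<^bsub>G\<^esub> (k b) \<otimes>\<^bsub>G\<^esub> finprod G (\<lambda>b. b [^]\<^bsub>G\<^esub> (k b)) B"
      by (intro finprod_insert) auto
    moreover have "finprod G (\<lambda>b. b [^]\<^bsub>G\<^esub> (k b)) B \<in> carrier G" using insert by (intro finprod_closed) auto
    ultimately show ?case using insert by (simp add: add \<theta>_pow)
  qed (simp add: \<theta>_one)
  have prod_closed: "finprod G (\<lambda>b. b [^]\<^bsub>G\<^esub> (k b)) B \<in> carrier G" if "B \<subseteq> carrier G" for B and k :: "_ \<Rightarrow> int"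
    using that by (intro finprod_closed) auto
  have le: "card B \<le> n" if B: "int_independent G B" for B
  proof (rule ccontr)
    assume "\<not> ?thesis"
    then have nB: "n < card B" by simp
    have fB: "finite B" "B \<subseteq> carrier G" using B by (auto simp: int_independent_def)
    have "\<theta> b j = 0" if "b \<in> B" "n \<le> j" for b j using bij_betwE[OF bij] fB that by blast
    then obtain k where k: "\<exists>b\<in>B. k b \<noteq> 0" "\<forall>j. (\<Sum>b\<in>B. k b * \<theta> b j) = 0"
      using int_vectors_dependent[OF fB(1) nB, of \<theta>] by blast
    have "finprod G (\<lambda>b. b [^]\<^bsub>G\<^esub> (k b)) B = \<one>\<^bsub>G\<^esub>"
      by (rule inj) (use prod_closed[OF fB(2)] k(2) in \<open>auto simp: \<theta>_prod[OF fB] \<theta>_one\<close>)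
    then show False using B k(1) unfolding int_independent_def by blast
  qed
  define e :: "nat \<Rightarrow> nat \<Rightarrow> int" where "e j i = (if i = j then 1 else 0)" for i j
  define b where "b j = inv_into (carrier G) \<theta> (e j)" for j
  have b: "b j \<in> carrier G" "\<theta> (b j) = e j" if "j < n" for j
  proof -
    have "e j \<in> {x. \<forall>i\<ge>n. x i = 0}" using that by (auto simp: e_def)
    then have "e j \<in> \<theta> ` carrier G" using bij by (simp add: bij_betw_def)
    then show "b j \<in> carrier G" "\<theta> (b j) = e j" unfolding b_def by (auto simp: inv_into_into f_inv_into_f)
  qed
  have injb: "inj_on b {..<n}"
  proof (rule inj_onI)
    fix i j assume ij: "i \<in> {..<n}" "j \<in> {..<n}" "b i = b j"
    then have "e i = e j" using b(2)[of i] b(2)[of j] by simp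
    then have "e i i = e j i" by simp
    then show "i = j" by (simp add: e_def split: if_splits)
  qed
  have "int_independent G (b ` {..<n})"
    unfolding int_independent_def
  proof (intro conjI allI impI ballI)
    show B: "finite (b ` {..<n})" "b ` {..<n} \<subseteq> carrier G" using b by auto
    fix k :: "'a \<Rightarrow> int" and g
    assume one: "finprod G (\<lambda>b. b [^]\<^bsub>G\<^esub> (k b)) (b ` {..<n}) = \<one>\<^bsub>G\<^esub>" and "g \<in> b ` {..<n}"
    then obtain j where j: "j < n" "g = b j" by blast
    have "0 = (\<Sum>g\<in>b ` {..<n}. k g * \<theta> g j)" using \<theta>_prod[OF B, of k j] one \<theta>_one by simp
    also have "\<dots> = (\<Sum>i<n. k (b i) * \<theta> (b i) j)" by (simp add: sum.reindex[OF injb])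
    also have "\<dots> = (\<Sum>i<n. if i = j then k (b i) else 0)"
      by (rule sum.cong) (auto simp: b e_def)
    finally show "k g = 0" using j by simp
  qed
  moreover have "card (b ` {..<n}) = n" using injb by (simp add: card_image)
  ultimately have "n \<in> {card B |B. int_independent G B}" by (metis (mono_tags, lifting) mem_Collect_eq)
  then show ?thesis
    unfolding abelian_rank_def using le by (intro cSup_eq_maximum) auto
qed

section \<open>First homology of a graph\<close>

abbreviation function_space :: "('v \<Rightarrow> real) topology" where "function_space \<equiv> powertop_real UNIV"

definition graph_points :: "'v set \<Rightarrow> 'v set set \<Rightarrow> ('v \<Rightarrow> real) set" where
  "graph_points V E =
    {x. (\<forall>v. 0 \<le> x v) \<and> {v. x v \<noteq> 0} \<in> (\<lambda>v. {v}) ` V \<union> E \<and> (\<Sum>v | x v \<noteq> 0. x v) = 1}"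

lemma graph_realization_eq: "graph_realization V E = subtopology function_space (graph_points V E)"
  by (simp add: graph_realization_def graph_points_def)

text \<open>The point with parameter \<open>t\<close> on the edge from \<open>u\<close> to
  \<open>w\<close>. At \<open>t = 0\<close> it is the vertex \<open>u\<close> for any second
  argument, so \<open>edge_point u z 0\<close> with a dummy \<open>z\<close> denotes a vertex
  below.\<close>

definition edge_point :: "'v \<Rightarrow> 'v \<Rightarrow> real \<Rightarrow> 'v \<Rightarrow> real" where
  "edge_point u w t = (\<lambda>v. if v = u then 1 - t else if v = w then t else 0)"

definition simple_graph :: "'v set \<Rightarrow> 'v set set \<Rightarrow> bool" where
  "simple_graph V E \<longleftrightarrow> E \<subseteq> {{u, w} | u w. u \<in> V \<and> w \<in> V \<and> u \<noteq> w}"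

lemma edge_point_swap: "u \<noteq> w \<Longrightarrow> edge_point u w t = edge_point w u (1 - t)"
  by (auto simp: edge_point_def)

lemma edge_point_1: "u \<noteq> w \<Longrightarrow> edge_point u w 1 = edge_point w z 0"
  by (auto simp: edge_point_def)

lemma edge_point_0: "edge_point u w 0 = edge_point u z 0"
  by (auto simp: edge_point_def)

lemma vertex_in_graph_points: "u \<in> V \<Longrightarrow> edge_point u w 0 \<in> graph_points V E"
proof -
  have "{v. edge_point u w 0 v \<noteq> 0} = {u}" by (auto simp: edge_point_def)
  then show "u \<in> V \<Longrightarrow> edge_point u w 0 \<in> graph_points V E"
    unfolding graph_points_def by (auto simp: edge_point_def)
qed

lemma edge_in_graph_points:
  assumes "{u, w} \<in> E" "u \<noteq> w" "0 < t" "t < 1"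
  shows "edge_point u w t \<in> graph_points V E"
proof -
  have "{v. edge_point u w t v \<noteq> 0} = {u, w}" using assms by (auto simp: edge_point_def)
  then show ?thesis
    unfolding graph_points_def using assms by (auto simp: edge_point_def)
qed

lemma closed_edge_in_graph_points:
  assumes "simple_graph V E" "{u, w} \<in> E" "u \<noteq> w" "0 \<le> t" "t \<le> 1"
  shows "edge_point u w t \<in> graph_points V E"
proof -
  have "u \<in> V" "w \<in> V" using assms(1,2) by (auto simp: simple_graph_def doubleton_eq_iff)
  consider "t = 0" | "t = 1" | "0 < t" "t < 1" using assms by linarith
  then show ?thesis
    using \<open>u \<in> V\<close> \<open>w \<in> V\<close> vertex_in_graph_points edge_in_graph_points assms
    by cases (auto simp: edge_point_1[OF assms(3), where z = u])
qed

lemma graph_points_cases: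
  assumes "simple_graph V E" "x \<in> graph_points V E"
  obtains (vertex) u where "u \<in> V" "\<And>z. x = edge_point u z 0"
    | (edge) u w t where "{u, w} \<in> E" "u \<noteq> w" "0 < t" "t < 1" "x = edge_point u w t"
proof -
  have x: "\<And>v. 0 \<le> x v" "{v. x v \<noteq> 0} \<in> (\<lambda>v. {v}) ` V \<union> E" "(\<Sum>v | x v \<noteq> 0. x v) = 1"
    using assms(2) by (auto simp: graph_points_def)
  consider u where "u \<in> V" "{v. x v \<noteq> 0} = {u}" | "{v. x v \<noteq> 0} \<in> E" using x(2) by blast
  then show thesis
  proof cases
    case 1
    then have "x u = 1" using x(3) by simp
    moreover have "x v = 0" if "v \<noteq> u" for v using 1(2) that by blast
    ultimately have "x = edge_point u z 0" for z by (auto simp: edge_point_def)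
    then show thesis using vertex 1(1) by blast
  next
    case 2
    then obtain u w where uw: "{v. x v \<noteq> 0} = {u, w}" "u \<noteq> w"
      using assms(1) by (auto simp: simple_graph_def)
    then have s: "x u + x w = 1" using x(3) by simp
    have nz: "x u \<noteq> 0" "x w \<noteq> 0" using uw by blast+
    then have pos: "0 < x u" "0 < x w" using x(1)[of u] x(1)[of w] by linarith+
    have "x v = 0" if "v \<noteq> u" "v \<noteq> w" for v using uw that by blast
    then have "x = edge_point u w (x w)" using s uw(2) by (auto simp: edge_point_def)
    then show thesis using edge[of u w "x w"] uw 2 pos s by auto
  qed
qed

section \<open>Straight-line homotopies\<close>

definition blend :: "real \<Rightarrow> ('v \<Rightarrow> real) \<Rightarrow> ('v \<Rightarrow> real) \<Rightarrow> 'v \<Rightarrow> real" where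
  "blend \<tau> y z = (\<lambda>v. (1 - \<tau>) * y v + \<tau> * z v)"

lemma blend_edge_point:
  "blend \<tau> (edge_point u w t) (edge_point u w t') = edge_point u w ((1 - \<tau>) * t + \<tau> * t')"
  by (auto simp: blend_def edge_point_def algebra_simps)

lemma blend_self [simp]: "blend \<tau> y y = y"
  by (simp add: blend_def algebra_simps)

text \<open>The homotopies below are all straight lines in the function space, so the work lies in
  checking that the segments stay inside the given sets.\<close>

lemma homotopic_with_blend:
  assumes f: "continuous_map X function_space f" and g: "continuous_map X function_space g"
    and Q: "\<And>x \<tau>. x \<in> topspace X \<Longrightarrow> 0 \<le> \<tau> \<Longrightarrow> \<tau> \<le> 1 \<Longrightarrow> blend \<tau> (f x) (g x) \<in> Q"
    and P: "\<And>\<tau>. 0 \<le> \<tau> \<Longrightarrow> \<tau> \<le> 1 \<Longrightarrow> P (\<lambda>x. blend \<tau> (f x) (g x))"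
  shows "homotopic_with P X (subtopology function_space Q) f g"
proof -
  have fv: "continuous_map X euclideanreal (\<lambda>x. f x v)" and gv: "continuous_map X euclideanreal (\<lambda>x. g x v)" for v
    using f g by (simp_all add: continuous_map_componentwise_UNIV)
  let ?I = "top_of_set {0..1::real}"
  have fst: "continuous_map (prod_topology ?I X) euclideanreal fst"
    using continuous_map_fst[of ?I X] continuous_map_into_fulltopology by blast
  have comp: "continuous_map (prod_topology ?I X) euclideanreal (\<lambda>p. h (snd p))"
    if "continuous_map X euclideanreal h" for h
    using continuous_map_compose[OF continuous_map_snd that, of ?I] by (simp add: comp_def)
  show ?thesis
    unfolding homotopic_with_def
  proof (intro exI[of _ "\<lambda>p. blend (fst p) (f (snd p)) (g (snd p))"] conjI)
    show "continuous_map (prod_topology ?I X) (subtopology function_space Q) (\<lambda>p. blend (fst p) (f (snd p)) (g (snd p)))"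
      unfolding continuous_map_in_subtopology continuous_map_componentwise_UNIV
    proof (intro conjI allI)
      fix v
      show "continuous_map (prod_topology ?I X) euclideanreal (\<lambda>p. blend (fst p) (f (snd p)) (g (snd p)) v)"
        unfolding blend_def by (intro continuous_intros fst comp fv gv)
    qed (use Q in auto)
  qed (use P in \<open>auto simp: blend_def\<close>)
qed

lemma path_component_of_edge:
  assumes "simple_graph V E" "{u, w} \<in> E" "u \<noteq> w"
  shows "path_component_of (graph_realization V E) (edge_point u z 0) (edge_point w z 0)"
  unfolding path_component_of_def
proof (intro exI[of _ "edge_point u w"] conjI)
  show "pathin (graph_realization V E) (edge_point u w)"
    unfolding pathin_def graph_realization_eq continuous_map_in_subtopology continuous_map_componentwise_UNIV
  proof (intro conjI allI)
    fix v
    show "continuous_map (top_of_set {0..1}) euclideanreal (\<lambda>t. edge_point u w t v)"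
      by (cases "v = u"; cases "v = w") (auto simp: edge_point_def intro!: continuous_intros)
    show "edge_point u w \<in> topspace (top_of_set {0..1}) \<rightarrow> graph_points V E"
      using closed_edge_in_graph_points[OF assms] by auto
  qed
qed (auto simp: edge_point_0[of u w z] edge_point_1[OF assms(3), of z])

section \<open>Adding one edge to a graph\<close>

locale add_edge =
  fixes V :: "'v set" and E :: "'v set set" and a b :: 'v
  assumes simple: "simple_graph V E" and ab: "a \<in> V" "b \<in> V" "a \<noteq> b" "{a, b} \<notin> E"
begin

definition P where "P = graph_points V E"
definition P' where "P' = graph_points V (insert {a, b} E)"
definition Op where "Op = {edge_point a b t | t. 0 < t \<and> t < 1}"
text \<open>The old graph with the outer thirds of the new edge. \<open>min (x a) (x b)\<close> is
  \<open>0\<close> on the old graph and positive inside the new edge (\<open>P_iff\<close>), so it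
  shows that \<open>P\<close> is closed and that \<open>N\<close> is an open neighbourhood.\<close>

definition N where "N = {x \<in> P'. min (x a) (x b) < 1 / 3}"
definition ON where "ON = {edge_point a b t | t. 0 < t \<and> t < 1 \<and> (t < 1 / 3 \<or> 2 / 3 < t)}"
abbreviation X' where "X' \<equiv> subtopology function_space P'"

lemma simple': "simple_graph V (insert {a, b} E)"
  using simple ab by (auto simp: simple_graph_def)

lemma edge_point_ab [simp]: "edge_point a b t a = 1 - t" "edge_point a b t b = t"
  using ab by (auto simp: edge_point_def)

lemma P_coords:
  assumes "x \<in> P"
  shows "0 \<le> x a" "0 \<le> x b" "x a = 0 \<or> x b = 0" "x a + x b \<le> 1"
    "x a + x b = 1 \<Longrightarrow> x = edge_point a b 0 \<or> x = edge_point a b 1"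
proof -
  have "0 \<le> x a \<and> 0 \<le> x b \<and> (x a = 0 \<or> x b = 0) \<and> x a + x b \<le> 1 \<and>
    (x a + x b = 1 \<longrightarrow> x = edge_point a b 0 \<or> x = edge_point a b 1)"
    using simple assms[unfolded P_def]
  proof (cases rule: graph_points_cases)
    case (vertex u)
    have x: "x = edge_point u u 0" by (rule vertex(2))
    have "x a = of_bool (a = u)" "x b = of_bool (b = u)" by (auto simp: x edge_point_def)
    moreover have "x = edge_point a b 0" if "a = u" using vertex(2) that by simp
    moreover have "x = edge_point a b 1" if "b = u" 
      using vertex(2)[of a] that edge_point_1[OF ab(3), of a] by simp
    ultimately show ?thesis using ab by auto
  next
    case (edge u w t)
    have "\<not> (a \<in> {u, w} \<and> b \<in> {u, w})" using edge(1) ab by (auto simp: insert_commute)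
    then show ?thesis using edge by (auto simp: edge_point_def)
  qed
  then show "0 \<le> x a" "0 \<le> x b" "x a = 0 \<or> x b = 0" "x a + x b \<le> 1"
    "x a + x b = 1 \<Longrightarrow> x = edge_point a b 0 \<or> x = edge_point a b 1" by auto
qed

lemma P_subset: "P \<subseteq> P'"
  by (auto simp: P_def P'_def graph_points_def)

lemma closed_edge: "0 \<le> t \<Longrightarrow> t \<le> 1 \<Longrightarrow> edge_point a b t \<in> P'"
  unfolding P'_def using closed_edge_in_graph_points[OF simple'] ab by blast

lemma ends_in_P: "edge_point a b 0 \<in> P" "edge_point a b 1 \<in> P"
  unfolding P_def edge_point_1[OF ab(3), of a] using ab by (auto intro: vertex_in_graph_points)

lemma P'_eq: "P' = P \<union> Op"
proof
  show "P' \<subseteq> P \<union> Op"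
  proof
    fix x assume "x \<in> P'"
    with simple' show "x \<in> P \<union> Op"
      unfolding P'_def
    proof (cases rule: graph_points_cases)
      case (vertex u)
      then show ?thesis unfolding P_def using vertex_in_graph_points[of u V u E] by simp
    next
      case (edge u w t)
      show ?thesis
      proof (cases "{u, w} = {a, b}")
        case True
        then consider "u = a" "w = b" | "u = b" "w = a" by (auto simp: doubleton_eq_iff)
        then show ?thesis
        proof cases
          case 2
          then have "x = edge_point a b (1 - t)" using edge(5) edge_point_swap[of b a t] ab by simp
          then show ?thesis using edge(3,4) by (auto simp: Op_def)
        qed (use edge in \<open>auto simp: Op_def\<close>)
      next
        case False
        then have "{u, w} \<in> E" using edge(1) by blast
        then show ?thesis unfolding P_def using edge_in_graph_points[OF _ edge(2-4)] edge(5) by simp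
      qed
    qed
  qed
  show "P \<union> Op \<subseteq> P'" using P_subset closed_edge by (auto simp: Op_def)
qed

lemma Op_iff: "x \<in> Op \<longleftrightarrow> x \<in> P' \<and> x \<notin> P"
proof -
  have "x \<notin> P" if "x \<in> Op" for x
  proof
    assume "x \<in> P"
    obtain t where t: "x = edge_point a b t" "0 < t" "t < 1" using \<open>x \<in> Op\<close> by (auto simp: Op_def)
    then show False using P_coords(3)[OF \<open>x \<in> P\<close>] by simp
  qed
  then show ?thesis unfolding P'_eq by blast
qed

lemma P_iff: "x \<in> P \<longleftrightarrow> x \<in> P' \<and> min (x a) (x b) = 0"
proof -
  have "min (x a) (x b) \<noteq> 0" if "x \<in> Op" for x
    using that by (auto simp: Op_def)
  moreover have "min (x a) (x b) = 0" if "x \<in> P" for x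
    using P_coords[OF that] by auto
  ultimately show ?thesis using Op_iff[of x] P'_eq by blast
qed

lemma N_eq: "N = P \<union> ON"
proof -
  have "min (x a) (x b) < 1 / 3" if "x \<in> P" for x
    using P_coords(3)[OF that] P_coords(1,2)[OF that] by auto
  moreover have "{x \<in> Op. min (x a) (x b) < 1 / 3} = ON"
  proof -
    have "min (1 - t) t < 1 / 3 \<longleftrightarrow> t < 1 / 3 \<or> 2 / 3 < t" for t :: real by linarith
    then show ?thesis by (auto simp: Op_def ON_def)
  qed
  ultimately show ?thesis unfolding N_def P'_eq by blast
qed

lemma ON_eq: "ON = N - P"
proof -
  have "x \<notin> P" if "x \<in> ON" for x using P_coords(3)[of x] that by (auto simp: ON_def)
  then show ?thesis by (auto simp: N_eq)
qed

lemma ON_subset: "ON \<subseteq> Op"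
  by (auto simp: ON_def Op_def)

lemma continuous_coord: "continuous_map (subtopology function_space Q) euclideanreal (\<lambda>x. x v)"
  by (intro continuous_intros) auto

text \<open>The difference \<open>x a - x b\<close> clamped to the interval of radius
  \<open>min (x a) (x b)\<close>. At parameter \<open>t\<close> of the new edge it is
  \<open>t\<close> on the first third, \<open>1 - 2 * t\<close> on the middle one and
  \<open>t - 1\<close> on the last; on the old graph the radius is \<open>0\<close>.\<close>

definition shift :: "('v \<Rightarrow> real) \<Rightarrow> real" where
  "shift x = max (- min (x a) (x b)) (min (min (x a) (x b)) (x a - x b))"

text \<open>On the new edge, \<open>stretch\<close> maps the outer thirds to the ends and the middle third
  affinely onto the edge.\<close>

definition stretch :: "('v \<Rightarrow> real) \<Rightarrow> 'v \<Rightarrow> real" where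
  "stretch x = (\<lambda>v. x v + shift x * (if v = a then 1 else if v = b then - 1 else 0))"

lemma stretch_P: "x \<in> P \<Longrightarrow> stretch x = x"
  using P_iff[of x] by (auto simp: stretch_def shift_def)

lemma stretch_edge: "stretch (edge_point a b t) = edge_point a b (t - shift (edge_point a b t))"
  using ab by (auto simp: stretch_def edge_point_def)

lemma shift_edge:
  assumes "0 \<le> t" "t \<le> 1"
  shows "0 \<le> t - shift (edge_point a b t)" "t - shift (edge_point a b t) \<le> 1"
    "t < 1 / 3 \<Longrightarrow> shift (edge_point a b t) = t" "2 / 3 < t \<Longrightarrow> shift (edge_point a b t) = t - 1"
  using assms by (auto simp: shift_def)

lemma stretch_in_P': "x \<in> P' \<Longrightarrow> stretch x \<in> P'"
proof -
  assume "x \<in> P'"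
  then consider "x \<in> P" | t where "x = edge_point a b t" "0 < t" "t < 1" by (auto simp: P'_eq Op_def)
  then show "stretch x \<in> P'"
  proof cases
    case 2
    then show ?thesis using shift_edge(1,2)[of t] by (auto simp: stretch_edge intro!: closed_edge)
  qed (use stretch_P P_subset in auto)
qed

lemma stretch_N: "x \<in> N \<Longrightarrow> stretch x \<in> P"
  using stretch_P ends_in_P by (auto simp: N_eq ON_def stretch_edge shift_edge)

text \<open>On an outer third of the new edge, \<open>stretch\<close> goes to the adjacent end, so
  the segment back to \<open>x\<close> remains in that third.\<close>

lemma blend_stretch:
  assumes "0 \<le> \<tau>" "\<tau> \<le> 1"
  shows "x \<in> P' \<Longrightarrow> blend \<tau> (stretch x) x \<in> P'" "x \<in> N \<Longrightarrow> blend \<tau> (stretch x) x \<in> N"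
    "x \<in> P \<Longrightarrow> blend \<tau> (stretch x) x \<in> P"
proof -
  show P: "blend \<tau> (stretch x) x \<in> P" if "x \<in> P" for x using that by (simp add: stretch_P)
  have e: "0 \<le> (1 - \<tau>) * (t - shift (edge_point a b t)) + \<tau> * t \<and> (1 - \<tau>) * (t - shift (edge_point a b t)) + \<tau> * t \<le> 1"
    if "0 < t" "t < 1" for t
  proof -
    have "t - shift (edge_point a b t) \<in> {0..1}" "t \<in> {0..1}" using shift_edge(1,2)[of t] that by auto
    then have "(1 - \<tau>) *\<^sub>R (t - shift (edge_point a b t)) + \<tau> *\<^sub>R t \<in> {0..1::real}"
      using assms by (intro convexD) auto
    then show ?thesis by simp
  qed
  show "blend \<tau> (stretch x) x \<in> P'" if x: "x \<in> P'" for x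
  proof -
    consider "x \<in> P" | t where "x = edge_point a b t" "0 < t" "t < 1" using x by (auto simp: P'_eq Op_def)
    then show ?thesis
    proof cases
      case 2
      then show ?thesis using e[OF 2(2,3)] by (auto simp: stretch_edge blend_edge_point intro!: closed_edge)
    qed (use P P_subset in blast)
  qed
  show "blend \<tau> (stretch x) x \<in> N" if x: "x \<in> N" for x
    using x unfolding N_eq
  proof
    assume "x \<in> ON"
    then obtain t where t: "x = edge_point a b t" "0 < t" "t < 1" "t < 1 / 3 \<or> 2 / 3 < t" by (auto simp: ON_def)
    have eq: "blend \<tau> (stretch x) x = edge_point a b ((1 - \<tau>) * (t - shift x) + \<tau> * t)"
      unfolding t(1) stretch_edge blend_edge_point ..
    have "blend \<tau> (stretch x) x \<in> P'" unfolding eq using e[OF t(2,3)] t(1) by (intro closed_edge) auto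
    moreover have "min (blend \<tau> (stretch x) x a) (blend \<tau> (stretch x) x b) < 1 / 3"
      using t(4)
    proof
      assume "t < 1 / 3"
      moreover have "\<tau> * t \<le> t" using assms t(2) by (intro mult_left_le_one_le) auto
      moreover have "(1 - \<tau>) * (t - shift x) + \<tau> * t = \<tau> * t"
        using shift_edge(3)[of t] t(1,2,3) \<open>t < 1 / 3\<close> by simp
      ultimately have "(1 - \<tau>) * (t - shift x) + \<tau> * t < 1 / 3" by linarith
      then show ?thesis unfolding eq by simp
    next
      assume a: "2 / 3 < t"
      have "(1 - \<tau>) * (t - shift x) + \<tau> * t = 1 - \<tau> * (1 - t)"
      proof -
        have "shift x = t - 1" using shift_edge(4)[of t] t(1,2,3) a by simp
        then show ?thesis unfolding \<open>shift x = t - 1\<close> by (simp add: algebra_simps)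
      qed
      moreover have "\<tau> * (1 - t) \<le> 1 - t" using assms t by (intro mult_left_le_one_le) auto
      ultimately show ?thesis unfolding eq using a by simp
    qed
    ultimately show "blend \<tau> (stretch x) x \<in> P \<union> ON" unfolding N_eq[symmetric] N_def by simp
  qed (use P in auto)
qed

lemma continuous_stretch: "continuous_map (subtopology function_space Q) function_space stretch"
  unfolding continuous_map_componentwise_UNIV stretch_def shift_def
  by (intro allI continuous_intros continuous_coord)

lemma iso_stretch:
  "hom_induced p X' N X' P stretch \<in> iso (relative_homology_group p X' N) (relative_homology_group p X' P)"
proof (rule homotopy_equivalence_relative_homology_group_isomorphism[where g = id])
  show "continuous_map X' X' stretch"
    unfolding continuous_map_in_subtopology using continuous_stretch stretch_in_P' by auto
  show "homotopic_with (\<lambda>h. h \<in> N \<rightarrow> N) X' X' (id \<circ> stretch) id"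
    "homotopic_with (\<lambda>h. h \<in> P \<rightarrow> P) X' X' (stretch \<circ> id) id"
    unfolding id_comp comp_id
    by (rule homotopic_with_blend; use continuous_stretch blend_stretch in \<open>auto simp: continuous_map_from_subtopology\<close>)+
qed (use stretch_N N_eq in auto)

text \<open>\<open>P\<close> is closed and \<open>N\<close> open, so \<open>P\<close> can be
  excised; the open edge with its outer thirds remains.\<close>

lemma iso_excision:
  "hom_induced p (subtopology function_space Op) ON X' N id
    \<in> iso (relative_homology_group p (subtopology function_space Op) ON) (relative_homology_group p X' N)"
proof -
  have min: "continuous_map X' euclideanreal (\<lambda>x. min (x a) (x b))"
    by (intro continuous_intros continuous_coord)
  have "closedin X' {x \<in> topspace X'. min (x a) (x b) \<in> {0}}"
    by (rule closedin_continuous_map_preimage[OF min]) auto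
  moreover have "{x \<in> topspace X'. min (x a) (x b) \<in> {0}} = P" using P_iff by auto
  ultimately have P: "closedin X' P" by simp
  have "openin X' {x \<in> topspace X'. min (x a) (x b) \<in> {..<1 / 3}}"
    by (rule openin_continuous_map_preimage[OF min]) auto
  moreover have "{x \<in> topspace X'. min (x a) (x b) \<in> {..<1 / 3}} = N" by (auto simp: N_def)
  ultimately have N: "openin X' N" by simp
  have "X' closure_of P \<subseteq> X' interior_of N"
    using P N N_eq by (simp add: closure_of_closedin interior_of_openin)
  from homology_excision_axiom[OF this, of P' p]
  have "hom_induced p (subtopology X' (P' - P)) (N - P) (subtopology X' P') N id
    \<in> iso (relative_homology_group p (subtopology X' (P' - P)) (N - P)) (relative_homology_group p (subtopology X' P') N)"
    by (auto simp: N_def)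
  moreover have "P' \<inter> (P' - P) = Op" using Op_iff by auto
  ultimately show ?thesis by (simp add: subtopology_subtopology ON_eq)
qed

text \<open>Excision followed by \<open>stretch\<close> is again induced by a single map, so
  naturality of the boundary map applies to it in \<open>hom_boundary_inj\<close>.\<close>

definition stretch_iso where "stretch_iso p = hom_induced p (subtopology function_space Op) ON X' P stretch"

lemma iso_stretch_excision:
  "stretch_iso p \<in> iso (relative_homology_group p (subtopology function_space Op) ON) (relative_homology_group p X' P)"
proof -
  have c: "continuous_map (subtopology function_space Op) X' id"
    using P'_eq by (auto simp: continuous_map_in_subtopology continuous_map_from_subtopology)
  have "continuous_map X' X' stretch"
    unfolding continuous_map_in_subtopology using continuous_stretch stretch_in_P' by auto
  then have "stretch_iso p = hom_induced p X' N X' P stretch \<circ> hom_induced p (subtopology function_space Op) ON X' N id"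
    unfolding stretch_iso_def
    by (subst hom_induced_compose[OF c, symmetric]) (use N_eq stretch_N in auto)
  then show ?thesis using iso_set_trans[OF iso_excision iso_stretch] by metis
qed

lemma contractible_Op: "contractible_space (subtopology function_space Op)"
  unfolding contractible_space_def
proof (intro exI[of _ "edge_point a b (1 / 2)"] homotopic_with_blend)
  fix x :: "'v \<Rightarrow> real" and \<tau> :: real
  assume "x \<in> topspace (subtopology function_space Op)" "0 \<le> \<tau>" "\<tau> \<le> 1"
  then obtain t where t: "x = edge_point a b t" "0 < t" "t < 1" by (auto simp: Op_def)
  have "(1 - \<tau>) *\<^sub>R t + \<tau> *\<^sub>R (1 / 2) \<in> {0<..<1::real}"
    using t \<open>0 \<le> \<tau>\<close> \<open>\<tau> \<le> 1\<close> by (intro convexD) auto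
  then show "blend \<tau> (id x) (edge_point a b (1 / 2)) \<in> Op" by (auto simp: t blend_edge_point Op_def)
qed (auto simp: continuous_map_from_subtopology)

abbreviation pa where "pa \<equiv> edge_point a b (1 / 4)"
abbreviation pb where "pb \<equiv> edge_point a b (3 / 4)"

text \<open>Constant on each outer third, at its point with parameter 1/4 or 3/4, and interpolating
  between these on the middle third; so it retracts \<open>ON\<close> to two points.\<close>

definition toends :: "('v \<Rightarrow> real) \<Rightarrow> 'v \<Rightarrow> real" where
  "toends x = edge_point a b (1 / 4 + 1 / 2 * max 0 (min 1 (3 * x b - 1)))"

lemma toends_edge:
  "t < 1 / 3 \<Longrightarrow> toends (edge_point a b t) = pa" "2 / 3 < t \<Longrightarrow> toends (edge_point a b t) = pb"
  by (simp_all add: toends_def)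

lemma continuous_edge_point:
  "continuous_map X euclideanreal f \<Longrightarrow> continuous_map X function_space (\<lambda>x. edge_point a b (f x))"
  unfolding continuous_map_componentwise_UNIV edge_point_def by (auto intro!: continuous_intros)

lemma continuous_toends: "continuous_map (subtopology function_space Q) function_space toends"
  unfolding toends_def by (intro continuous_edge_point continuous_intros continuous_coord)

lemma toends_ON: "x \<in> ON \<Longrightarrow> toends x \<in> {pa, pb}"
  by (auto simp: ON_def toends_edge)

lemma edge_in_ON:
  "0 < t \<Longrightarrow> t < 1 / 3 \<Longrightarrow> edge_point a b t \<in> ON" "2 / 3 < t \<Longrightarrow> t < 1 \<Longrightarrow> edge_point a b t \<in> ON"
  unfolding ON_def by (intro CollectI exI[of _ t]; simp)+

lemma ends_in_ON: "{pa, pb} \<subseteq> ON"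
  unfolding ON_def by fastforce

lemma homotopic_toends: "homotopic_with (\<lambda>x. True) (subtopology function_space ON) (subtopology function_space ON) toends id"
proof (rule homotopic_with_blend)
  fix x :: "'v \<Rightarrow> real" and \<tau> :: real
  assume x: "x \<in> topspace (subtopology function_space ON)" and \<tau>: "0 \<le> \<tau>" "\<tau> \<le> 1"
  obtain t where t: "x = edge_point a b t" "0 < t" "t < 1" "t < 1 / 3 \<or> 2 / 3 < t" using x by (auto simp: ON_def)
  show "blend \<tau> (toends x) (id x) \<in> ON"
    using t(4)
  proof
    assume *: "t < 1 / 3"
    then have "(1 - \<tau>) *\<^sub>R (1 / 4) + \<tau> *\<^sub>R t \<in> {0<..<1 / 3::real}"
      using t \<tau> by (intro convexD) auto
    moreover have "blend \<tau> (toends x) (id x) = edge_point a b ((1 - \<tau>) * (1 / 4) + \<tau> * t)"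
      by (simp only: t(1) toends_edge(1)[OF *] blend_edge_point id_apply)
    ultimately show ?thesis by (simp only: edge_in_ON greaterThanLessThan_iff real_scaleR_def)
  next
    assume *: "2 / 3 < t"
    then have "(1 - \<tau>) *\<^sub>R (3 / 4) + \<tau> *\<^sub>R t \<in> {2 / 3<..<1::real}"
      using t \<tau> by (intro convexD) auto
    moreover have "blend \<tau> (toends x) (id x) = edge_point a b ((1 - \<tau>) * (3 / 4) + \<tau> * t)"
      by (simp only: t(1) toends_edge(2)[OF *] blend_edge_point id_apply)
    ultimately show ?thesis by (simp only: edge_in_ON greaterThanLessThan_iff real_scaleR_def)
  qed
qed (auto simp: continuous_toends continuous_map_from_subtopology)

lemma retraction_toends: "retraction_maps (subtopology function_space ON) (subtopology function_space {pa, pb}) toends id"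
  unfolding retraction_maps_def
  using continuous_toends toends_ON ends_in_ON toends_edge[of "1 / 4"] toends_edge[of "3 / 4"]
  by (auto simp: continuous_map_in_subtopology continuous_map_from_subtopology)

lemma pa_neq_pb: "pa \<noteq> pb"
proof
  assume "pa = pb"
  then have "pa b = pb b" by simp
  then show False by simp
qed

text \<open>\<open>Op\<close> is contractible and \<open>ON\<close> is homotopy equivalent to two
  points, whose reduced homology is the homology of one point.\<close>

lemma relative_homology_iso: "relative_homology_group p X' P \<cong> homology_group (p - 1) (subtopology function_space {pa})"
proof -
  have "relative_homology_group p X' P \<cong> relative_homology_group p (subtopology function_space Op) ON"
    using iso_stretch_excision is_isoI group.iso_sym by (metis group_relative_homology_group)
  also have "\<dots> \<cong> reduced_homology_group (p - 1) (subtopology (subtopology function_space Op) ON)"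
    by (rule isomorphic_group_relative_homology_of_contractible[OF contractible_Op])
      (use ends_in_ON ON_subset in auto)
  also have "subtopology (subtopology function_space Op) ON = subtopology function_space ON"
    using ON_subset by (simp add: subtopology_subtopology Int_absorb1)
  also have "reduced_homology_group (p - 1) (subtopology function_space ON) \<cong> reduced_homology_group (p - 1) (subtopology function_space {pa, pb})"
    by (intro homotopy_equivalent_space_imp_isomorphic_reduced_homology_groups
        deformation_retract_imp_homotopy_equivalent_space[OF homotopic_toends retraction_toends])
  also have "\<dots> \<cong> homology_group (p - 1) (subtopology function_space {pa})"
    by (rule reduced_homology_group_pair) (auto simp: pa_neq_pb t1_space_product_topology Hausdorff_imp_t1_space)
  finally show ?thesis .
qed

lemma relative_homology_1: "relative_homology_group 1 X' P \<cong> integer_group"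
proof -
  have "relative_homology_group 1 X' P \<cong> homology_group 0 (subtopology function_space {pa})"
    using relative_homology_iso[of 1] by simp
  also have "\<dots> \<cong> integer_group" by (rule homology_coefficients[of _ pa]) simp
  finally show ?thesis .
qed

lemma relative_homology_2: "trivial_group (relative_homology_group 2 X' P)"
proof -
  have "trivial_group (homology_group 1 (subtopology function_space {pa}))"
    by (rule homology_dimension_axiom[of _ pa]) auto
  then show ?thesis
    using relative_homology_iso[of 2] isomorphic_group_triviality[OF relative_homology_iso[of 2]] by simp
qed

end

section \<open>Effect of the new edge on first homology\<close>

context add_edge
begin

text \<open>The new edge is sent, by its parameter \<open>x b\<close>, along a path in
  \<open>P\<close> between its ends.\<close>

lemma P_retract:
  assumes "path_component_of (subtopology function_space P) (edge_point a b 0) (edge_point a b 1)"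
  shows "P retract_of_space X'"
proof -
  obtain g where g: "pathin (subtopology function_space P) g" "g 0 = edge_point a b 0" "g 1 = edge_point a b 1"
    using assms by (auto simp: path_component_of_def)
  \<comment> \<open>On \<open>P\<close> the left side is \<open>0\<close> and the right side
    nonnegative; inside the new edge the left side is positive and the right side \<open>0\<close>.
    Equality holds only at the two ends, where both clauses agree.\<close>
  let ?r = "\<lambda>x. if min (x a) (x b) \<le> 1 - x a - x b then x else g (x b)"
  have xb: "x b \<in> {0..1}" if "x \<in> P'" for x
    using that P_coords(1,2,4)[of x] by (auto simp: P'_eq Op_def)
  have "continuous_map X' (subtopology function_space P) ?r"
  proof (rule continuous_map_cases_le)
    show "continuous_map X' euclideanreal (\<lambda>x. min (x a) (x b))" "continuous_map X' euclideanreal (\<lambda>x. 1 - x a - x b)"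
      by (intro continuous_intros continuous_coord)+
    have sub: "x \<in> P" if "x \<in> P'" "min (x a) (x b) \<le> 1 - x a - x b" for x
      using that by (auto simp: P'_eq Op_def)
    then show "continuous_map (subtopology X' {x \<in> topspace X'. min (x a) (x b) \<le> 1 - x a - x b}) (subtopology function_space P) (\<lambda>x. x)"
      by (auto simp: continuous_map_in_subtopology subtopology_subtopology continuous_map_from_subtopology)
    have c: "continuous_map (subtopology X' {x \<in> topspace X'. 1 - x a - x b \<le> min (x a) (x b)}) (top_of_set {0..1}) (\<lambda>x. x b)"
      unfolding continuous_map_in_subtopology subtopology_subtopology using xb continuous_coord by auto
    show "continuous_map (subtopology X' {x \<in> topspace X'. 1 - x a - x b \<le> min (x a) (x b)}) (subtopology function_space P) (\<lambda>x. g (x b))"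
      using continuous_map_compose[OF c g(1)[unfolded pathin_def]] by (simp add: comp_def)
    fix x assume x: "x \<in> topspace X'" "min (x a) (x b) = 1 - x a - x b"
    then have "x \<in> P" using sub by auto
    then have "x a + x b = 1" using P_coords(1-3)[of x] x(2) by auto
    then have "x = edge_point a b 0 \<or> x = edge_point a b 1" using P_coords(5) \<open>x \<in> P\<close> by blast
    then show "x = g (x b)" using g by auto
  qed
  moreover have "subtopology X' P = subtopology function_space P"
    using P_subset by (simp add: subtopology_subtopology Int_absorb1)
  moreover have "?r x = x" if "x \<in> P" for x using P_coords(3,4)[OF that] P_coords(1,2)[OF that] by auto
  ultimately show ?thesis
    unfolding retract_of_space_def using P_subset by (intro conjI exI[of _ ?r]) auto
qed

lemma homology_connected:
  assumes "path_component_of (subtopology function_space P) (edge_point a b 0) (edge_point a b 1)"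
  shows "homology_group 1 X' \<cong> homology_group 1 (subtopology function_space P) \<times>\<times> relative_homology_group 1 X' P"
proof -
  have "subtopology X' P = subtopology function_space P"
    using P_subset by (simp add: subtopology_subtopology Int_absorb1)
  then show ?thesis
    using isomorphic_group_homology_group_prod_retract[OF disjI2[OF P_retract[OF assms]], of 1] by simp
qed

text \<open>\<open>A\<close> is a union of components with \<open>b\<close> but not
  \<open>a\<close>. The sum of coordinates over \<open>A\<close> is 0 or 1 on the old graph, so
  \<open>side\<close> separates the ends; after \<open>stretch\<close> it agrees with
  \<open>toends\<close> on \<open>ON\<close>, which is an isomorphism on homology. Hence
  \<open>stretch\<close> is injective on degree 0 homology of \<open>ON\<close>, and naturality
  transfers this to the boundary map.\<close>

lemma hom_boundary_inj:
  assumes A: "finite A" "b \<in> A" "a \<notin> A" "\<And>u w. {u, w} \<in> E \<Longrightarrow> u \<in> A \<longleftrightarrow> w \<in> A"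
  shows "inj_on (hom_boundary 1 X' P) (carrier (relative_homology_group 1 X' P))"
proof -
  let ?O = "subtopology function_space Op" and ?ON = "subtopology function_space ON" and ?P = "subtopology function_space P"
  let ?Q = "subtopology function_space {pa, pb}"
  have subO: "subtopology ?O ON = ?ON" using ON_subset by (simp add: subtopology_subtopology Int_absorb1)
  have subP: "subtopology X' P = ?P" using P_subset by (simp add: subtopology_subtopology Int_absorb1)
  define side where "side x = edge_point a b (1 / 4 + 1 / 2 * (\<Sum>v\<in>A. x v))" for x
  have side_sum: "(\<Sum>v\<in>A. x v) \<in> {0, 1}" if "x \<in> P" for x
    using simple that[unfolded P_def]
  proof (cases rule: graph_points_cases)
    case (vertex u)
    have "(\<Sum>v\<in>A. x v) = (\<Sum>v\<in>A. if v = u then 1 else 0)"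
      using vertex(2)[of u] by (intro sum.cong) (auto simp: edge_point_def)
    then show ?thesis using A(1) by simp
  next
    case (edge u w t)
    have "(\<Sum>v\<in>A. x v) = (\<Sum>v\<in>A. (if v = u then 1 - t else 0) + (if v = w then t else 0))"
      using edge by (intro sum.cong) (auto simp: edge_point_def)
    then show ?thesis using A(1) A(4)[OF edge(1)] by (simp add: sum.distrib)
  qed
  have side: "continuous_map ?P ?Q side"
    unfolding continuous_map_in_subtopology
  proof
    show "continuous_map ?P function_space side"
      unfolding side_def by (intro continuous_edge_point continuous_intros continuous_coord A(1))
    show "side \<in> topspace ?P \<rightarrow> {pa, pb}" using side_sum by (fastforce simp: side_def)
  qed
  have stretch_ON: "continuous_map ?ON ?P stretch"
    unfolding continuous_map_in_subtopology using continuous_stretch stretch_N N_eq by auto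
  have side_stretch: "(side \<circ> stretch) x = toends x" if x: "x \<in> topspace ?ON" for x
  proof -
    obtain t where t: "x = edge_point a b t" "0 < t" "t < 1" "t < 1 / 3 \<or> 2 / 3 < t" using x by (auto simp: ON_def)
    have s: "(\<Sum>v\<in>A. edge_point a b r v) = r" for r
    proof -
      have "(\<Sum>v\<in>A. edge_point a b r v) = (\<Sum>v\<in>A. if v = b then r else 0)"
        using A(3) by (intro sum.cong) (auto simp: edge_point_def)
      then show ?thesis using A(1,2) by simp
    qed
    show ?thesis
      using t(4) unfolding comp_def t(1) stretch_edge side_def s
      using t(2,3) by (auto simp: shift_edge toends_edge)
  qed
  have iso: "hom_induced 0 ?ON {} ?Q {} toends \<in> iso (homology_group 0 ?ON) (homology_group 0 ?Q)"
    by (rule deformation_retract_relative_homology_group_isomorphism[OF retraction_toends])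
      (use homotopic_toends in simp_all)
  have "hom_induced 0 ?P {} ?Q {} side \<circ> hom_induced 0 ?ON {} ?P {} stretch = hom_induced 0 ?ON {} ?Q {} toends"
    unfolding hom_induced_compose_empty[OF stretch_ON side, symmetric]
    by (rule hom_induced_eq) (rule side_stretch)
  then have inj0: "inj_on (hom_induced 0 ?ON {} ?P {} stretch) (carrier (homology_group 0 ?ON))"
    using iso by (metis (no_types, lifting) bij_betw_imp_inj_on inj_on_imageI2 iso_def mem_Collect_eq)
  have inj1: "inj_on (hom_boundary 1 ?O ON) (carrier (relative_homology_group 1 ?O ON))"
  proof -
    have "topspace ?O \<inter> ON \<noteq> {}" using ends_in_ON ON_subset by auto
    then show ?thesis
      using iso_relative_homology_of_contractible[OF contractible_Op, of ON 1] by (auto simp: iso_def bij_betw_def)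
  qed
  have "continuous_map ?O X' stretch"
    unfolding continuous_map_in_subtopology using continuous_stretch stretch_in_P' P'_eq by auto
  then have nat: "hom_boundary 1 X' P \<circ> stretch_iso 1 = hom_induced 0 ?ON {} ?P {} stretch \<circ> hom_boundary 1 ?O ON"
    using naturality_hom_induced[of ?O X' stretch ON P 1] stretch_N N_eq
    unfolding stretch_iso_def subO subP by auto
  have cb: "hom_boundary 1 ?O ON x \<in> carrier (homology_group 0 ?ON)" if "x \<in> carrier (relative_homology_group 1 ?O ON)" for x
    using hom_boundary_hom[of 1 ?O ON] that unfolding subO by (auto simp: hom_def)
  have inj: "inj_on (hom_boundary 1 X' P \<circ> stretch_iso 1) (carrier (relative_homology_group 1 ?O ON))"
    unfolding nat by (rule comp_inj_on[OF inj1 inj_on_subset[OF inj0]]) (use cb in auto)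
  have "carrier (relative_homology_group 1 X' P) = stretch_iso 1 ` carrier (relative_homology_group 1 ?O ON)"
    using iso_stretch_excision[of 1] by (auto simp: iso_def bij_betw_def)
  then show ?thesis using inj inj_on_imageI by metis
qed

text \<open>In the exact sequence of the pair the relative group of degree 2 is trivial and the
  boundary map out of the one of degree 1 is injective.\<close>

lemma homology_disconnected:
  assumes A: "finite A" "b \<in> A" "a \<notin> A" "\<And>u w. {u, w} \<in> E \<Longrightarrow> u \<in> A \<longleftrightarrow> w \<in> A"
  shows "homology_group 1 (subtopology function_space P) \<cong> homology_group 1 X'"
proof -
  let ?P = "subtopology function_space P"
  let ?i = "hom_induced 1 ?P {} X' {} id" and ?j = "hom_induced 1 X' {} X' P id"
  have subP: "subtopology X' P = ?P" using P_subset by (simp add: subtopology_subtopology Int_absorb1)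
  note ex1 = homology_exactness_axiom_1[of 1 X' P, unfolded subP]
  note ex2 = homology_exactness_axiom_2[of 2 X' P, unfolded subP]
  note ex3 = homology_exactness_axiom_3[of 1 X' P, unfolded subP]
  interpret i: group_hom "homology_group 1 ?P" "homology_group 1 X'" ?i
    by (simp add: group_hom_def group_hom_axioms_def hom_induced_hom)
  interpret d: group_hom "relative_homology_group 1 X' P" "homology_group 0 ?P" "hom_boundary 1 X' P"
    using hom_boundary_hom[of 1 X' P] by (simp add: group_hom_def group_hom_axioms_def subP)
  have "kernel (homology_group 1 ?P) (homology_group 1 X') ?i = hom_boundary 2 X' P ` carrier (relative_homology_group 2 X' P)"
    using ex2 by simp
  also have "\<dots> = {\<one>\<^bsub>homology_group 1 ?P\<^esub>}"
  proof -
    have "hom_boundary 2 X' P \<in> hom (relative_homology_group 2 X' P) (homology_group 1 ?P)"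
      using hom_boundary_hom[of 2 X' P] by (simp add: subP)
    then have "hom_boundary 2 X' P \<one>\<^bsub>relative_homology_group 2 X' P\<^esub> = \<one>\<^bsub>homology_group 1 ?P\<^esub>"
      by (rule hom_one) simp_all
    moreover have "carrier (relative_homology_group 2 X' P) = {\<one>\<^bsub>relative_homology_group 2 X' P\<^esub>}"
      using relative_homology_2 by (simp add: trivial_group_def)
    ultimately show ?thesis by (simp only: image_insert image_empty)
  qed
  finally have "inj_on ?i (carrier (homology_group 1 ?P))" using i.trivial_ker_imp_inj by blast
  moreover have "?i ` carrier (homology_group 1 ?P) = carrier (homology_group 1 X')"
  proof -
    have "?j ` carrier (homology_group 1 X') = kernel (relative_homology_group 1 X' P) (homology_group 0 ?P) (hom_boundary 1 X' P)"
      using ex1 by simp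
    also have "\<dots> = {\<one>\<^bsub>relative_homology_group 1 X' P\<^esub>}"
      using d.inj_iff_trivial_ker hom_boundary_inj[OF A] by blast
    finally have "?j x = \<one>\<^bsub>relative_homology_group 1 X' P\<^esub>" if "x \<in> carrier (homology_group 1 X')" for x
      using that by blast
    then have "kernel (homology_group 1 X') (relative_homology_group 1 X' P) ?j = carrier (homology_group 1 X')"
      by (auto simp: kernel_def)
    then show ?thesis using ex3 by simp
  qed
  ultimately have "?i \<in> iso (homology_group 1 ?P) (homology_group 1 X')"
    using i.homh by (auto simp: iso_def bij_betw_def)
  then show ?thesis by (rule is_isoI)
qed

end

section \<open>Homology of a finite graph by induction on the edges\<close>

lemma homology_no_edges:
  assumes "finite V"
  shows "trivial_group (homology_group 1 (graph_realization V {}))"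
proof -
  let ?Q = "graph_points V {}" and ?X = "graph_realization V {}"
  have "simple_graph V {}" by (simp add: simple_graph_def)
  then have "?Q \<subseteq> (\<lambda>u. edge_point u u 0) ` V"
    by (auto elim!: graph_points_cases)
  then have fin: "finite ?Q" using assms finite_subset by blast
  have X: "?X = discrete_topology ?Q"
    unfolding graph_realization_eq
    using subtopology_eq_discrete_topology_finite[of function_space ?Q] fin
    by (simp add: t1_space_product_topology Hausdorff_imp_t1_space)
  let ?U = "(\<lambda>x. {x}) ` ?Q"
  have iso: "sum_group ?U (\<lambda>S. homology_group 1 (subtopology ?X S)) \<cong> homology_group 1 ?X"
    by (rule is_isoI, rule homology_additivity_axiom) (auto simp: X pairwise_def disjnt_def)
  have "trivial_group (homology_group 1 (subtopology ?X S))" if "S \<in> ?U" for S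
    using that by (auto simp: X intro!: homology_dimension_axiom)
  then have "trivial_group (sum_group ?U (\<lambda>S. homology_group 1 (subtopology ?X S)))"
    by (intro group.trivial_group_alt[THEN iffD2] exI[of _ "\<lambda>S\<in>?U. \<one>\<^bsub>homology_group 1 (subtopology ?X S)\<^esub>"])
      (auto simp: carrier_sum_group trivial_group_def PiE_iff extensional_def fun_eq_iff)
  then show ?thesis using isomorphic_group_triviality[OF iso] by simp
qed

text \<open>\<open>T\<close> collects the edges whose ends were already connected when they were
  inserted, so \<open>E - T\<close> is a spanning forest. The clauses on functions say that on the
  forest every edge function is a coboundary, and that the forest has the same components as the
  graph.\<close>

theorem graph_homology_rank:
  assumes V: "finite V" and "finite E" "simple_graph V E"
  shows "\<exists>T\<subseteq>E. free_rank (homology_group 1 (graph_realization V E)) (card T)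
    \<and> (\<forall>g :: 'v set \<Rightarrow> bit. \<exists>h. \<forall>u w. {u, w} \<in> E - T \<longrightarrow> h u + h w = g {u, w})
    \<and> (\<forall>h :: 'v \<Rightarrow> bit. (\<forall>u w. {u, w} \<in> E - T \<longrightarrow> h u = h w) \<longrightarrow> (\<forall>u w. {u, w} \<in> E \<longrightarrow> h u = h w))"
  using assms(2,3)
proof (induction E rule: finite_induct)
  case empty
  show ?case using free_rank_trivial[OF _ homology_no_edges[OF V]] by auto
next
  case (insert e E)
  obtain a b where e: "e = {a, b}" and ab: "a \<in> V" "b \<in> V" "a \<noteq> b"
    using insert(4) by (auto simp: simple_graph_def)
  have simple: "simple_graph V E" using insert(4) by (simp add: simple_graph_def)
  interpret add_edge V E a b
    using simple ab insert(2) e by unfold_locales auto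
  have real: "graph_realization V E = subtopology function_space P" "graph_realization V (insert e E) = X'"
    by (simp_all add: graph_realization_eq P_def P'_def e)
  obtain T where T: "T \<subseteq> E" "free_rank (homology_group 1 (subtopology function_space P)) (card T)"
    and span: "\<And>g :: 'v set \<Rightarrow> bit. \<exists>h. \<forall>u w. {u, w} \<in> E - T \<longrightarrow> h u + h w = g {u, w}"
    and const: "\<And>h :: 'v \<Rightarrow> bit. (\<forall>u w. {u, w} \<in> E - T \<longrightarrow> h u = h w) \<Longrightarrow> (\<forall>u w. {u, w} \<in> E \<longrightarrow> h u = h w)"
    using insert(3)[OF simple] unfolding real by blast
  have finT: "finite T" using T(1) insert(1) finite_subset by blast
  have eT: "e \<notin> T" using T(1) insert(2) by blast
  define conn where "conn = {(u, w). {u, w} \<in> E}\<^sup>*"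
  show ?case
  proof (cases "(b, a) \<in> conn")
    case True
    have edge_ne: "u \<noteq> w" if "{u, w} \<in> E" for u w using simple that by (auto simp: simple_graph_def doubleton_eq_iff)
    have path: "path_component_of (subtopology function_space P) (edge_point a a 0) (edge_point u a 0)" if "(u, a) \<in> conn" for u
      using that unfolding conn_def
    proof (induction rule: converse_rtrancl_induct)
      case base
      show ?case unfolding path_component_of_refl P_def using ab by (auto intro: vertex_in_graph_points)
    next
      case (step u w)
      then have "{w, u} \<in> E" by (auto simp: insert_commute)
      from path_component_of_edge[OF simple this edge_ne[OF this], of a]
      have "path_component_of (subtopology function_space P) (edge_point w a 0) (edge_point u a 0)"
        unfolding real(1) .
      with step(3) show ?case by (rule path_component_of_trans)
    qed
    have "path_component_of (subtopology function_space P) (edge_point a b 0) (edge_point a b 1)"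
      using path[OF True] by (simp add: edge_point_0[of a a b] edge_point_1[OF ab(3), of a])
    from homology_connected[OF this]
    have rank: "free_rank (homology_group 1 X') (Suc (card T))"
      using free_rank_iso[OF free_rank_DirProd_int[OF T(2) _ relative_homology_1]] group.iso_sym
      by (metis group_relative_homology_group)
    have card: "card (insert e T) = Suc (card T)" using finT eT by simp
    have diff: "insert e E - insert e T = E - T" using insert(2) eT by blast
    have const': "\<forall>u w. {u, w} \<in> insert e E \<longrightarrow> h u = h w"
      if "\<forall>u w. {u, w} \<in> E - T \<longrightarrow> h u = h w" for h :: "'v \<Rightarrow> bit"
    proof -
      have E: "h u = h w" if "{u, w} \<in> E" for u w using const[OF \<open>\<forall>u w. _ \<longrightarrow> _\<close>] that by blast
      have "h u = h a" if "(u, a) \<in> conn" for u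
        using that unfolding conn_def by (induction rule: converse_rtrancl_induct) (auto dest: E)
      then have "h b = h a" using True by blast
      then show ?thesis using E by (auto simp: e doubleton_eq_iff)
    qed
    show ?thesis
      unfolding real
    proof (intro exI[of _ "insert e T"] conjI)
      show "insert e T \<subseteq> insert e E" using T(1) by blast
      show "free_rank (homology_group 1 X') (card (insert e T))" unfolding card by (rule rank)
      show "\<forall>g :: 'v set \<Rightarrow> bit. \<exists>h. \<forall>u w. {u, w} \<in> insert e E - insert e T \<longrightarrow> h u + h w = g {u, w}"
        unfolding diff by (rule allI, rule span)
      show "\<forall>h :: 'v \<Rightarrow> bit. (\<forall>u w. {u, w} \<in> insert e E - insert e T \<longrightarrow> h u = h w)
          \<longrightarrow> (\<forall>u w. {u, w} \<in> insert e E \<longrightarrow> h u = h w)"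
        unfolding diff by (rule allI, rule impI, rule const')
    qed
  next
    case False
    define A where "A = {w. (b, w) \<in> conn}"
    have bA: "b \<in> A" by (simp add: A_def conn_def)
    have aA: "a \<notin> A" using False by (simp add: A_def)
    have EA: "u \<in> A \<longleftrightarrow> w \<in> A" if "{u, w} \<in> E" for u w
    proof -
      have "(u, w) \<in> {(u, w). {u, w} \<in> E}" "(w, u) \<in> {(u, w). {u, w} \<in> E}" using that by (auto simp: insert_commute)
      then show ?thesis unfolding A_def conn_def by (auto intro: rtrancl.rtrancl_into_rtrancl)
    qed
    have "A \<subseteq> V"
    proof
      fix w assume "w \<in> A"
      then have "(b, w) \<in> conn" by (simp add: A_def)
      then show "w \<in> V"
        unfolding conn_def using ab
        by (induction rule: rtrancl_induct) (use simple in \<open>auto simp: simple_graph_def doubleton_eq_iff\<close>)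
    qed
    then have "finite A" using V finite_subset by blast
    from homology_disconnected[OF this bA aA EA]
    have rank: "free_rank (homology_group 1 X') (card T)"
      using free_rank_iso[OF T(2)] by (metis group_relative_homology_group)
    have span': "\<exists>h. \<forall>u w. {u, w} \<in> insert e E - T \<longrightarrow> h u + h w = g {u, w}" for g :: "'v set \<Rightarrow> bit"
    proof -
      obtain h where h: "\<And>u w. {u, w} \<in> E - T \<Longrightarrow> h u + h w = g {u, w}" using span by blast
      \<comment> \<open>A constant added on the component \<open>A\<close> of \<open>b\<close>
        leaves the sums over old edges alone and corrects the one over the new edge.\<close>
      define c where "c = h a + h b + g e"
      define h' where "h' v = h v + (if v \<in> A then c else 0)" for v
      have "h' u + h' w = g {u, w}" if "{u, w} \<in> E - T" for u w
        using h[OF that] EA[of u w] that by (auto simp: h'_def ac_simps)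
      moreover have "h' a + h' b = g {a, b}" using aA bA by (simp add: h'_def c_def e ac_simps)
      ultimately have "\<forall>u w. {u, w} \<in> insert e E - T \<longrightarrow> h' u + h' w = g {u, w}"
        by (auto simp: e doubleton_eq_iff add.commute insert_commute)
      then show ?thesis by blast
    qed
    have const': "\<forall>u w. {u, w} \<in> insert e E \<longrightarrow> h u = h w"
      if "\<forall>u w. {u, w} \<in> insert e E - T \<longrightarrow> h u = h w" for h :: "'v \<Rightarrow> bit"
      using const[of h] that eT by blast
    show ?thesis
      unfolding real
    proof (intro exI[of _ T] conjI)
      show "T \<subseteq> insert e E" using T(1) by blast
      show "free_rank (homology_group 1 X') (card T)" by (rule rank)
      show "\<forall>g :: 'v set \<Rightarrow> bit. \<exists>h. \<forall>u w. {u, w} \<in> insert e E - T \<longrightarrow> h u + h w = g {u, w}"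
        by (rule allI, rule span')
      show "\<forall>h :: 'v \<Rightarrow> bit. (\<forall>u w. {u, w} \<in> insert e E - T \<longrightarrow> h u = h w)
          \<longrightarrow> (\<forall>u w. {u, w} \<in> insert e E \<longrightarrow> h u = h w)"
        by (rule allI, rule impI, rule const')
    qed
  qed
qed

section \<open>The second homology of an Artin group\<close>

lemma sum_indicator:
  fixes c :: "'i set \<Rightarrow> bit"
  assumes "finite I" "i \<in> I" "p \<in> i" "\<And>j. j \<in> I \<Longrightarrow> p \<in> j \<Longrightarrow> j = i"
  shows "(\<Sum>j\<in>I. c j * of_bool (p \<in> j)) = c i"
proof -
  have "(\<Sum>j\<in>I. c j * of_bool (p \<in> j)) = (\<Sum>j\<in>I. if j = i then c j else 0)"
  proof (rule sum.cong[OF HOL.refl])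
    fix j assume "j \<in> I"
    then have "p \<in> j \<longleftrightarrow> j = i" using assms(3) assms(4)[of j] by blast
    then show "c j * of_bool (p \<in> j) = (if j = i then c j else 0)" by simp
  qed
  then show ?thesis using assms(1,2) by simp
qed

section \<open>Pairs of generators and the index set of the basis\<close>

context coxeter
begin

definition even_pairs :: "'s set set" where
  "even_pairs = {{s, t} | s t. s \<in> S \<and> t \<in> S \<and> 4 \<le> m s t \<and> even_label (m s t)}"

lemma label_2: "s \<in> S \<Longrightarrow> m s t = 2 \<Longrightarrow> s \<noteq> t"
  using m_self[of s] by auto

lemma commuting_pairs_iff:
  assumes "s \<in> S" "t \<in> S" shows "{s, t} \<in> commuting_pairs S m \<longleftrightarrow> m s t = 2"
  unfolding commuting_pairs_def using assms m_sym by (auto simp: doubleton_eq_iff)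

lemma even_pairs_iff:
  assumes "s \<in> S" "t \<in> S" shows "{s, t} \<in> even_pairs \<longleftrightarrow> 4 \<le> m s t \<and> even_label (m s t)"
proof
  assume "{s, t} \<in> even_pairs"
  then obtain s' t' where "{s, t} = {s', t'}" "s' \<in> S" "t' \<in> S" "4 \<le> m s' t'" "even_label (m s' t')"
    unfolding even_pairs_def by blast
  then show "4 \<le> m s t \<and> even_label (m s t)" using m_sym by (auto simp: doubleton_eq_iff)
qed (use assms in \<open>auto simp: even_pairs_def\<close>)

lemma odd_edges_iff:
  assumes "s \<in> S" "t \<in> S" shows "{s, t} \<in> odd_edges S m \<longleftrightarrow> s \<noteq> t \<and> odd_label (m s t)"
proof
  assume "{s, t} \<in> odd_edges S m"
  then obtain s' t' where "{s, t} = {s', t'}" "s' \<in> S" "t' \<in> S" "s' \<noteq> t'" "odd_label (m s' t')"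
    unfolding odd_edges_def by blast
  then show "s \<noteq> t \<and> odd_label (m s t)" using m_sym by (auto simp: doubleton_eq_iff)
qed (use assms in \<open>auto simp: odd_edges_def\<close>)

lemma pairE:
  assumes "p \<in> commuting_pairs S m \<union> even_pairs \<union> odd_edges S m"
  obtains s t where "p = {s, t}" "s \<in> S" "t \<in> S"
  using assms unfolding commuting_pairs_def even_pairs_def odd_edges_def by blast

lemma not_odd_label_2 [simp]: "\<not> odd_label 2"
  by (auto simp: odd_label_def numeral_eq_enat)

lemma pairs_disjoint:
  "commuting_pairs S m \<inter> even_pairs = {}" "commuting_pairs S m \<inter> odd_edges S m = {}"
  "even_pairs \<inter> odd_edges S m = {}"
proof -
  have "\<not> (p \<in> commuting_pairs S m \<and> p \<in> even_pairs) \<and> \<not> (p \<in> commuting_pairs S m \<and> p \<in> odd_edges S m)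
    \<and> \<not> (p \<in> even_pairs \<and> p \<in> odd_edges S m)" for p
  proof (cases "p \<in> commuting_pairs S m \<union> even_pairs \<union> odd_edges S m")
    case True
    then obtain s t where st: "p = {s, t}" "s \<in> S" "t \<in> S" by (rule pairE)
    show ?thesis
      unfolding st(1) commuting_pairs_iff[OF st(2,3)] even_pairs_iff[OF st(2,3)] odd_edges_iff[OF st(2,3)]
      by (auto simp: even_label_def odd_label_def numeral_eq_enat)
  qed auto
  then show "commuting_pairs S m \<inter> even_pairs = {}" "commuting_pairs S m \<inter> odd_edges S m = {}"
    "even_pairs \<inter> odd_edges S m = {}" by blast+
qed

lemma pair_cases:
  assumes st: "s \<in> S" "t \<in> S" "s \<noteq> t" and k: "m s t = enat k"
  obtains (commuting) "{s, t} \<in> commuting_pairs S m" "even k"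
    | (even) "{s, t} \<in> even_pairs" "even k"
    | (odd) "{s, t} \<in> odd_edges S m" "odd k"
proof -
  have "k = 2 \<or> (even k \<and> 4 \<le> k) \<or> odd k" using m_enat_ge2[OF st k] by presburger
  then show thesis
    using that commuting_pairs_iff[OF st(1,2)] even_pairs_iff[OF st(1,2)] odd_edges_iff[OF st(1,2)] st(3) k
    by (auto simp: even_label_def odd_label_def numeral_eq_enat)
qed

lemma finite_pairs:
  "finite (commuting_pairs S m)" "finite even_pairs" "finite (odd_edges S m)"
  by (rule finite_subset[of _ "Pow S"]; use finite_S in \<open>auto simp: commuting_pairs_def even_pairs_def odd_edges_def\<close>)+

lemma simple_graph_odd: "simple_graph S (odd_edges S m)"
  by (auto simp: simple_graph_def odd_edges_def)

lemma equiv_pair_equiv: "equiv (commuting_pairs S m) (pair_equiv S m)"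
proof (rule equivI)
  let ?r = "(pair_step S m \<union> (pair_step S m)\<inverse>)\<^sup>*"
  have s: "sym ?r" by (rule sym_rtrancl) (auto simp: sym_def)
  show "pair_equiv S m \<subseteq> commuting_pairs S m \<times> commuting_pairs S m" by (auto simp: pair_equiv_def)
  show "refl_on (commuting_pairs S m) (pair_equiv S m)" by (auto simp: refl_on_def pair_equiv_def)
  show "sym (pair_equiv S m)" using s by (auto simp: sym_def pair_equiv_def)
  show "trans (pair_equiv S m)"
    unfolding pair_equiv_def trans_def by (auto intro: rtrancl_trans)
qed

lemma pair_equiv_invariant:
  fixes D :: "'s set \<Rightarrow> bit"
  assumes D: "admissible D" and "(p, q) \<in> pair_equiv S m"
  shows "D p = D q"
proof -
  have step: "D p = D q" if pq: "(p, q) \<in> pair_step S m" for p q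
  proof -
    obtain s t t' where p: "p = {s, t}" "q = {s, t'}" "{s, t} \<in> commuting_pairs S m" "{s, t'} \<in> commuting_pairs S m"
      "odd_label (m t t')"
      using pq unfolding pair_step_def by blast
    then have "s \<in> S" "t \<in> S" "t' \<in> S" by (auto simp: commuting_pairs_def doubleton_eq_iff)
    then show ?thesis using admissibleD[OF D] p commuting_pairs_iff by blast
  qed
  have "(p, q) \<in> (pair_step S m \<union> (pair_step S m)\<inverse>)\<^sup>*" using assms(2) by (simp add: pair_equiv_def)
  then show ?thesis by (induction rule: rtrancl_induct) (auto dest: step)
qed

text \<open>Every index is a set of pairs: a class of commuting pairs, or a singleton for any other
  pair that contributes. The indices are disjoint, and their indicator functions are the sign
  functions to be realised by basis cocycles.\<close>

definition index_set :: "'s set set \<Rightarrow> 's set set set" where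
  "index_set T = commuting_pairs S m // pair_equiv S m \<union> (\<lambda>p. {p}) ` (even_pairs \<union> T)"

lemma index_set_unique:
  assumes T: "T \<subseteq> odd_edges S m" and "i \<in> index_set T" "j \<in> index_set T" "p \<in> i" "p \<in> j"
  shows "i = j"
proof -
  have sub: "i \<subseteq> commuting_pairs S m" if "i \<in> commuting_pairs S m // pair_equiv S m" for i
    using Union_quotient[OF equiv_pair_equiv] that by blast
  have "(even_pairs \<union> T) \<inter> commuting_pairs S m = {}" using pairs_disjoint T by blast
  then show ?thesis
    using assms(2-5) sub quotient_disj[OF equiv_pair_equiv, of i j] unfolding index_set_def by blast
qed

lemma index_setE:
  assumes "i \<in> index_set T"
  obtains p where "p \<in> i" "p \<in> commuting_pairs S m \<union> even_pairs \<union> T"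
proof -
  consider "i \<in> commuting_pairs S m // pair_equiv S m" | p where "p \<in> even_pairs \<union> T" "i = {p}"
    using assms unfolding index_set_def by blast
  then show thesis
  proof cases
    case 1
    then have "i \<noteq> {}" "i \<subseteq> commuting_pairs S m"
      using in_quotient_imp_non_empty[OF equiv_pair_equiv] in_quotient_imp_subset[OF equiv_pair_equiv] by auto
    then show thesis using that by blast
  qed (use that in blast)
qed

lemma finite_index_set: "T \<subseteq> odd_edges S m \<Longrightarrow> finite (index_set T)"
  unfolding index_set_def using finite_pairs finite_quotient[OF finite_pairs(1)] equiv_pair_equiv
  by (auto simp: pair_equiv_def intro: finite_subset)

lemma card_index_set:
  assumes T: "T \<subseteq> odd_edges S m"
  shows "card (index_set T) = p_num S m + q1_num S m + q2_num S m + card T"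
proof -
  let ?C = "commuting_pairs S m // pair_equiv S m"
  have finC: "finite ?C" using finite_index_set[OF T] unfolding index_set_def by simp
  have finT: "finite T" using T finite_pairs(3) finite_subset by blast
  \<comment> \<open>With coefficients in Z_2 torsion and non-torsion classes count alike; both
    numbers together count all classes.\<close>
  have "?C = {C \<in> ?C. torsion_class S m C} \<union> {C \<in> ?C. \<not> torsion_class S m C}" by blast
  then have "card ?C = p_num S m + q1_num S m"
    unfolding p_num_def q1_num_def using finC by (subst card_Un_disjoint[symmetric]) auto
  moreover have "card ((\<lambda>p. {p}) ` (even_pairs \<union> T)) = q2_num S m + card T"
  proof -
    have "card (even_pairs \<union> T) = card even_pairs + card T"
      using finite_pairs(2) finT pairs_disjoint(3) T by (intro card_Un_disjoint) auto
    moreover have "card even_pairs = q2_num S m" by (simp add: even_pairs_def q2_num_def)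
    ultimately show ?thesis by (simp add: card_image inj_on_def)
  qed
  moreover have "?C \<inter> (\<lambda>p. {p}) ` (even_pairs \<union> T) = {}"
  proof -
    have "i \<subseteq> commuting_pairs S m" if "i \<in> ?C" for i
      using in_quotient_imp_subset[OF equiv_pair_equiv that] .
    then show ?thesis using pairs_disjoint T by blast
  qed
  ultimately show ?thesis
    unfolding index_set_def using finC finite_pairs(2) finT by (subst card_Un_disjoint) auto
qed

text \<open>A class is closed under \<open>pair_step\<close>, and a singleton index contains no
  commuting pair, so its indicator is \<open>0\<close> at both pairs.\<close>

lemma admissible_index:
  assumes T: "T \<subseteq> odd_edges S m" and i: "i \<in> index_set T"
  shows "admissible (\<lambda>p. of_bool (p \<in> i))"
  unfolding admissible_def
proof (intro ballI impI)
  fix s t t' assume st: "s \<in> S" "t \<in> S" "t' \<in> S" "m s t = 2" "m s t' = 2" "odd_label (m t t')"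
  then have c: "{s, t} \<in> commuting_pairs S m" "{s, t'} \<in> commuting_pairs S m" by (simp_all add: commuting_pairs_iff)
  then have "({s, t}, {s, t'}) \<in> pair_step S m" using st unfolding pair_step_def by blast
  then have e: "({s, t}, {s, t'}) \<in> pair_equiv S m" using c unfolding pair_equiv_def by auto
  have "{s, t} \<in> i \<longleftrightarrow> {s, t'} \<in> i"
  proof (cases "i \<in> commuting_pairs S m // pair_equiv S m")
    case True
    then show ?thesis
      using in_quotient_imp_closed[OF equiv_pair_equiv True _ e] e
        in_quotient_imp_closed[OF equiv_pair_equiv True, of "{s, t'}" "{s, t}"] equivE[OF equiv_pair_equiv] symD by metis
  next
    case False
    then have "i \<inter> commuting_pairs S m = {}" using i pairs_disjoint T unfolding index_set_def by blast
    then show ?thesis using c by blast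
  qed
  then show "(of_bool ({s, t} \<in> i) :: bit) = of_bool ({s, t'} \<in> i)" by simp
qed

lemma sum_index_set:
  fixes c :: "'s set set \<Rightarrow> bit"
  assumes T: "T \<subseteq> odd_edges S m" and "i \<in> index_set T" "p \<in> i"
  shows "(\<Sum>j\<in>index_set T. c j * of_bool (p \<in> j)) = c i"
  using sum_indicator[OF finite_index_set[OF T] assms(2,3)] index_set_unique[OF T _ assms(2) _ assms(3)] by blast

lemma sum_index_set_other:
  fixes c :: "'s set set \<Rightarrow> bit"
  assumes T: "T \<subseteq> odd_edges S m" and p: "p \<in> odd_edges S m - T"
  shows "(\<Sum>j\<in>index_set T. c j * of_bool (p \<in> j)) = 0"
proof (rule sum.neutral, rule ballI)
  fix j assume "j \<in> index_set T"
  have "p \<notin> j"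
  proof
    assume "p \<in> j"
    then have "p \<in> commuting_pairs S m \<union> even_pairs \<union> T"
      using \<open>j \<in> index_set T\<close> in_quotient_imp_subset[OF equiv_pair_equiv] unfolding index_set_def by blast
    then show False using p pairs_disjoint by blast
  qed
  then show "c j * of_bool (p \<in> j) = 0" by simp
qed

section \<open>The isomorphism\<close>

lemma disc_sym:
  assumes "s \<in> S" "t \<in> S" shows "disc f s t = disc f t s"
proof (cases "m t s")
  case (enat k)
  then have "m s t = enat k" using m_sym[OF assms] by simp
  with enat show ?thesis by (simp add: disc_def)
next
  case infinity
  then have "m s t = \<infinity>" using m_sym[OF assms] by simp
  with infinity show ?thesis by (simp add: disc_def)
qed

lemma second_homology_artin:
  "group_homology TYPE(bit) 2 (artin_group S m) \<cong> product_group {..<p_num S m + q_num S m} (\<lambda>_. integer_mod_group 2)"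
proof -
  let ?E = "odd_edges S m"
  obtain T where T: "T \<subseteq> ?E"
    and rank: "free_rank (homology_group 1 (graph_realization S ?E)) (card T)"
    and span: "\<forall>g :: 's set \<Rightarrow> bit. \<exists>h. \<forall>u w. {u, w} \<in> ?E - T \<longrightarrow> h u + h w = g {u, w}"
    and const: "\<forall>h :: 's \<Rightarrow> bit. (\<forall>u w. {u, w} \<in> ?E - T \<longrightarrow> h u = h w) \<longrightarrow> (\<forall>u w. {u, w} \<in> ?E \<longrightarrow> h u = h w)"
    using graph_homology_rank[OF finite_S finite_pairs(3) simple_graph_odd]
    by (elim exE conjE) (rule that)
  let ?I = "index_set T"
  have "\<forall>i\<in>?I. \<exists>fe. cocycle (artin_group S m) (fst fe) \<and> (\<forall>s t k. s \<in> S \<longrightarrow> t \<in> S \<longrightarrow> s \<noteq> t \<longrightarrow> m s t = enat k \<longrightarrow>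
      disc (fst fe) s t = of_bool ({s, t} \<in> i) + (if odd k then snd fe s + snd fe t else 0))"
  proof
    fix i assume "i \<in> ?I"
    from exists_cocycle[OF admissible_index[OF T this]] obtain f e where "cocycle (artin_group S m) f"
      "\<And>s t k. \<lbrakk>s \<in> S; t \<in> S; s \<noteq> t; m s t = enat k\<rbrakk> \<Longrightarrow> disc f s t = of_bool ({s, t} \<in> i) + (if odd k then e s + e t else 0)"
      by blast
    then show "\<exists>fe. cocycle (artin_group S m) (fst fe) \<and> (\<forall>s t k. s \<in> S \<longrightarrow> t \<in> S \<longrightarrow> s \<noteq> t \<longrightarrow> m s t = enat k \<longrightarrow>
      disc (fst fe) s t = of_bool ({s, t} \<in> i) + (if odd k then snd fe s + snd fe t else 0))"
      by (intro exI[of _ "(f, e)"]) simp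
  qed
  then obtain fe where fe: "\<forall>i\<in>?I. cocycle (artin_group S m) (fst (fe i)) \<and> (\<forall>s t k. s \<in> S \<longrightarrow> t \<in> S \<longrightarrow> s \<noteq> t \<longrightarrow> m s t = enat k \<longrightarrow>
      disc (fst (fe i)) s t = of_bool ({s, t} \<in> i) + (if odd k then snd (fe i) s + snd (fe i) t else 0))"
    by (rule bchoice[THEN exE])
  define F where "F i = fst (fe i)" for i
  define e where "e i = snd (fe i)" for i
  have F: "cocycle (artin_group S m) (F i)" if "i \<in> ?I" for i using fe that by (simp add: F_def)
  have discF: "disc (\<lambda>g h. \<Sum>i\<in>?I. c i * F i g h) s t
      = (\<Sum>i\<in>?I. c i * of_bool ({s, t} \<in> i)) + (if odd k then (\<Sum>i\<in>?I. c i * e i s) + (\<Sum>i\<in>?I. c i * e i t) else 0)"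
    if st: "s \<in> S" "t \<in> S" "s \<noteq> t" "m s t = enat k" for c s t k
  proof -
    have "disc (F i) s t = of_bool ({s, t} \<in> i) + (if odd k then e i s + e i t else 0)" if "i \<in> ?I" for i
      using fe st that unfolding F_def e_def by blast
    then have "disc (\<lambda>g h. \<Sum>i\<in>?I. c i * F i g h) s t
        = (\<Sum>i\<in>?I. c i * (of_bool ({s, t} \<in> i) + (if odd k then e i s + e i t else 0)))"
      unfolding disc_sum by (intro sum.cong) simp_all
    then show ?thesis by (simp add: distrib_left sum.distrib)
  qed
  have grp: "group (artin_group S m)" unfolding artin_group_def by (rule group_presented_group)
  have "group_homology TYPE(bit) 2 (artin_group S m) \<cong> product_group {..<card ?I} (\<lambda>_. integer_mod_group 2)"
  proof (rule second_homology_iso[OF grp finite_index_set[OF T] F])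
    fix f assume f: "cocycle (artin_group S m) f"
    \<comment> \<open>The signs of \<open>f\<close> as a function of unordered pairs:
      \<open>q\<close> is some ordering of the pair, immaterial by \<open>disc_sym\<close>.\<close>
    define D where "D p = (let q = SOME q. p = {fst q, snd q} in disc f (fst q) (snd q))" for p
    have D: "D {s, t} = disc f s t" if "s \<in> S" "t \<in> S" for s t
    proof -
      define q where "q = (SOME q. {s, t} = {fst q, snd q})"
      have "{s, t} = {fst q, snd q}" unfolding q_def by (rule someI[of _ "(s, t)"]) simp
      then have "(fst q = s \<and> snd q = t) \<or> (fst q = t \<and> snd q = s)" unfolding doubleton_eq_iff by blast
      moreover have "D {s, t} = disc f (fst q) (snd q)" by (simp only: D_def Let_def q_def)
      ultimately show ?thesis using disc_sym[OF that] by auto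
    qed
    have admD: "admissible D"
      unfolding admissible_def using D disc_admissible[OF f] by simp
    obtain h where h: "\<And>u w. {u, w} \<in> ?E - T \<Longrightarrow> h u + h w = D {u, w}" using span[THEN spec, of D] by blast
    \<comment> \<open>\<open>h\<close> matches \<open>D\<close> on the forest but need not do so on
      \<open>T\<close>; there the coefficient records the defect, with \<open>sum h p\<close> equal
      to \<open>h s + h t\<close>.\<close>
    define c where "c i = (let p = SOME p. p \<in> i in D p + (if p \<in> ?E then sum h p else 0))" for i
    have main: "D {s, t} + (\<Sum>i\<in>?I. c i * of_bool ({s, t} \<in> i)) = (if odd k then h s + h t else 0)"
      if st: "s \<in> S" "t \<in> S" "s \<noteq> t" "m s t = enat k" for s t k
      using st
    proof (cases rule: pair_cases)
      case commuting
      define i where "i = pair_equiv S m `` {{s, t}}"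
      have i: "i \<in> commuting_pairs S m // pair_equiv S m" unfolding i_def using commuting(1) by (rule quotientI)
      have st_i: "{s, t} \<in> i" unfolding i_def using equiv_class_self[OF equiv_pair_equiv commuting(1)] .
      have p: "(SOME p. p \<in> i) \<in> i" using st_i by (rule someI)
      then have "D {s, t} = D (SOME p. p \<in> i)" using pair_equiv_invariant[OF admD] unfolding i_def by blast
      moreover have "(SOME p. p \<in> i) \<notin> ?E"
        using p in_quotient_imp_subset[OF equiv_pair_equiv i] pairs_disjoint(2) by blast
      ultimately have "c i = D {s, t}" by (simp add: c_def)
      moreover have "i \<in> ?I" using i by (simp add: index_set_def)
      ultimately show ?thesis using sum_index_set[OF T _ st_i, of c] commuting(2) by simp
    next
      case even
      then have "{{s, t}} \<in> ?I" "{s, t} \<notin> ?E" using pairs_disjoint(3) by (auto simp: index_set_def)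
      then show ?thesis using sum_index_set[OF T, of "{{s, t}}" "{s, t}" c] even(2) by (simp add: c_def)
    next
      case odd
      show ?thesis
      proof (cases "{s, t} \<in> T")
        case True
        then have "{{s, t}} \<in> ?I" by (auto simp: index_set_def)
        then show ?thesis using sum_index_set[OF T, of "{{s, t}}" "{s, t}" c] odd st(3) by (simp add: c_def)
      next
        case False
        then show ?thesis using sum_index_set_other[OF T, of "{s, t}" c] h[of s t] odd by simp
      qed
    qed
    have "coboundary (artin_group S m) (\<lambda>g k. f g k + (\<Sum>i\<in>?I. c i * F i g k))"
    proof (rule coboundary_if_disc)
      show "cocycle (artin_group S m) (\<lambda>g k. f g k + (\<Sum>i\<in>?I. c i * F i g k))"
        by (intro cocycle_add f cocycle_sum F)
      fix s t k assume st: "s \<in> S" "t \<in> S" "s \<noteq> t" "m s t = enat k"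
      show "disc (\<lambda>g k. f g k + (\<Sum>i\<in>?I. c i * F i g k)) s t
        = (if odd k then (h s + (\<Sum>i\<in>?I. c i * e i s)) + (h t + (\<Sum>i\<in>?I. c i * e i t)) else 0)"
        unfolding disc_add discF[OF st] add.assoc[symmetric] D[OF st(1,2), symmetric] main[OF st]
        by (cases "odd k") (simp_all add: ac_simps)
    qed
    then show "\<exists>c. coboundary (artin_group S m) (\<lambda>g k. f g k + (\<Sum>i\<in>?I. c i * F i g k))" by blast
  next
    fix c assume "coboundary (artin_group S m) (\<lambda>g h. \<Sum>i\<in>?I. c i * F i g h)"
    from disc_coboundary[OF this] obtain h where
      h: "\<And>s t k. \<lbrakk>s \<in> S; t \<in> S; s \<noteq> t; m s t = enat k\<rbrakk> \<Longrightarrow>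
        disc (\<lambda>g h. \<Sum>i\<in>?I. c i * F i g h) s t = (if odd k then h s + h t else 0)" by blast
    \<comment> \<open>The vertex functions \<open>e i\<close> of the basis cocycles are absorbed
      into \<open>h\<close>.\<close>
    define h' where "h' s = h s + (\<Sum>i\<in>?I. c i * e i s)" for s
    have h': "(\<Sum>i\<in>?I. c i * of_bool ({s, t} \<in> i)) = (if odd k then h' s + h' t else 0)"
      if st: "s \<in> S" "t \<in> S" "s \<noteq> t" "m s t = enat k" for s t k
      using h[OF st] unfolding discF[OF st] by (auto simp: h'_def bit_swap_sides ac_simps)
    have odd: "s \<noteq> t \<and> s \<in> S \<and> t \<in> S \<and> (\<exists>k. m s t = enat k \<and> odd k)" if "{s, t} \<in> ?E" for s t
    proof -
      have "s \<in> S" "t \<in> S" using that by (auto simp: odd_edges_def doubleton_eq_iff)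
      then show ?thesis using that odd_edges_iff by (auto simp: odd_label_def)
    qed
    have "h' u = h' w" if uw: "{u, w} \<in> ?E - T" for u w
    proof -
      obtain k where "u \<noteq> w" "u \<in> S" "w \<in> S" "m u w = enat k" "odd k" using odd[of u w] uw by blast
      then show ?thesis using h'[of u w k] sum_index_set_other[OF T uw, of c] by (simp add: bit_add_eq_0)
    qed
    \<comment> \<open>No index contributes on the forest, so \<open>h'\<close> is constant along it
      and hence along every odd edge; this kills the coefficients at \<open>T\<close>.\<close>
    then have h'_const: "h' u = h' w" if "{u, w} \<in> ?E" for u w using const[THEN spec, of h'] that by blast
    show "\<forall>i\<in>?I. c i = 0"
    proof
      fix i assume i: "i \<in> ?I"
      obtain p where p: "p \<in> i" "p \<in> commuting_pairs S m \<union> even_pairs \<union> T" using index_setE[OF i] .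
      then obtain s t where st: "p = {s, t}" "s \<in> S" "t \<in> S" using pairE[of p] T by blast
      have ci: "(\<Sum>j\<in>?I. c j * of_bool ({s, t} \<in> j)) = c i" using sum_index_set[OF T i p(1)] st(1) by simp
      consider "m s t = 2" | "4 \<le> m s t" "even_label (m s t)" | "{s, t} \<in> ?E"
        using p(2) st commuting_pairs_iff[OF st(2,3)] even_pairs_iff[OF st(2,3)] T by blast
      then show "c i = 0"
      proof cases
        case 1
        then show ?thesis using h'[OF st(2,3) label_2[OF st(2) 1], of 2] ci by (simp add: numeral_eq_enat)
      next
        case 2
        then have "s \<noteq> t" using m_self[OF st(2)] by (auto simp: numeral_eq_enat one_enat_def)
        moreover obtain k where "m s t = enat k" "even k" using 2 by (auto simp: even_label_def)
        ultimately show ?thesis using h'[OF st(2,3), of k] ci by simp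
      next
        case 3
        obtain k where k: "s \<noteq> t" "m s t = enat k" "odd k" using odd[OF 3] by blast
        show ?thesis using h'[OF st(2,3) k(1,2)] h'_const[OF 3] k(3) ci by simp
      qed
    qed
  qed
  moreover have "card ?I = p_num S m + q_num S m"
    using card_index_set[OF T] abelian_rank_free_rank[OF rank] by (simp add: q_num_def q3_num_def)
  ultimately show ?thesis by simp
qed

end

theorem theorem1p1:
  fixes S :: "'s set" and m :: "'s \<Rightarrow> 's \<Rightarrow> enat"
  assumes "coxeter_matrix S m"
  shows "group_homology TYPE(bit) 2 (artin_group S m)
           \<cong> product_group {..<p_num S m + q_num S m} (\<lambda>_. integer_mod_group 2)"
  using coxeter.second_homology_artin[OF coxeter.intro[OF assms]] .

end
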